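(* Let $\mathcal M$ be a Riemannian manifold and let $F$ be a subequation on $\mathcal M$ for which comparison holds. Let $U\subset\mathcal M$ be a bounded domain such that $\overline U$ is a (compact) manifold with embedded corners, and assume that $F(U)$ and $\widetilde F(U)$ each contain at least one function bounded from below. Let $\phi$ be a consistent continuous function on $\partial U$. If $\partial U$ is strictly $(F,\phi)$-convex and strictly $(\widetilde F,-\phi)$-convex, then the $F$-Dirichlet problem for $(U,\phi)$ admits a unique solution in $C^0(\overline U)$; that is, there is a unique $u\in C^0(\overline U)$ that is $F$-harmonic on $U$ and satisfies $u=\phi$ on $\partial U$.
   Context: **Jets, subequations.** $J^2(\mathcal M)$ is the second-order jet bundle, identified via the Riemannian Hessian with $\mathbb{R}\oplus T^*\mathcal M\oplus\mathrm{Sym}^2(T^*\mathcal M)$, $J^2_xu=(u(x),(du)_x,\mathrm{Hess}_xu)$; $J^2_{\mathrm{red}}(\mathcal M)=T^*\mathcal M\oplus\mathrm{Sym}^2(T^*\mathcal M)$. A *subequation* is a subset $F\subset J^2(\mathcal M)$ (fibres $F_x$) with: (P) $F+P\subset F$, $P_x=\{(0,0,A):A\ge0\}$; (N) $F+N\subset F$, $N_x=\{(r,0,0):r\le0\}$; (T) $F=\overline{\mathrm{Int}F}$, $F_x=\overline{\mathrm{Int}F_x}$, $\mathrm{Int}F_x=(\mathrm{Int}F)_x$. Its dual is $\widetilde F=-(J^2(\mathcal M)\setminus\mathrm{Int}F)$. **Subharmonic functions, comparison.** For $V\subset\mathcal M$ open, an upper semicontinuous $u:V\to[-\infty,\infty)$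 is in $F(V)$ ($F$-subharmonic) if for each $x\in V$ and each $\varphi$ of class $C^2$ near $x$ with $u\le\varphi$ near $x$, $u(x)=\varphi(x)$, one has $J^2_x\varphi\in F_x$. For $K$ compact, $F(K)$ is the set of upper semicontinuous $u$ on $K$ with $u|_{\mathrm{Int}K}\in F(\mathrm{Int}K)$. $u$ is *$F$-harmonic* on $V$ if $u\in F(V)$ and $-u\in\widetilde F(V)$. *Comparison holds for $F$ on $\mathcal M$* if for all compact $K\subset\mathcal M$, $u\in F(K)$, $v\in\widetilde F(K)$: $u+v\le0$ on $\partial K$ implies $u+v\le0$ on $K$. **Corners.** (Joyce's conventions.) For a manifold with corners $\overline U$, the boundary $\partial U$ is itself a manifold with corners with a map $i_U:\partial U\to\overline U$, possibly not injective. $\overline U$ has *embedded corners* if $\partial U$ is a disjoint union of finitely many open and closed subsets (components $\partial U_i$) on each of which $i_U$ is injective. A function on $\partial U$ is *consistent* if it is constant on the fibres of $i_U$. **Convexity.** For $\lambda\in\mathbb{R}$ let $F_\lambda\subset J^2_{\mathrm{red}}(\mathcal M)$ be given by $\{\lambda\}\times F_\lambda=F\cap(\{\lambda\}\times J^2_{\mathrm{red}}(\mathcal M))$. The *asymptotic interior* $\vec G$ of $G\subset J^2_{\mathrm{red}}(\mathcal M)$ is the set of $J$ having a neighbourhood $\mathcal N(J)$ in the total space of $J^2_{\mathrm{red}}(\mathcal M)$ and $t_0>0$ with $t\cdot\mathcal N(J)\subset G$ for all $t\ge t_0$. A boundary component $\partial U_i$ is *strictly $F$-convex* if at each $x\in\partial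 U_i$ and for each $\lambda\in\mathbb{R}$ there is a local defining function $\rho$ for $\partial U_i$ near $x$ (smooth near $x$, $\rho=0$ exactly on $\partial U_i$, $d\rho\ne0$ there, $\rho<0$ on $U$) with $J^2_{\mathrm{red},x}\rho\in(\vec{F_\lambda})_x$. A *subsolution* of the $F$-Dirichlet problem for $(U,\phi)$ is an upper semicontinuous function $u$ on $\overline U$ with $u|_U\in F(U)$ and $u|_{\partial U}\le\phi$; it is *$\delta$-maximal* at $p\in\partial U$ if $u(p)\ge\phi(p)-\delta$. $\partial U$ is *strictly $(F,\phi)$-convex* if $\partial U=A\sqcup B$ with $A,B$ unions of components such that: (1) for each $p\in A$ and $\delta>0$ there is a $C^0(\overline U)$ subsolution of the $F$-Dirichlet problem for $(U,\phi)$ that is $\delta$-maximal at $p$; (2) $B$ is strictly $F$-convex. Strict $(\widetilde F,-\phi)$-convexity is the same with $(\widetilde F,-\phi)$ in place of $(F,\phi)$. *)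

theory Defs
  imports "HOL-Analysis.Analysis"
begin

section \<open>Functions of class $C^k$ on open subsets of a Euclidean space\<close>

text \<open>
  For an open set in a finite-dimensional space this is the usual class $C^k$: the
  directional derivatives in all fixed directions are of class $C^{k-1}$.
\<close>

primrec Ck_on :: "nat \<Rightarrow> 'e::euclidean_space set \<Rightarrow> ('e \<Rightarrow> 'b::real_normed_vector) \<Rightarrow> bool" where
  "Ck_on 0 S f \<longleftrightarrow> continuous_on S f"
| "Ck_on (Suc k) S f \<longleftrightarrow>
     (\<forall>x\<in>S. f differentiable (at x)) \<and> (\<forall>v. Ck_on k S (\<lambda>x. frechet_derivative f (at x) v))"

definition smooth_on :: "'e::euclidean_space set \<Rightarrow> ('e \<Rightarrow> 'b::real_normed_vector) \<Rightarrow> bool" where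
  "smooth_on S f \<longleftrightarrow> (\<forall>k. Ck_on k S f)"


section \<open>Smooth manifolds\<close>

text \<open>
  The manifold is a whole (Hausdorff, second countable) topological type, modelled on a
  Euclidean space \<^typ>\<open>'e\<close>; its smooth structure is a maximal atlas.  A chart is a pair of an
  open domain and a map, whose values outside the domain are irrelevant.
\<close>

type_synonym ('m, 'e) chart = "'m set \<times> ('m \<Rightarrow> 'e)"

definition chart_inv :: "('m, 'e) chart \<Rightarrow> 'e \<Rightarrow> 'm" where
  "chart_inv c = inv_into (fst c) (snd c)"

definition is_chart :: "('m::topological_space, 'e::euclidean_space) chart \<Rightarrow> bool" where
  "is_chart c \<longleftrightarrow> open (fst c) \<and> open (snd c ` fst c) \<and>
     homeomorphism (fst c) (snd c ` fst c) (snd c) (chart_inv c)"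

definition compatible_charts ::
  "('m, 'e::euclidean_space) chart \<Rightarrow> ('m, 'e) chart \<Rightarrow> bool" where
  "compatible_charts c c' \<longleftrightarrow>
     smooth_on (snd c ` (fst c \<inter> fst c')) (snd c' \<circ> chart_inv c) \<and>
     smooth_on (snd c' ` (fst c \<inter> fst c')) (snd c \<circ> chart_inv c')"

definition smooth_structure ::
  "('m::{t2_space,second_countable_topology}, 'e::euclidean_space) chart set \<Rightarrow> bool" where
  "smooth_structure \<A> \<longleftrightarrow>
     (\<forall>c\<in>\<A>. is_chart c) \<and>
     (\<Union>c\<in>\<A>. fst c) = UNIV \<and>
     (\<forall>c\<in>\<A>. \<forall>c'\<in>\<A>. compatible_charts c c') \<and>
     (\<forall>c. is_chart c \<and> (\<forall>c'\<in>\<A>. compatible_charts c c') \<longrightarrow> c \<in> \<A>)"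

definition charts_at :: "('m, 'e) chart set \<Rightarrow> 'm \<Rightarrow> ('m, 'e) chart set" where
  "charts_at \<A> x = {c \<in> \<A>. x \<in> fst c}"

definition Ck_fun_on ::
  "('m, 'e::euclidean_space) chart set \<Rightarrow> nat \<Rightarrow> 'm set \<Rightarrow> ('m \<Rightarrow> real) \<Rightarrow> bool" where
  "Ck_fun_on \<A> k W f \<longleftrightarrow> (\<forall>c\<in>\<A>. Ck_on k (snd c ` (W \<inter> fst c)) (f \<circ> chart_inv c))"

definition smooth_fun_on ::
  "('m, 'e::euclidean_space) chart set \<Rightarrow> 'm set \<Rightarrow> ('m \<Rightarrow> real) \<Rightarrow> bool" where
  "smooth_fun_on \<A> W f \<longleftrightarrow> (\<forall>k. Ck_fun_on \<A> k W f)"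


section \<open>Covectors, symmetric 2-tensors and Riemannian metrics\<close>

text \<open>
  Tensors at a point are given by their coordinate expressions in all charts around the point,
  subject to the transformation law; the expression is 0 for charts not around the point, which
  makes the representation unique.
\<close>

type_synonym ('m, 'e) covector = "('m, 'e) chart \<Rightarrow> 'e \<Rightarrow>\<^sub>L real"
type_synonym ('m, 'e) tensor2 = "('m, 'e) chart \<Rightarrow> 'e \<Rightarrow>\<^sub>L 'e \<Rightarrow>\<^sub>L real"

definition tangent_transition ::
  "('m, 'e::euclidean_space) chart \<Rightarrow> ('m, 'e) chart \<Rightarrow> 'm \<Rightarrow> 'e \<Rightarrow> 'e" where
  "tangent_transition c c' x = frechet_derivative (snd c' \<circ> chart_inv c) (at (snd c x))"

definition covectors ::
  "('m, 'e::euclidean_space) chart set \<Rightarrow> 'm \<Rightarrow> ('m, 'e) covector set" where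
  "covectors \<A> x = {p.
     (\<forall>c. c \<notin> charts_at \<A> x \<longrightarrow> p c = 0) \<and>
     (\<forall>c\<in>charts_at \<A> x. \<forall>c'\<in>charts_at \<A> x. \<forall>v.
        blinfun_apply (p c) v = blinfun_apply (p c') (tangent_transition c c' x v))}"

definition sym2 ::
  "('m, 'e::euclidean_space) chart set \<Rightarrow> 'm \<Rightarrow> ('m, 'e) tensor2 set" where
  "sym2 \<A> x = {A.
     (\<forall>c. c \<notin> charts_at \<A> x \<longrightarrow> A c = 0) \<and>
     (\<forall>c\<in>charts_at \<A> x. \<forall>v w.
        blinfun_apply (blinfun_apply (A c) v) w = blinfun_apply (blinfun_apply (A c) w) v) \<and>
     (\<forall>c\<in>charts_at \<A> x. \<forall>c'\<in>charts_at \<A> x. \<forall>v w.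
        blinfun_apply (blinfun_apply (A c) v) w =
        blinfun_apply (blinfun_apply (A c') (tangent_transition c c' x v))
          (tangent_transition c c' x w))}"

definition sym2_nonneg ::
  "('m, 'e::euclidean_space) chart set \<Rightarrow> 'm \<Rightarrow> ('m, 'e) tensor2 set" where
  "sym2_nonneg \<A> x =
     {A \<in> sym2 \<A> x. \<forall>c\<in>charts_at \<A> x. \<forall>v. 0 \<le> blinfun_apply (blinfun_apply (A c) v) v}"

definition riemannian_metric ::
  "('m, 'e::euclidean_space) chart set \<Rightarrow> ('m \<Rightarrow> ('m, 'e) tensor2) \<Rightarrow> bool" where
  "riemannian_metric \<A> g \<longleftrightarrow>
     (\<forall>x. g x \<in> sym2 \<A> x) \<and>
     (\<forall>x. \<forall>c\<in>charts_at \<A> x. \<forall>v. v \<noteq> 0 \<longrightarrow> 0 < blinfun_apply (blinfun_apply (g x c) v) v) \<and>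
     (\<forall>c\<in>\<A>. smooth_on (snd c ` fst c) (\<lambda>y. g (chart_inv c y) c))"

definition metric_at ::
  "('m \<Rightarrow> ('m, 'e::euclidean_space) tensor2) \<Rightarrow> ('m, 'e) chart \<Rightarrow> 'e \<Rightarrow> 'e \<Rightarrow> 'e \<Rightarrow> real" where
  "metric_at g c y v w = blinfun_apply (blinfun_apply (g (chart_inv c y) c) v) w"

text \<open>
  Christoffel symbols of the Levi-Civita connection, as the vector-valued bilinear map
  $(v,w) \mapsto \Gamma^k_{ij} v^i w^j$, through
  $g_{kl}\Gamma^l_{ij} = \frac12(\partial_i g_{jk} + \partial_j g_{ik} - \partial_k g_{ij})$.
\<close>

definition christoffel ::
  "('m \<Rightarrow> ('m, 'e::euclidean_space) tensor2) \<Rightarrow> ('m, 'e) chart \<Rightarrow> 'e \<Rightarrow> 'e \<Rightarrow> 'e \<Rightarrow> 'e" where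
  "christoffel g c y v w = (THE z. \<forall>k. metric_at g c y z k =
     (frechet_derivative (\<lambda>y'. metric_at g c y' w k) (at y) v
      + frechet_derivative (\<lambda>y'. metric_at g c y' v k) (at y) w
      - frechet_derivative (\<lambda>y'. metric_at g c y' v w) (at y) k) / 2)"

definition differential ::
  "('m, 'e::euclidean_space) chart set \<Rightarrow> 'm \<Rightarrow> ('m \<Rightarrow> real) \<Rightarrow> ('m, 'e) covector" where
  "differential \<A> x f = (\<lambda>c. if c \<in> charts_at \<A> x
     then Blinfun (frechet_derivative (f \<circ> chart_inv c) (at (snd c x))) else 0)"

text \<open>$(\mathrm{Hess} f)_{ij} = \partial_i\partial_j f - \Gamma^k_{ij}\partial_k f$ in coordinates.\<close>

definition hessian ::
  "('m, 'e::euclidean_space) chart set \<Rightarrow> ('m \<Rightarrow> ('m, 'e) tensor2) \<Rightarrow> 'm \<Rightarrow> ('m \<Rightarrow> real)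
     \<Rightarrow> ('m, 'e) tensor2" where
  "hessian \<A> g x f = (\<lambda>c. if c \<in> charts_at \<A> x
     then Blinfun (\<lambda>v. Blinfun (\<lambda>w.
       frechet_derivative (\<lambda>y. frechet_derivative (f \<circ> chart_inv c) (at y) w) (at (snd c x)) v
       - frechet_derivative (f \<circ> chart_inv c) (at (snd c x)) (christoffel g c (snd c x) v w)))
     else 0)"


section \<open>Jet bundles\<close>

text \<open>
  Elements of the total spaces of
  $J^2 = \mathbb{R} \oplus T^* \oplus \mathrm{Sym}^2(T^*)$ and
  $J^2_{\mathrm{red}} = T^* \oplus \mathrm{Sym}^2(T^*)$ carry their base point as first component.
\<close>

type_synonym ('m, 'e) jet = "'m \<times> real \<times> ('m, 'e) covector \<times> ('m, 'e) tensor2"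
type_synonym ('m, 'e) red_jet = "'m \<times> ('m, 'e) covector \<times> ('m, 'e) tensor2"

definition jet_bundle :: "('m, 'e::euclidean_space) chart set \<Rightarrow> ('m, 'e) jet set" where
  "jet_bundle \<A> = {(x, r, p, A). p \<in> covectors \<A> x \<and> A \<in> sym2 \<A> x}"

definition red_jet_bundle :: "('m, 'e::euclidean_space) chart set \<Rightarrow> ('m, 'e) red_jet set" where
  "red_jet_bundle \<A> = {(x, p, A). p \<in> covectors \<A> x \<and> A \<in> sym2 \<A> x}"

definition jet_fibre :: "('m, 'e::euclidean_space) chart set \<Rightarrow> 'm \<Rightarrow> ('m, 'e) jet set" where
  "jet_fibre \<A> x = {j \<in> jet_bundle \<A>. fst j = x}"

text \<open>The topology for which the local trivializations over charts are homeomorphisms.\<close>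

definition jet_topology :: "('m, 'e::euclidean_space) chart set \<Rightarrow> ('m, 'e) jet topology" where
  "jet_topology \<A> = topology_generated_by
     {{(x, r, p, A). (x, r, p, A) \<in> jet_bundle \<A> \<and> x \<in> fst c \<and> (snd c x, r, p c, A c) \<in> Q}
      | c Q. c \<in> \<A> \<and> open Q}"

definition red_jet_topology ::
  "('m, 'e::euclidean_space) chart set \<Rightarrow> ('m, 'e) red_jet topology" where
  "red_jet_topology \<A> = topology_generated_by
     {{(x, p, A). (x, p, A) \<in> red_jet_bundle \<A> \<and> x \<in> fst c \<and> (snd c x, p c, A c) \<in> Q}
      | c Q. c \<in> \<A> \<and> open Q}"

definition jet2 ::
  "('m, 'e::euclidean_space) chart set \<Rightarrow> ('m \<Rightarrow> ('m, 'e) tensor2) \<Rightarrow> 'm \<Rightarrow> ('m \<Rightarrow> real)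
     \<Rightarrow> ('m, 'e) jet" where
  "jet2 \<A> g x f = (x, f x, differential \<A> x f, hessian \<A> g x f)"

definition red_jet2 ::
  "('m, 'e::euclidean_space) chart set \<Rightarrow> ('m \<Rightarrow> ('m, 'e) tensor2) \<Rightarrow> 'm \<Rightarrow> ('m \<Rightarrow> real)
     \<Rightarrow> ('m, 'e) red_jet" where
  "red_jet2 \<A> g x f = (x, differential \<A> x f, hessian \<A> g x f)"

definition neg_jet :: "('m, 'e::euclidean_space) jet \<Rightarrow> ('m, 'e) jet" where
  "neg_jet = (\<lambda>(x, r, p, A). (x, - r, (\<lambda>c. - p c), (\<lambda>c. - A c)))"

definition scale_red_jet :: "real \<Rightarrow> ('m, 'e::euclidean_space) red_jet \<Rightarrow> ('m, 'e) red_jet" where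
  "scale_red_jet t = (\<lambda>(x, p, A). (x, (\<lambda>c. t *\<^sub>R p c), (\<lambda>c. t *\<^sub>R A c)))"


section \<open>Subequations, subharmonic functions, comparison\<close>

definition subequation ::
  "('m, 'e::euclidean_space) chart set \<Rightarrow> ('m, 'e) jet set \<Rightarrow> bool" where
  "subequation \<A> F \<longleftrightarrow>
     F \<subseteq> jet_bundle \<A> \<and>
     (\<forall>x r p A B. (x, r, p, A) \<in> F \<and> B \<in> sym2_nonneg \<A> x \<longrightarrow> (x, r, p, (\<lambda>c. A c + B c)) \<in> F) \<and>
     (\<forall>x r p A s. (x, r, p, A) \<in> F \<and> s \<le> 0 \<longrightarrow> (x, r + s, p, A) \<in> F) \<and>
     F = jet_topology \<A> closure_of (jet_topology \<A> interior_of F) \<and>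
     (\<forall>x. let T = subtopology (jet_topology \<A>) (jet_fibre \<A> x); Fx = F \<inter> jet_fibre \<A> x in
        Fx = T closure_of (T interior_of Fx) \<and>
        T interior_of Fx = (jet_topology \<A> interior_of F) \<inter> jet_fibre \<A> x)"

definition dual_subequation ::
  "('m, 'e::euclidean_space) chart set \<Rightarrow> ('m, 'e) jet set \<Rightarrow> ('m, 'e) jet set" where
  "dual_subequation \<A> F = neg_jet ` (jet_bundle \<A> - jet_topology \<A> interior_of F)"

text \<open>Upper semicontinuous functions with values in $[-\infty,\infty)$.\<close>

definition usc_on :: "'m::topological_space set \<Rightarrow> ('m \<Rightarrow> ereal) \<Rightarrow> bool" where
  "usc_on S u \<longleftrightarrow> (\<forall>x\<in>S. u x < \<infinity>) \<and> (\<forall>a. openin (top_of_set S) {x \<in> S. u x < a})"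

text \<open>$u \in F(V)$ for an open set $V$.\<close>

definition subharmonic_on ::
  "('m::topological_space, 'e::euclidean_space) chart set \<Rightarrow> ('m \<Rightarrow> ('m, 'e) tensor2)
     \<Rightarrow> ('m, 'e) jet set \<Rightarrow> 'm set \<Rightarrow> ('m \<Rightarrow> ereal) \<Rightarrow> bool" where
  "subharmonic_on \<A> g F V u \<longleftrightarrow> usc_on V u \<and>
     (\<forall>x\<in>V. \<forall>\<phi> W. open W \<and> x \<in> W \<and> W \<subseteq> V \<and> Ck_fun_on \<A> 2 W \<phi> \<and>
        (\<forall>y\<in>W. u y \<le> ereal (\<phi> y)) \<and> u x = ereal (\<phi> x) \<longrightarrow> jet2 \<A> g x \<phi> \<in> F)"

text \<open>$u \in F(K)$ for a compact set $K$.\<close>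

definition subharmonic_on_compact ::
  "('m::topological_space, 'e::euclidean_space) chart set \<Rightarrow> ('m \<Rightarrow> ('m, 'e) tensor2)
     \<Rightarrow> ('m, 'e) jet set \<Rightarrow> 'm set \<Rightarrow> ('m \<Rightarrow> ereal) \<Rightarrow> bool" where
  "subharmonic_on_compact \<A> g F K u \<longleftrightarrow> usc_on K u \<and> subharmonic_on \<A> g F (interior K) u"

definition harmonic_on ::
  "('m::topological_space, 'e::euclidean_space) chart set \<Rightarrow> ('m \<Rightarrow> ('m, 'e) tensor2)
     \<Rightarrow> ('m, 'e) jet set \<Rightarrow> 'm set \<Rightarrow> ('m \<Rightarrow> ereal) \<Rightarrow> bool" where
  "harmonic_on \<A> g F V u \<longleftrightarrow>
     subharmonic_on \<A> g F V u \<and> subharmonic_on \<A> g (dual_subequation \<A> F) V (\<lambda>x. - u x)"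

definition comparison_holds ::
  "('m::topological_space, 'e::euclidean_space) chart set \<Rightarrow> ('m \<Rightarrow> ('m, 'e) tensor2)
     \<Rightarrow> ('m, 'e) jet set \<Rightarrow> bool" where
  "comparison_holds \<A> g F \<longleftrightarrow>
     (\<forall>K u v. compact K \<and> subharmonic_on_compact \<A> g F K u \<and>
        subharmonic_on_compact \<A> g (dual_subequation \<A> F) K v \<and>
        (\<forall>x\<in>frontier K. u x + v x \<le> 0) \<longrightarrow> (\<forall>x\<in>K. u x + v x \<le> 0))"


section \<open>Codimension-zero submanifolds with corners and their boundary\<close>

text \<open>
  A corner chart of \<^term>\<open>X\<close> at \<^term>\<open>x\<close> is an ambient chart sending \<^term>\<open>x\<close> to a point whose
  coordinates indexed by \<^term>\<open>I\<close> vanish, and in which \<^term>\<open>X\<close> is given by nonnegativity of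
  these coordinates.  The number of elements of \<^term>\<open>I\<close> is the depth of \<^term>\<open>x\<close>.
\<close>

definition corner_chart ::
  "('m, 'e::euclidean_space) chart set \<Rightarrow> 'm set \<Rightarrow> 'm \<Rightarrow> 'e set \<Rightarrow> ('m, 'e) chart \<Rightarrow> bool" where
  "corner_chart \<A> X x I c \<longleftrightarrow> c \<in> charts_at \<A> x \<and> I \<subseteq> Basis \<and>
     (\<forall>i\<in>I. snd c x \<bullet> i = 0) \<and>
     snd c ` (X \<inter> fst c) = {y \<in> snd c ` fst c. \<forall>i\<in>I. 0 \<le> y \<bullet> i}"

definition manifold_with_corners ::
  "('m, 'e::euclidean_space) chart set \<Rightarrow> 'm set \<Rightarrow> bool" where
  "manifold_with_corners \<A> X \<longleftrightarrow> (\<forall>x\<in>X. \<exists>I c. corner_chart \<A> X x I c)"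

definition depth1_stratum :: "('m, 'e::euclidean_space) chart set \<Rightarrow> 'm set \<Rightarrow> 'm set" where
  "depth1_stratum \<A> X = {x \<in> X. \<exists>I c. corner_chart \<A> X x I c \<and> card I = 1}"

text \<open>
  Joyce's local boundary components of \<^term>\<open>X\<close> at \<^term>\<open>x\<close>: compatible choices \<^term>\<open>\<beta> V\<close> of
  connected components of the depth 1 stratum in the neighbourhoods \<^term>\<open>V\<close> of \<^term>\<open>x\<close>.
  A compatible choice on the sufficiently small neighbourhoods extends uniquely to all
  neighbourhoods, so asking for all of them makes \<^term>\<open>\<beta>\<close> canonical.
\<close>

definition local_boundary_component ::
  "('m::topological_space, 'e::euclidean_space) chart set \<Rightarrow> 'm set \<Rightarrow> 'm
     \<Rightarrow> ('m set \<Rightarrow> 'm set) \<Rightarrow> bool" where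
  "local_boundary_component \<A> X x \<beta> \<longleftrightarrow>
     (let nbhds = {V. openin (top_of_set X) V \<and> x \<in> V} in
       (\<forall>V\<in>nbhds. \<beta> V \<in> components (V \<inter> depth1_stratum \<A> X) \<and> x \<in> closure (\<beta> V)) \<and>
       (\<forall>V\<in>nbhds. \<forall>V'\<in>nbhds. x \<in> closure (\<beta> V \<inter> \<beta> V')) \<and>
       (\<forall>V. V \<notin> nbhds \<longrightarrow> \<beta> V = {}))"

text \<open>The boundary, whose structure map to \<^term>\<open>X\<close> is \<^const>\<open>fst\<close>.\<close>

type_synonym 'm bdry_point = "'m \<times> ('m set \<Rightarrow> 'm set)"

definition bdry ::
  "('m::topological_space, 'e::euclidean_space) chart set \<Rightarrow> 'm set \<Rightarrow> 'm bdry_point set" where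
  "bdry \<A> X = {(x, \<beta>). x \<in> X \<and> local_boundary_component \<A> X x \<beta>}"

text \<open>
  For \<^term>\<open>V\<close> the domain of a cubical corner chart these generating sets are precisely the
  domains $\{y_i = 0\}$ of the induced charts of the boundary.
\<close>

definition bdry_topology ::
  "('m::topological_space, 'e::euclidean_space) chart set \<Rightarrow> 'm set \<Rightarrow> 'm bdry_point topology" where
  "bdry_topology \<A> X = topology_generated_by
     {{(x, \<beta>). (x, \<beta>) \<in> bdry \<A> X \<and> x \<in> V \<and> \<beta> V = W}
      | V W. openin (top_of_set X) V \<and> W \<in> components (V \<inter> depth1_stratum \<A> X)}"

text \<open>
  \<^term>\<open>X\<close> has embedded corners, witnessed by the finite decomposition \<^term>\<open>\<C>\<close> of its boundary
  into the components $\partial U_i$.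
\<close>

definition embedded_corners ::
  "('m::topological_space, 'e::euclidean_space) chart set \<Rightarrow> 'm set \<Rightarrow> 'm bdry_point set set
     \<Rightarrow> bool" where
  "embedded_corners \<A> X \<C> \<longleftrightarrow>
     manifold_with_corners \<A> X \<and> finite \<C> \<and> partition_on (bdry \<A> X) \<C> \<and>
     (\<forall>C\<in>\<C>. openin (bdry_topology \<A> X) C \<and> closedin (bdry_topology \<A> X) C \<and> inj_on fst C)"

definition consistent ::
  "('m::topological_space, 'e::euclidean_space) chart set \<Rightarrow> 'm set \<Rightarrow> ('m bdry_point \<Rightarrow> real)
     \<Rightarrow> bool" where
  "consistent \<A> X \<phi> \<longleftrightarrow> (\<forall>b\<in>bdry \<A> X. \<forall>b'\<in>bdry \<A> X. fst b = fst b' \<longrightarrow> \<phi> b = \<phi> b')"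


section \<open>Boundary convexity\<close>

definition fibre_at_value :: "('m, 'e::euclidean_space) jet set \<Rightarrow> real \<Rightarrow> ('m, 'e) red_jet set" where
  "fibre_at_value F r = {(x, p, A). (x, r, p, A) \<in> F}"

definition asymptotic_interior ::
  "('m, 'e::euclidean_space) chart set \<Rightarrow> ('m, 'e) red_jet set \<Rightarrow> ('m, 'e) red_jet set" where
  "asymptotic_interior \<A> G = {J. \<exists>N t0. openin (red_jet_topology \<A>) N \<and> J \<in> N \<and> 0 < t0 \<and>
     (\<forall>t\<ge>t0. scale_red_jet t ` N \<subseteq> G)}"

text \<open>
  \<^term>\<open>E\<close> is the image in \<^term>\<open>closure U\<close> of a boundary component.  Near a corner it is only a
  part of a hypersurface, so ``$\rho = 0$ exactly on \<^term>\<open>E\<close>'' refers to points of the closure.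
\<close>

definition local_defining_function ::
  "('m::topological_space, 'e::euclidean_space) chart set \<Rightarrow> 'm set \<Rightarrow> 'm set \<Rightarrow> 'm
     \<Rightarrow> ('m \<Rightarrow> real) \<Rightarrow> bool" where
  "local_defining_function \<A> U E x \<rho> \<longleftrightarrow>
     (\<exists>W. open W \<and> x \<in> W \<and> smooth_fun_on \<A> W \<rho> \<and>
        (\<forall>y \<in> W \<inter> closure U. \<rho> y = 0 \<longleftrightarrow> y \<in> E) \<and>
        (\<forall>y \<in> W \<inter> E. differential \<A> y \<rho> \<noteq> (\<lambda>c. 0)) \<and>
        (\<forall>y \<in> W \<inter> U. \<rho> y < 0))"

definition strictly_convex_component ::
  "('m::topological_space, 'e::euclidean_space) chart set \<Rightarrow> ('m \<Rightarrow> ('m, 'e) tensor2)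
     \<Rightarrow> ('m, 'e) jet set \<Rightarrow> 'm set \<Rightarrow> 'm bdry_point set \<Rightarrow> bool" where
  "strictly_convex_component \<A> g F U C \<longleftrightarrow>
     (\<forall>x \<in> fst ` C. \<forall>r::real. \<exists>\<rho>. local_defining_function \<A> U (fst ` C) x \<rho> \<and>
        red_jet2 \<A> g x \<rho> \<in> asymptotic_interior \<A> (fibre_at_value F r))"

definition subsolution ::
  "('m::topological_space, 'e::euclidean_space) chart set \<Rightarrow> ('m \<Rightarrow> ('m, 'e) tensor2)
     \<Rightarrow> ('m, 'e) jet set \<Rightarrow> 'm set \<Rightarrow> ('m bdry_point \<Rightarrow> real) \<Rightarrow> ('m \<Rightarrow> ereal) \<Rightarrow> bool" where
  "subsolution \<A> g F U \<phi> u \<longleftrightarrow>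
     usc_on (closure U) u \<and> subharmonic_on \<A> g F U u \<and>
     (\<forall>b \<in> bdry \<A> (closure U). u (fst b) \<le> ereal (\<phi> b))"

definition delta_maximal ::
  "('m bdry_point \<Rightarrow> real) \<Rightarrow> real \<Rightarrow> 'm bdry_point \<Rightarrow> ('m \<Rightarrow> ereal) \<Rightarrow> bool" where
  "delta_maximal \<phi> \<delta> b u \<longleftrightarrow> ereal (\<phi> b - \<delta>) \<le> u (fst b)"

definition strictly_convex_boundary ::
  "('m::topological_space, 'e::euclidean_space) chart set \<Rightarrow> ('m \<Rightarrow> ('m, 'e) tensor2)
     \<Rightarrow> ('m, 'e) jet set \<Rightarrow> 'm set \<Rightarrow> 'm bdry_point set set \<Rightarrow> ('m bdry_point \<Rightarrow> real) \<Rightarrow> bool" where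
  "strictly_convex_boundary \<A> g F U \<C> \<phi> \<longleftrightarrow>
     (\<exists>\<C>A \<C>B. \<C>A \<union> \<C>B = \<C> \<and> \<C>A \<inter> \<C>B = {} \<and>
        (\<forall>b \<in> \<Union>\<C>A. \<forall>\<delta>>0. \<exists>w :: 'm \<Rightarrow> real. continuous_on (closure U) w \<and>
           subsolution \<A> g F U \<phi> (\<lambda>x. ereal (w x)) \<and>
           delta_maximal \<phi> \<delta> b (\<lambda>x. ereal (w x))) \<and>
        (\<forall>C \<in> \<C>B. strictly_convex_component \<A> g F U C))"

definition dirichlet_solution ::
  "('m::topological_space, 'e::euclidean_space) chart set \<Rightarrow> ('m \<Rightarrow> ('m, 'e) tensor2)
     \<Rightarrow> ('m, 'e) jet set \<Rightarrow> 'm set \<Rightarrow> ('m bdry_point \<Rightarrow> real) \<Rightarrow> ('m \<Rightarrow> real) \<Rightarrow> bool" where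
  "dirichlet_solution \<A> g F U \<phi> u \<longleftrightarrow>
     continuous_on (closure U) u \<and> harmonic_on \<A> g F U (\<lambda>x. ereal (u x)) \<and>
     (\<forall>b \<in> bdry \<A> (closure U). u (fst b) = \<phi> b)"

end

theory Submission
  imports Defs
begin

text \<open>
  Perron's method.  Let \<open>u\<close> be the upper semicontinuous regularization of the supremum of all
  subsolutions and \<open>v\<close> that of \<open>- u\<close>.  The closedness of \<open>F\<close> makes \<open>u\<close> \<open>F\<close>-subharmonic.
  If \<open>v\<close> were not subharmonic for the dual, a test function would have a jet in the interior of \<open>F\<close>,
  and a small bump of it would enlarge \<open>u\<close>.  The two convexity assumptions give barriers at every
  boundary point; compared with the competitors by means of the comparison principle, they show
  that \<open>u \<le> \<phi>\<close> and \<open>v \<le> - \<phi>\<close> on the boundary.  Comparison then yields \<open>u + v \<le> 0\<close>, so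
  that \<open>u = - v\<close> is continuous.
\<close>

section \<open>Calculus of $C^k$ functions\<close>

text \<open>Boundary data live on germs of boundary components, whereas Perron's method needs a
  function on points. Consistency lets \<open>\<phi>\<close> descend to a continuous
  \<open>h\<close> on \<open>closure U - U\<close>; after that corners hardly matter, because a
  barrier needs the right sign on \<open>closure U\<close> only, so a defining function of any one
  component through a corner point suffices. The obstacle is a competitor bounded below. The given
  subharmonic function may be unbounded near the boundary and knows nothing of \<open>h\<close>. If
  no component carries subsolutions, it is shifted down and replaced near the boundary by finitely
  many steep barriers. A bounded competitor has two uses: glued with a local barrier it gives a
  global competitor, and the one for the dual bounds the Perron family from above. Jets are defined
  chart by chart, so their tensor law and their continuity in the point must be derived first: every
  contradiction below perturbs a test function by a multiple of a squared chart distance and a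
  constant, and relies on open jet conditions surviving this.\<close>

abbreviation dirD :: "('e::real_normed_vector \<Rightarrow> 'b::real_normed_vector) \<Rightarrow> 'e \<Rightarrow> 'e \<Rightarrow> 'b" where
  "dirD f v \<equiv> (\<lambda>x. frechet_derivative f (at x) v)"

lemma Ck_on_subset: "Ck_on k S f \<Longrightarrow> T \<subseteq> S \<Longrightarrow> Ck_on k T f"
  by (induction k arbitrary: f) (auto intro: continuous_on_subset)

lemma dirD_cong:
  assumes "open S" "x \<in> S" "\<And>y. y \<in> S \<Longrightarrow> f y = g y" "f differentiable (at x)"
  shows "dirD f v x = dirD g v x"
  using frechet_derivative_transform_within_open[OF assms(4,1,2,3)] by simp

lemma differentiable_cong_open:
  assumes "open S" "x \<in> S" "\<And>y. y \<in> S \<Longrightarrow> f y = g y" "f differentiable (at x)"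
  shows "g differentiable (at x)"
  using assms has_derivative_transform_within_open[of f _ x UNIV S g]
  unfolding differentiable_def by metis

text \<open>Derivatives are taken in the full space, so agreement on \<open>S\<close> controls them
  only because \<open>S\<close> is open.\<close>

lemma Ck_on_cong:
  assumes "open S" "\<And>x. x \<in> S \<Longrightarrow> f x = g x" "Ck_on k S f"
  shows "Ck_on k S g"
  using assms(2,3)
proof (induction k arbitrary: f g)
  case 0
  then show ?case by (metis Ck_on.simps(1) continuous_on_cong)
next
  case (Suc k)
  have "g differentiable (at x)" if "x \<in> S" for x
    using differentiable_cong_open[OF assms(1) that Suc.prems(1)] Suc.prems(2) that by simp
  moreover have "Ck_on k S (dirD g v)" for v
  proof (rule Suc.IH)
    show "dirD f v x = dirD g v x" if "x \<in> S" for x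
      by (rule dirD_cong[OF assms(1) that Suc.prems(1)]) (use Suc.prems that in auto)
    show "Ck_on k S (dirD f v)" using Suc.prems by simp
  qed
  ultimately show ?case by simp
qed

lemma Ck_on_SucD: "open S \<Longrightarrow> Ck_on (Suc k) S f \<Longrightarrow> Ck_on k S f"
proof (induction k arbitrary: f)
  case 0
  then show ?case
    by (auto intro!: continuous_at_imp_continuous_on differentiable_imp_continuous_within)
next
  case (Suc k)
  then show ?case by (metis Ck_on.simps(2))
qed

lemma frechet_derivative_eqI: "(f has_derivative f') (at x) \<Longrightarrow> frechet_derivative f (at x) = f'"
  using frechet_derivative_at by metis

lemma has_derivative_dirD: "f differentiable (at x) \<Longrightarrow> (f has_derivative (\<lambda>v. dirD f v x)) (at x)"
  using frechet_derivative_works by blast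

lemma Ck_on_const: "Ck_on k S (\<lambda>x. c)"
  by (induction k arbitrary: c) (auto simp: frechet_derivative_const)

lemma Ck_on_add:
  assumes "open S"
  shows "Ck_on k S f \<Longrightarrow> Ck_on k S g \<Longrightarrow> Ck_on k S (\<lambda>x. f x + g x)"
proof (induction k arbitrary: f g)
  case 0
  then show ?case by (auto intro: continuous_intros)
next
  case (Suc k)
  have *: "dirD (\<lambda>x. f x + g x) v x = dirD f v x + dirD g v x" if "x \<in> S" for x v
  proof -
    have "((\<lambda>x. f x + g x) has_derivative (\<lambda>v. dirD f v x + dirD g v x)) (at x)"
      using Suc.prems that by (intro has_derivative_add has_derivative_dirD) auto
    then show ?thesis using frechet_derivative_eqI by metis
  qed
  have "Ck_on k S (dirD (\<lambda>x. f x + g x) v)" for v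
    by (rule Ck_on_cong[OF assms(1), where f="\<lambda>x. dirD f v x + dirD g v x"])
       (use * Suc in \<open>auto\<close>)
  then show ?case using Suc.prems by auto
qed

lemma Ck_on_bounded_linear:
  assumes "open S" "bounded_linear h"
  shows "Ck_on k S f \<Longrightarrow> Ck_on k S (\<lambda>x. h (f x))"
proof (induction k arbitrary: f)
  case 0
  then show ?case
    using continuous_on_compose2[OF linear_continuous_on[OF assms(2), of UNIV], of S f] by simp
next
  case (Suc k)
  have *: "((\<lambda>x. h (f x)) has_derivative (\<lambda>v. h (dirD f v x))) (at x)" if "x \<in> S" for x
    using Suc.prems that
    by (intro bounded_linear.has_derivative[OF assms(2)] has_derivative_dirD) auto
  have "Ck_on k S (dirD (\<lambda>x. h (f x)) v)" for v
    by (rule Ck_on_cong[OF assms(1), where f="\<lambda>x. h (dirD f v x)"])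
       (use Suc frechet_derivative_eqI[OF *] in auto)
  then show ?case using * by (auto simp: differentiable_def)
qed

lemma Ck_on_inner:
  fixes f g :: "'e::euclidean_space \<Rightarrow> 'b::real_inner"
  assumes "open S"
  shows "Ck_on k S f \<Longrightarrow> Ck_on k S g \<Longrightarrow> Ck_on k S (\<lambda>x. f x \<bullet> g x)"
proof (induction k arbitrary: f g)
  case 0
  then show ?case by (auto intro: continuous_intros)
next
  case (Suc k)
  have *: "((\<lambda>x. f x \<bullet> g x) has_derivative (\<lambda>v. f x \<bullet> dirD g v x + dirD f v x \<bullet> g x)) (at x)"
    if "x \<in> S" for x
    using Suc.prems that by (intro has_derivative_inner has_derivative_dirD) auto
  have fg: "Ck_on k S f" "Ck_on k S g" using Suc.prems Ck_on_SucD[OF assms] by auto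
  have "Ck_on k S (dirD (\<lambda>x. f x \<bullet> g x) v)" for v
    by (rule Ck_on_cong[OF assms(1), where f="\<lambda>x. f x \<bullet> dirD g v x + dirD f v x \<bullet> g x"])
       (use Suc.prems fg frechet_derivative_eqI[OF *] in \<open>auto intro!: Ck_on_add[OF assms] Suc.IH\<close>)
  then show ?case using * by (auto simp: differentiable_def)
qed

lemma Ck_on_2D:
  assumes "Ck_on 2 S f"
  shows "x \<in> S \<Longrightarrow> f differentiable (at x)"
    and "x \<in> S \<Longrightarrow> dirD f v differentiable (at x)"
    and "continuous_on S f" and "continuous_on S (dirD f v)"
    and "continuous_on S (dirD (dirD f v) w)"
  using assms unfolding numeral_2_eq_2
  by (auto intro!: continuous_at_imp_continuous_on differentiable_imp_continuous_within)

lemma dirD_lin: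
  assumes "f differentiable (at x)"
  shows "dirD f (v + w) x = dirD f v x + dirD f w x" "dirD f (a *\<^sub>R v) x = a *\<^sub>R dirD f v x"
  using linear_frechet_derivative[OF assms] by (auto simp: linear_add linear_scale)

lemma dirD_add:
  assumes "f differentiable (at x)" "g differentiable (at x)"
  shows "dirD (\<lambda>x. f x + g x) v x = dirD f v x + dirD g v x"
  by (metis frechet_derivative_eqI has_derivative_add has_derivative_dirD assms)

lemma dirD_bounded_linear:
  assumes "bounded_linear h" "f differentiable (at x)"
  shows "dirD (\<lambda>x. h (f x)) v x = h (dirD f v x)"
  by (metis frechet_derivative_eqI bounded_linear.has_derivative has_derivative_dirD assms)

lemma dirD2_cong:
  assumes "open S" "x \<in> S" "\<And>y. y \<in> S \<Longrightarrow> f y = g y" "Ck_on 2 S f"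
  shows "dirD (dirD f v) w x = dirD (dirD g v) w x"
  by (rule dirD_cong[OF assms(1,2)])
     (use dirD_cong[OF assms(1) _ assms(3)] Ck_on_2D[OF assms(4)] assms(2) in auto)

lemma dirD2_add:
  assumes "open S" "x \<in> S" "Ck_on 2 S f" "Ck_on 2 S g"
  shows "dirD (dirD (\<lambda>x. f x + g x) v) w x = dirD (dirD f v) w x + dirD (dirD g v) w x"
proof -
  have "dirD (dirD (\<lambda>x. f x + g x) v) w x = dirD (\<lambda>y. dirD f v y + dirD g v y) w x"
    by (rule sym, rule dirD_cong[OF assms(1,2)])
       (use Ck_on_2D[OF assms(3)] Ck_on_2D[OF assms(4)] assms(2) in \<open>auto intro!: dirD_add[symmetric]\<close>)
  also have "\<dots> = dirD (dirD f v) w x + dirD (dirD g v) w x"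
    by (rule dirD_add) (use Ck_on_2D[OF assms(3)] Ck_on_2D[OF assms(4)] assms(2) in auto)
  finally show ?thesis .
qed

lemma dirD2_bounded_linear:
  assumes "open S" "x \<in> S" "Ck_on 2 S f" "bounded_linear h"
  shows "dirD (dirD (\<lambda>x. h (f x)) v) w x = h (dirD (dirD f v) w x)"
proof -
  have "(\<lambda>y. h (dirD f v y)) differentiable (at x)"
    using bounded_linear.has_derivative[OF assms(4) has_derivative_dirD[OF Ck_on_2D(2)[OF assms(3,2)]]]
    by (auto simp: differentiable_def)
  then have "dirD (dirD (\<lambda>x. h (f x)) v) w x = dirD (\<lambda>y. h (dirD f v y)) w x"
    by (intro sym[OF dirD_cong[OF assms(1,2)]])
       (use Ck_on_2D(1)[OF assms(3)] in \<open>auto simp: dirD_bounded_linear[OF assms(4)]\<close>)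
  also have "\<dots> = h (dirD (dirD f v) w x)"
    by (rule dirD_bounded_linear) (use Ck_on_2D[OF assms(3)] assms(2,4) in auto)
  finally show ?thesis .
qed

lemma dirD2_lin_inner:
  assumes "open S" "x \<in> S" "Ck_on 2 S f"
  shows "dirD (dirD f (v + v')) w x = dirD (dirD f v) w x + dirD (dirD f v') w x"
    and "dirD (dirD f (a *\<^sub>R v)) w x = a *\<^sub>R dirD (dirD f v) w x"
proof -
  have "dirD (dirD f (v + v')) w x = dirD (\<lambda>y. dirD f v y + dirD f v' y) w x"
    by (rule dirD_cong[OF assms(1,2)]) (use Ck_on_2D[OF assms(3)] assms(2) in \<open>auto simp: dirD_lin\<close>)
  also have "\<dots> = dirD (dirD f v) w x + dirD (dirD f v') w x"
    by (rule dirD_add) (use Ck_on_2D[OF assms(3)] assms(2) in auto)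
  finally show "dirD (dirD f (v + v')) w x = dirD (dirD f v) w x + dirD (dirD f v') w x" .
  have "dirD (dirD f (a *\<^sub>R v)) w x = dirD (\<lambda>y. a *\<^sub>R dirD f v y) w x"
    by (rule dirD_cong[OF assms(1,2)]) (use Ck_on_2D[OF assms(3)] assms(2) in \<open>auto simp: dirD_lin\<close>)
  also have "\<dots> = a *\<^sub>R dirD (dirD f v) w x"
    by (rule dirD_bounded_linear) (use Ck_on_2D[OF assms(3)] assms(2) in \<open>auto simp: bounded_linear_scaleR_right\<close>)
  finally show "dirD (dirD f (a *\<^sub>R v)) w x = a *\<^sub>R dirD (dirD f v) w x" .
qed

text \<open>Both mixed derivatives arise as limits of the same second difference quotient.\<close>

lemma second_difference_mvt:
  fixes f :: "'e::euclidean_space \<Rightarrow> real"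
  assumes C: "Ck_on 2 S f" and "s > 0" and
    sub: "\<And>a b. 0 \<le> a \<Longrightarrow> a \<le> s \<Longrightarrow> 0 \<le> b \<Longrightarrow> b \<le> s \<Longrightarrow> x + a *\<^sub>R v + b *\<^sub>R w \<in> S"
  shows "\<exists>a b. 0 < a \<and> a < s \<and> 0 < b \<and> b < s \<and>
    f (x + s *\<^sub>R v + s *\<^sub>R w) - f (x + s *\<^sub>R v) - f (x + s *\<^sub>R w) + f x
      = s^2 * dirD (dirD f v) w (x + a *\<^sub>R v + b *\<^sub>R w)"
proof -
  have shift: "((\<lambda>a. x + a *\<^sub>R v + c) has_derivative (\<lambda>r. r *\<^sub>R v)) (at a)" for c v a
    by (auto intro!: derivative_eq_intros)
  \<comment> \<open>The second difference is the increment of \<open>h\<close>, the first difference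
    in direction \<open>w\<close>. The mean value theorem is applied to \<open>h\<close> along
    \<open>v\<close>, then to \<open>k\<close> along \<open>w\<close>.\<close>
  define h where "h a = f (x + a *\<^sub>R v + s *\<^sub>R w) - f (x + a *\<^sub>R v)" for a
  have dh: "(h has_real_derivative (dirD f v (x + a *\<^sub>R v + s *\<^sub>R w) - dirD f v (x + a *\<^sub>R v))) (at a)"
    if "0 \<le> a" "a \<le> s" for a
  proof -
    have in1: "x + a *\<^sub>R v + s *\<^sub>R w \<in> S" using sub[of a s] that \<open>s>0\<close> by auto
    have in2: "x + a *\<^sub>R v \<in> S" using sub[of a 0] that \<open>s>0\<close> by auto
    have l1: "dirD f (r *\<^sub>R v) (x + a *\<^sub>R v + s *\<^sub>R w) = r *\<^sub>R dirD f v (x + a *\<^sub>R v + s *\<^sub>R w)"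
      and l2: "dirD f (r *\<^sub>R v) (x + a *\<^sub>R v) = r *\<^sub>R dirD f v (x + a *\<^sub>R v)" for r
      by (rule dirD_lin(2)[OF Ck_on_2D(1)[OF C]], fact)+
    have "((\<lambda>a. f (x + a *\<^sub>R v + s *\<^sub>R w)) has_derivative (\<lambda>r. dirD f (r *\<^sub>R v) (x + a *\<^sub>R v + s *\<^sub>R w))) (at a)"
      by (rule has_derivative_compose[OF shift[of v "s *\<^sub>R w" a] has_derivative_dirD[OF Ck_on_2D(1)[OF C in1]]])
    moreover have "((\<lambda>a. f (x + a *\<^sub>R v)) has_derivative (\<lambda>r. dirD f (r *\<^sub>R v) (x + a *\<^sub>R v))) (at a)"
      using has_derivative_compose[OF shift[of v 0 a]] has_derivative_dirD[OF Ck_on_2D(1)[OF C in2]] by simp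
    ultimately have "(h has_derivative (\<lambda>r. dirD f (r *\<^sub>R v) (x + a *\<^sub>R v + s *\<^sub>R w) - dirD f (r *\<^sub>R v) (x + a *\<^sub>R v))) (at a)"
      unfolding h_def by (rule has_derivative_diff)
    then show ?thesis
      unfolding has_field_derivative_def l1 l2 by (rule has_derivative_eq_rhs) (simp add: fun_eq_iff algebra_simps)
  qed
  obtain a where a: "0 < a" "a < s"
    and ha: "h s - h 0 = s * (dirD f v (x + a *\<^sub>R v + s *\<^sub>R w) - dirD f v (x + a *\<^sub>R v))"
    using MVT2[OF \<open>s>0\<close>, of h "\<lambda>a. dirD f v (x + a *\<^sub>R v + s *\<^sub>R w) - dirD f v (x + a *\<^sub>R v)"] dh by auto
  define k where "k b = dirD f v (x + a *\<^sub>R v + b *\<^sub>R w)" for b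
  have dk: "(k has_real_derivative dirD (dirD f v) w (x + a *\<^sub>R v + b *\<^sub>R w)) (at b)"
    if "0 \<le> b" "b \<le> s" for b
  proof -
    have in1: "x + a *\<^sub>R v + b *\<^sub>R w \<in> S" using sub[of a b] that a by auto
    have l1: "dirD (dirD f v) (r *\<^sub>R w) (x + a *\<^sub>R v + b *\<^sub>R w) = r *\<^sub>R dirD (dirD f v) w (x + a *\<^sub>R v + b *\<^sub>R w)" for r
      by (rule dirD_lin(2)[OF Ck_on_2D(2)[OF C in1]])
    have "(k has_derivative (\<lambda>r. dirD (dirD f v) (r *\<^sub>R w) (x + a *\<^sub>R v + b *\<^sub>R w))) (at b)"
      unfolding k_def
      using has_derivative_compose[OF shift[of w "a *\<^sub>R v" b], of "dirD f v"]
        has_derivative_dirD[OF Ck_on_2D(2)[OF C in1, of v]] by (simp add: algebra_simps)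
    then show ?thesis
      unfolding has_field_derivative_def l1 by (rule has_derivative_eq_rhs) (simp add: fun_eq_iff algebra_simps)
  qed
  obtain b where b: "0 < b" "b < s"
    and kb: "k s - k 0 = s * dirD (dirD f v) w (x + a *\<^sub>R v + b *\<^sub>R w)"
    using MVT2[OF \<open>s>0\<close>, of k "\<lambda>b. dirD (dirD f v) w (x + a *\<^sub>R v + b *\<^sub>R w)"] dk by auto
  have "h s - h 0 = s^2 * dirD (dirD f v) w (x + a *\<^sub>R v + b *\<^sub>R w)"
    using ha kb unfolding k_def by (simp add: power2_eq_square)
  then show ?thesis using a b unfolding h_def
    by (intro exI[of _ a] exI[of _ b]) (simp add: algebra_simps)
qed

lemma dirD2_symmetric:
  fixes f :: "'e::euclidean_space \<Rightarrow> real"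
  assumes "open S" "x \<in> S" "Ck_on 2 S f"
  shows "dirD (dirD f v) w x = dirD (dirD f w) v x"
proof (rule ccontr)
  assume neq: "dirD (dirD f v) w x \<noteq> dirD (dirD f w) v x"
  \<comment> \<open>Half the gap: each mixed derivative moves by less than \<open>e\<close> between
    \<open>x\<close> and its mean value point, yet their values at the two mean value points
    coincide.\<close>
  define e where "e = \<bar>dirD (dirD f v) w x - dirD (dirD f w) v x\<bar> / 2"
  have "e > 0" using neq by (simp add: e_def)
  have cont: "isCont (dirD (dirD f v) w) x" for v w
    using Ck_on_2D(5)[OF assms(3)] assms(1,2) continuous_on_eq_continuous_at by blast
  obtain d1 where d1: "d1 > 0" "\<And>y. dist y x < d1 \<Longrightarrow> dist (dirD (dirD f v) w y) (dirD (dirD f v) w x) < e"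
    using cont[of v w] \<open>e>0\<close> unfolding continuous_at_eps_delta dist_norm by blast
  obtain d2 where d2: "d2 > 0" "\<And>y. dist y x < d2 \<Longrightarrow> dist (dirD (dirD f w) v y) (dirD (dirD f w) v x) < e"
    using cont[of w v] \<open>e>0\<close> unfolding continuous_at_eps_delta dist_norm by blast
  obtain d3 where d3: "d3 > 0" "ball x d3 \<subseteq> S"
    using assms open_contains_ball by blast
  define d where "d = min d1 (min d2 d3)"
  have "d > 0" using d1 d2 d3 by (simp add: d_def)
  \<comment> \<open>With this side length the whole parallelogram stays within \<open>d / 2\<close>
    of \<open>x\<close>; the summand 1 keeps the denominator positive.\<close>
  define s where "s = d / (2 * (norm v + norm w + 1))"
  have "s > 0" unfolding s_def using \<open>d>0\<close> by (simp add: add_nonneg_pos)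
  have near: "dist (x + a *\<^sub>R v + b *\<^sub>R w) x < d" if "0 \<le> a" "a \<le> s" "0 \<le> b" "b \<le> s" for a b
  proof -
    have "dist (x + a *\<^sub>R v + b *\<^sub>R w) x = norm (a *\<^sub>R v + b *\<^sub>R w)" by (simp add: dist_norm)
    also have "\<dots> \<le> a * norm v + b * norm w" using that by (intro norm_triangle_le) simp
    also have "\<dots> \<le> s * norm v + s * norm w" using that by (intro add_mono mult_right_mono) auto
    also have "\<dots> \<le> s * (norm v + norm w + 1)" using \<open>s>0\<close> by (simp add: algebra_simps)
    also have "\<dots> = d / 2"
    proof -
      have "norm v + norm w + 1 > 0" by (simp add: add_nonneg_pos)
      then show ?thesis unfolding s_def by (metis less_irrefl mult.commute nonzero_divide_mult_cancel_left times_divide_eq_right divide_divide_eq_right mult_2 nonzero_mult_divide_mult_cancel_right)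
    qed
    finally show ?thesis using \<open>d>0\<close> by simp
  qed
  have near': "dist (x + a *\<^sub>R w + b *\<^sub>R v) x < d" if "0 \<le> a" "a \<le> s" "0 \<le> b" "b \<le> s" for a b
    using near[of b a] that by (simp add: add.commute add.left_commute)
  have insub: "y \<in> S" if "dist y x < d" for y
    using that d3 unfolding d_def by (auto simp: dist_commute)
  obtain a b where ab: "0 < a" "a < s" "0 < b" "b < s"
    "f (x + s *\<^sub>R v + s *\<^sub>R w) - f (x + s *\<^sub>R v) - f (x + s *\<^sub>R w) + f x
      = s^2 * dirD (dirD f v) w (x + a *\<^sub>R v + b *\<^sub>R w)"
    using second_difference_mvt[OF assms(3) \<open>s>0\<close>, of x v w] near insub by metis
  obtain a' b' where ab': "0 < a'" "a' < s" "0 < b'" "b' < s"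
    "f (x + s *\<^sub>R w + s *\<^sub>R v) - f (x + s *\<^sub>R w) - f (x + s *\<^sub>R v) + f x
      = s^2 * dirD (dirD f w) v (x + a' *\<^sub>R w + b' *\<^sub>R v)"
    using second_difference_mvt[OF assms(3) \<open>s>0\<close>, of x w v] near' insub by metis
  have "s^2 * dirD (dirD f v) w (x + a *\<^sub>R v + b *\<^sub>R w) = s^2 * dirD (dirD f w) v (x + a' *\<^sub>R w + b' *\<^sub>R v)"
    using ab(5) ab'(5) by (simp add: algebra_simps)
  then have eq: "dirD (dirD f v) w (x + a *\<^sub>R v + b *\<^sub>R w) = dirD (dirD f w) v (x + a' *\<^sub>R w + b' *\<^sub>R v)"
    using \<open>s>0\<close> by simp
  have "dist (dirD (dirD f v) w (x + a *\<^sub>R v + b *\<^sub>R w)) (dirD (dirD f v) w x) < e"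
    using d1(2) near[of a b] ab unfolding d_def by simp
  moreover have "dist (dirD (dirD f w) v (x + a' *\<^sub>R w + b' *\<^sub>R v)) (dirD (dirD f w) v x) < e"
    using d2(2) near'[of a' b'] ab' unfolding d_def by simp
  ultimately show False using eq unfolding e_def dist_real_def by (auto simp: abs_if split: if_splits)
qed

text \<open>Needed for transition maps, whose second derivatives enter the transformation law of the
  Christoffel symbols. The scalar case is applied to each component.\<close>

lemma euclidean_dirD2_symmetric:
  fixes f :: "'e::euclidean_space \<Rightarrow> 'b::euclidean_space"
  assumes "open S" "x \<in> S" "Ck_on 2 S f"
  shows "dirD (dirD f v) w x = dirD (dirD f w) v x"
proof (rule euclidean_eqI)
  fix b :: 'b
  have "Ck_on 2 S (\<lambda>x. f x \<bullet> b)"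
    by (rule Ck_on_bounded_linear[OF assms(1) _ assms(3)]) (rule bounded_linear_inner_left)
  then show "dirD (dirD f v) w x \<bullet> b = dirD (dirD f w) v x \<bullet> b"
    using dirD2_symmetric[OF assms(1,2), of "\<lambda>x. f x \<bullet> b" v w]
      dirD2_bounded_linear[OF assms bounded_linear_inner_left[of b]] by simp
qed

text \<open>A product rule in which differentiability of \<open>B\<close> is known for fixed
  directions only. Expanding the moving direction in the basis reduces to this case; the sum with
  frozen coefficients is then identified by uniqueness of the derivative (\<open>H0\<close> against
  \<open>der\<close>).\<close>

lemma has_derivative_moving_direction:
  fixes B :: "'e::euclidean_space \<Rightarrow> 'e \<Rightarrow> real" and \<tau> V :: "'e \<Rightarrow> 'e"
  assumes "open S" "y \<in> S" "\<And>z. z \<in> S \<Longrightarrow> linear (B (\<tau> z))"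
    and "\<And>b. (\<lambda>z. B z b) differentiable (at (\<tau> y))"
    and \<tau>: "\<tau> differentiable (at y)" and V: "V differentiable (at y)"
  shows "((\<lambda>z. B (\<tau> z) (V z)) has_derivative
     (\<lambda>v. dirD (\<lambda>z. B z (V y)) (dirD \<tau> v y) (\<tau> y) + B (\<tau> y) (dirD V v y))) (at y)"
    (is "(_ has_derivative ?D) _")
proof -
  have B_expand: "B (\<tau> z) v = (\<Sum>b\<in>Basis. (v \<bullet> b) * B (\<tau> z) b)" if "z \<in> S" for z v
    using Linear_Algebra.linear_componentwise[OF assms(3)[OF that], of v 1] by simp
  have der: "((\<lambda>z. B (\<tau> z) b) has_derivative (\<lambda>v. dirD (\<lambda>z. B z b) (dirD \<tau> v y) (\<tau> y))) (at y)" for b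
    by (rule has_derivative_compose[OF has_derivative_dirD[OF \<tau>] has_derivative_dirD[OF assms(4)]])
  have "((\<lambda>z. \<Sum>b\<in>Basis. (V z \<bullet> b) * B (\<tau> z) b) has_derivative
     (\<lambda>v. \<Sum>b\<in>Basis. (V y \<bullet> b) * dirD (\<lambda>z. B z b) (dirD \<tau> v y) (\<tau> y) + (dirD V v y \<bullet> b) * B (\<tau> y) b)) (at y)"
    by (intro has_derivative_sum has_derivative_mult der has_derivative_inner_left has_derivative_dirD V)
  then have H: "((\<lambda>z. B (\<tau> z) (V z)) has_derivative
     (\<lambda>v. \<Sum>b\<in>Basis. (V y \<bullet> b) * dirD (\<lambda>z. B z b) (dirD \<tau> v y) (\<tau> y) + (dirD V v y \<bullet> b) * B (\<tau> y) b)) (at y)"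
    by (rule has_derivative_transform_within_open[OF _ assms(1,2)]) (simp add: B_expand[symmetric])
  have H0: "((\<lambda>z. B (\<tau> z) (V y)) has_derivative
     (\<lambda>v. \<Sum>b\<in>Basis. (V y \<bullet> b) * dirD (\<lambda>z. B z b) (dirD \<tau> v y) (\<tau> y))) (at y)"
  proof (rule has_derivative_transform_within_open[OF _ assms(1,2)])
    show "((\<lambda>z. \<Sum>b\<in>Basis. (V y \<bullet> b) * B (\<tau> z) b) has_derivative
       (\<lambda>v. \<Sum>b\<in>Basis. (V y \<bullet> b) * dirD (\<lambda>z. B z b) (dirD \<tau> v y) (\<tau> y))) (at y)"
      by (intro has_derivative_sum has_derivative_mult_right der)
  qed (simp add: B_expand[symmetric])
  have "(\<lambda>v. \<Sum>b\<in>Basis. (V y \<bullet> b) * dirD (\<lambda>z. B z b) (dirD \<tau> v y) (\<tau> y))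
     = (\<lambda>v. dirD (\<lambda>z. B z (V y)) (dirD \<tau> v y) (\<tau> y))"
    using has_derivative_unique[OF H0 der] .
  then have "(\<Sum>b\<in>Basis. (V y \<bullet> b) * dirD (\<lambda>z. B z b) (dirD \<tau> v y) (\<tau> y) + (dirD V v y \<bullet> b) * B (\<tau> y) b) = ?D v" for v
    by (simp add: sum.distrib B_expand[OF assms(2), of "dirD V v y"] fun_eq_iff)
  with H show ?thesis by simp
qed

text \<open>The last summand, \<open>f\<close> differentiated along a second derivative of
  \<open>\<tau>\<close>, is the non-tensorial part that the Christoffel symbols will have to
  cancel.\<close>

lemma dirD2_chain:
  fixes f :: "'e::euclidean_space \<Rightarrow> real" and \<tau> :: "'e \<Rightarrow> 'e"
  assumes S: "open S" "y \<in> S" and \<tau>: "Ck_on 2 S \<tau>" "\<tau> ` S \<subseteq> T" and f: "Ck_on 2 T f"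
  shows "dirD (f \<circ> \<tau>) w y = dirD f (dirD \<tau> w y) (\<tau> y)"
    and "dirD (dirD (f \<circ> \<tau>) w) v y
      = dirD (dirD f (dirD \<tau> w y)) (dirD \<tau> v y) (\<tau> y) + dirD f (dirD (dirD \<tau> w) v y) (\<tau> y)"
proof -
  have 1: "((f \<circ> \<tau>) has_derivative (\<lambda>w. dirD f (dirD \<tau> w z) (\<tau> z))) (at z)" if "z \<in> S" for z
    using has_derivative_compose[OF has_derivative_dirD[OF Ck_on_2D(1)[OF \<tau>(1) that]]
        has_derivative_dirD[OF Ck_on_2D(1)[OF f]]] \<tau>(2) that
    by (auto simp: comp_def)
  have 2: "dirD (f \<circ> \<tau>) w z = dirD f (dirD \<tau> w z) (\<tau> z)" if "z \<in> S" for z w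
    using frechet_derivative_eqI[OF 1[OF that]] by simp
  then show "dirD (f \<circ> \<tau>) w y = dirD f (dirD \<tau> w y) (\<tau> y)" using S by blast
  have "((\<lambda>z. dirD f (dirD \<tau> w z) (\<tau> z)) has_derivative
    (\<lambda>v. dirD (\<lambda>z. dirD f (dirD \<tau> w y) z) (dirD \<tau> v y) (\<tau> y) + dirD f (dirD (dirD \<tau> w) v y) (\<tau> y))) (at y)"
    by (rule has_derivative_moving_direction[OF S, where B="\<lambda>z v. dirD f v z" and \<tau>=\<tau> and V="dirD \<tau> w"])
      (use \<tau>(2) S(2) Ck_on_2D(1,2)[OF f] Ck_on_2D(1,2)[OF \<tau>(1)] in \<open>auto intro!: linear_frechet_derivative\<close>)
  then have "(dirD (f \<circ> \<tau>) w has_derivative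
    (\<lambda>v. dirD (\<lambda>z. dirD f (dirD \<tau> w y) z) (dirD \<tau> v y) (\<tau> y) + dirD f (dirD (dirD \<tau> w) v y) (\<tau> y))) (at y)"
    by (rule has_derivative_transform_within_open[OF _ S]) (simp add: 2)
  from frechet_derivative_eqI[OF this] show "dirD (dirD (f \<circ> \<tau>) w) v y
      = dirD (dirD f (dirD \<tau> w y)) (dirD \<tau> v y) (\<tau> y) + dirD f (dirD (dirD \<tau> w) v y) (\<tau> y)"
    by metis
qed

section \<open>Charts, the Levi-Civita connection and its transformation law\<close>

text \<open>Positivity on the diagonal makes lowering an index (\<open>L\<close>) injective, hence
  surjective in finite dimension. This gives meaning to the definite description in
  \<open>christoffel\<close>.\<close>

lemma positive_form_riesz:
  fixes M :: "'e::euclidean_space \<Rightarrow>\<^sub>L 'e \<Rightarrow>\<^sub>L real" and f :: "'e \<Rightarrow> real"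
  assumes pos: "\<And>v. v \<noteq> 0 \<Longrightarrow> 0 < M v v" and f: "linear f"
  shows "\<exists>!z. \<forall>k. M z k = f k"
proof -
  define L where "L z = (\<Sum>b\<in>Basis. M z b *\<^sub>R b)" for z
  have lin: "linear L"
    unfolding L_def
    by (rule linearI) (simp_all add: blinfun.bilinear_simps scaleR_left_distrib sum.distrib scaleR_right.sum)
  have expand: "M z k = (\<Sum>b\<in>Basis. (k \<bullet> b) * M z b)" for z k
    using Linear_Algebra.linear_componentwise[of "M z" k 1]
    by (simp add: bounded_linear.linear blinfun.bounded_linear_right)
  have "z = 0" if "L z = 0" for z
  proof (rule ccontr)
    assume "z \<noteq> 0"
    have "M z b = 0" if "b \<in> Basis" for b
      using \<open>L z = 0\<close> that inner_sum_left_Basis[of b "\<lambda>b. M z b"] unfolding L_def by simp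
    then have "M z z = 0" by (subst expand) simp
    with pos[OF \<open>z \<noteq> 0\<close>] show False by simp
  qed
  then have "inj L" using lin by (simp add: linear_injective_0)
  then have "surj L" using lin by (simp add: linear_injective_imp_surjective)
  then obtain z where z: "L z = (\<Sum>b\<in>Basis. f b *\<^sub>R b)" by (metis surjD)
  have "M z b = f b" if "b \<in> Basis" for b
    using arg_cong[OF z, of "\<lambda>u. u \<bullet> b"] that unfolding L_def by (simp add: inner_sum_left_Basis)
  then have "blinfun_apply (M z) = f"
    by (intro linear_eq_stdbasis f) (auto intro: bounded_linear.linear blinfun.bounded_linear_right)
  moreover have "z' = z" if "\<And>k. M z' k = f k" for z'
  proof -
    have "M (z' - z) (z' - z) = 0"
      by (simp add: blinfun.bilinear_simps that \<open>blinfun_apply (M z) = f\<close>)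
    then show ?thesis using pos[of "z' - z"] by force
  qed
  ultimately show ?thesis by (metis)
qed

text \<open>\<open>Blinfun\<close> is meaningful on bounded linear maps only. Linearity in each
  argument is what allows the nested \<open>Blinfun\<close> in \<open>hessian\<close> to be
  evaluated.\<close>

lemma blinfun2_apply:
  fixes H :: "'e::euclidean_space \<Rightarrow> 'e \<Rightarrow> real"
  assumes "\<And>v. linear (H v)" "\<And>w. linear (\<lambda>v. H v w)"
  shows "blinfun_apply (blinfun_apply (Blinfun (\<lambda>v. Blinfun (H v))) v) w = H v w"
proof -
  have 1: "blinfun_apply (Blinfun (H v)) = H v" for v
    by (rule bounded_linear_Blinfun_apply) (use assms in \<open>simp add: linear_conv_bounded_linear\<close>)
  have "linear (\<lambda>v. Blinfun (H v))"
    by (rule linearI; rule blinfun_eqI)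
       (simp_all add: 1 blinfun.bilinear_simps linear_add[OF assms(2)] linear_scale[OF assms(2)])
  then show ?thesis
    by (subst bounded_linear_Blinfun_apply) (simp_all add: linear_conv_bounded_linear 1)
qed

locale riemannian =
  fixes \<A> :: "('m::{t2_space,second_countable_topology}, 'e::euclidean_space) chart set"
    and g :: "'m \<Rightarrow> ('m, 'e) tensor2"
  assumes smooth_structure: "smooth_structure \<A>"
    and metric: "riemannian_metric \<A> g"
begin

lemma charts_at_exists: "\<exists>c. c \<in> charts_at \<A> x"
  using smooth_structure unfolding smooth_structure_def charts_at_def by blast

lemma is_chart: "c \<in> \<A> \<Longrightarrow> is_chart c"
  using smooth_structure unfolding smooth_structure_def by blast

lemma charts_atD: "c \<in> charts_at \<A> x \<Longrightarrow> c \<in> \<A>" "c \<in> charts_at \<A> x \<Longrightarrow> x \<in> fst c"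
  unfolding charts_at_def by auto

lemma open_fst [simp]: "c \<in> \<A> \<Longrightarrow> open (fst c)" and open_img [simp]: "c \<in> \<A> \<Longrightarrow> open (snd c ` fst c)"
  using is_chart[of c] unfolding is_chart_def by blast+

lemma chart_continuous: "c \<in> \<A> \<Longrightarrow> continuous_on (fst c) (snd c)"
  and chart_inv_continuous: "c \<in> \<A> \<Longrightarrow> continuous_on (snd c ` fst c) (chart_inv c)"
  using is_chart[of c] unfolding is_chart_def homeomorphism_def by blast+

lemma chart_inv_chart [simp]: "c \<in> \<A> \<Longrightarrow> x \<in> fst c \<Longrightarrow> chart_inv c (snd c x) = x"
  using is_chart[of c] unfolding is_chart_def homeomorphism_def by blast

lemma chart_chart_inv [simp]: "c \<in> \<A> \<Longrightarrow> y \<in> snd c ` fst c \<Longrightarrow> snd c (chart_inv c y) = y"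
  and chart_inv_in: "c \<in> \<A> \<Longrightarrow> y \<in> snd c ` fst c \<Longrightarrow> chart_inv c y \<in> fst c"
  using is_chart[of c] unfolding is_chart_def homeomorphism_def by auto

lemma chart_inj: "c \<in> \<A> \<Longrightarrow> x \<in> fst c \<Longrightarrow> y \<in> fst c \<Longrightarrow> snd c x = snd c y \<Longrightarrow> x = y"
  by (metis chart_inv_chart)

lemma open_chart_image:
  assumes "c \<in> \<A>" "open W"
  shows "open (snd c ` (W \<inter> fst c))"
proof -
  have "snd c ` (W \<inter> fst c) = chart_inv c -` W \<inter> snd c ` fst c"
    using assms(1) by (auto simp: image_iff)
  then show ?thesis
    using continuous_open_preimage[OF chart_inv_continuous[OF assms(1)] open_img[OF assms(1)] assms(2)]
    by (simp add: Int_commute)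
qed

lemma transition_smooth:
  assumes "c \<in> \<A>" "c' \<in> \<A>"
  shows "smooth_on (snd c ` (fst c \<inter> fst c')) (snd c' \<circ> chart_inv c)"
  using smooth_structure assms unfolding smooth_structure_def compatible_charts_def by blast

lemma transition_Ck:
  assumes "c \<in> \<A>" "c' \<in> \<A>"
  shows "Ck_on k (snd c ` (fst c \<inter> fst c')) (snd c' \<circ> chart_inv c)"
  using transition_smooth[OF assms] unfolding smooth_on_def by auto

lemma open_overlap: "c \<in> \<A> \<Longrightarrow> c' \<in> \<A> \<Longrightarrow> open (snd c ` (fst c \<inter> fst c'))"
  by (metis open_chart_image open_fst Int_commute)

abbreviation gloc :: "('m, 'e) chart \<Rightarrow> 'e \<Rightarrow> 'e \<Rightarrow>\<^sub>L 'e \<Rightarrow>\<^sub>L real" where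
  "gloc c \<equiv> (\<lambda>y. g (chart_inv c y) c)"

lemma gloc_Ck: "c \<in> \<A> \<Longrightarrow> Ck_on k (snd c ` fst c) (gloc c)"
  using metric unfolding riemannian_metric_def smooth_on_def by blast

lemma gloc_sym: "c \<in> \<A> \<Longrightarrow> y \<in> snd c ` fst c \<Longrightarrow> gloc c y v w = gloc c y w v"
  using metric chart_inv_in unfolding riemannian_metric_def sym2_def charts_at_def by blast

lemma gloc_pos: "c \<in> \<A> \<Longrightarrow> y \<in> snd c ` fst c \<Longrightarrow> v \<noteq> 0 \<Longrightarrow> 0 < gloc c y v v"
  using metric chart_inv_in unfolding riemannian_metric_def charts_at_def by blast

lemma gloc_differentiable: "c \<in> \<A> \<Longrightarrow> y \<in> snd c ` fst c \<Longrightarrow> gloc c differentiable (at y)"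
  using Ck_on_2D(1)[OF gloc_Ck] .

lemma dirD_metric_at:
  assumes "c \<in> \<A>" "y \<in> snd c ` fst c"
  shows "dirD (\<lambda>y'. metric_at g c y' v w) u y = dirD (gloc c) u y v w"
  unfolding metric_at_def
  by (rule dirD_bounded_linear[OF _ gloc_differentiable[OF assms]])
     (auto intro!: bounded_linear_compose[of "\<lambda>B. blinfun_apply B w"] blinfun.bounded_linear_left)

text \<open>The Christoffel symbols of the first kind. Differentiating the operator-valued
  \<open>gloc\<close>, not its entries, makes linearity in every slot immediate.\<close>

definition christoffel_lower :: "('m, 'e) chart \<Rightarrow> 'e \<Rightarrow> 'e \<Rightarrow> 'e \<Rightarrow> 'e \<Rightarrow> real" where
  "christoffel_lower c y v w k =
    (dirD (gloc c) v y w k + dirD (gloc c) w y v k - dirD (gloc c) k y v w) / 2"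

lemma christoffel_lower_linear:
  assumes "c \<in> \<A>" "y \<in> snd c ` fst c"
  shows "linear (christoffel_lower c y v w)" "linear (\<lambda>w. christoffel_lower c y v w k)"
    "linear (\<lambda>v. christoffel_lower c y v w k)"
  unfolding christoffel_lower_def
  by (auto intro!: linearI simp: dirD_lin[OF gloc_differentiable[OF assms]] blinfun.bilinear_simps
      algebra_simps add_divide_distrib diff_divide_distrib)

text \<open>Replaces the definite description once and for all by its characterization through the
  metric; the later facts about \<open>christoffel\<close> are identities tested against an
  arbitrary \<open>k\<close>.\<close>

lemma christoffel_eq_iff:
  assumes "c \<in> \<A>" "y \<in> snd c ` fst c"
  shows "z = christoffel g c y v w \<longleftrightarrow> (\<forall>k. gloc c y z k = christoffel_lower c y v w k)"
proof -
  have ex: "\<exists>!z. \<forall>k. gloc c y z k = christoffel_lower c y v w k"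
    by (rule positive_form_riesz[OF gloc_pos[OF assms] christoffel_lower_linear(1)[OF assms]])
  have eq: "christoffel g c y v w = (THE z. \<forall>k. gloc c y z k = christoffel_lower c y v w k)"
    unfolding christoffel_def dirD_metric_at[OF assms] christoffel_lower_def by (simp add: metric_at_def)
  show ?thesis unfolding eq using theI'[OF ex] the1_equality[OF ex] by blast
qed

lemma gloc_christoffel:
  assumes "c \<in> \<A>" "y \<in> snd c ` fst c"
  shows "gloc c y (christoffel g c y v w) k = christoffel_lower c y v w k"
  using christoffel_eq_iff[OF assms] by blast

lemma christoffel_linear:
  assumes "c \<in> \<A>" "y \<in> snd c ` fst c"
  shows "linear (christoffel g c y v)" "linear (\<lambda>v. christoffel g c y v w)"
proof -
  note eqI = christoffel_eq_iff[OF assms, THEN iffD2, symmetric]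
  note simps = blinfun.bilinear_simps gloc_christoffel[OF assms]
    linear_add[OF christoffel_lower_linear(2)[OF assms]] linear_scale[OF christoffel_lower_linear(2)[OF assms]]
    linear_add[OF christoffel_lower_linear(3)[OF assms]] linear_scale[OF christoffel_lower_linear(3)[OF assms]]
  show "linear (christoffel g c y v)" by (rule linearI; rule eqI) (simp_all add: simps)
  show "linear (\<lambda>v. christoffel g c y v w)" by (rule linearI; rule eqI) (simp_all add: simps)
qed

lemma christoffel_sym:
  assumes "c \<in> \<A>" "y \<in> snd c ` fst c"
  shows "christoffel g c y v w = christoffel g c y w v"
proof -
  have "dirD (gloc c) k y w v = dirD (gloc c) k y v w" for k v w
  proof -
    have 1: "(\<lambda>y'. metric_at g c y' v w) differentiable at y"
      unfolding metric_at_def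
      by (rule differentiableI, rule bounded_linear.has_derivative[OF bounded_linear_compose,
          OF blinfun.bounded_linear_left blinfun.bounded_linear_left has_derivative_dirD[OF gloc_differentiable[OF assms]]])
    have "dirD (\<lambda>y'. metric_at g c y' v w) k y = dirD (\<lambda>y'. metric_at g c y' w v) k y"
      by (rule dirD_cong[OF open_img[OF assms(1)] assms(2) _ 1])
        (use gloc_sym[OF assms(1)] in \<open>auto simp: metric_at_def\<close>)
    then show ?thesis using dirD_metric_at[OF assms] by metis
  qed
  then have "christoffel_lower c y v w k = christoffel_lower c y w v k" for k
    unfolding christoffel_lower_def by (metis add.commute)
  then show ?thesis using christoffel_eq_iff[OF assms] by metis
qed

lemma gloc_transform:
  assumes c: "c \<in> \<A>" "c' \<in> \<A>" and z: "z \<in> snd c ` (fst c \<inter> fst c')"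
  shows "gloc c z v w = gloc c' ((snd c' \<circ> chart_inv c) z)
    (dirD (snd c' \<circ> chart_inv c) v z) (dirD (snd c' \<circ> chart_inv c) w z)"
proof -
  obtain x where x: "x \<in> fst c" "x \<in> fst c'" "z = snd c x" using z by auto
  then have "c \<in> charts_at \<A> x" "c' \<in> charts_at \<A> x" "chart_inv c z = x"
    using c by (auto simp: charts_at_def)
  moreover have "g x \<in> sym2 \<A> x" using metric unfolding riemannian_metric_def by blast
  then have "\<forall>c\<in>charts_at \<A> x. \<forall>c'\<in>charts_at \<A> x. \<forall>v w.
      g x c v w = g x c' (tangent_transition c c' x v) (tangent_transition c c' x w)"
    unfolding sym2_def by blast
  ultimately have "g x c v w = g x c' (tangent_transition c c' x v) (tangent_transition c c' x w)"
    by blast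
  moreover have "chart_inv c' ((snd c' \<circ> chart_inv c) z) = x"
    using x c by simp
  ultimately show ?thesis
    using x \<open>chart_inv c z = x\<close> unfolding tangent_transition_def by simp
qed

section \<open>Change of charts: the transformation law of the Christoffel symbols\<close>

context
  fixes c c' \<tau> x
  assumes cc: "c \<in> charts_at \<A> x" "c' \<in> charts_at \<A> x"
  defines "\<tau> \<equiv> snd c' \<circ> chart_inv c"
begin

lemma overlap_point: "c \<in> \<A>" "c' \<in> \<A>" "snd c x \<in> snd c ` (fst c \<inter> fst c')" "snd c x \<in> snd c ` fst c"
  "\<tau> (snd c x) = snd c' x" "snd c' x \<in> snd c' ` fst c'" "chart_inv c (snd c x) = x" "chart_inv c' (snd c' x) = x"
proof -
  show 1: "c \<in> \<A>" "c' \<in> \<A>" and 2: "snd c x \<in> snd c ` (fst c \<inter> fst c')" "snd c x \<in> snd c ` fst c"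
      "snd c' x \<in> snd c' ` fst c'"
    using cc by (simp_all add: charts_at_def)
  have "x \<in> fst c" "x \<in> fst c'" using cc by (simp_all add: charts_at_def)
  then show "chart_inv c (snd c x) = x" "chart_inv c' (snd c' x) = x" "\<tau> (snd c x) = snd c' x"
    using 1 by (simp_all add: \<tau>_def)
qed

text \<open>The tensor law of the metric, differentiated by the product rule; the two terms with
  second derivatives of \<open>\<tau>\<close> come from its two arguments.\<close>

lemma dirD_gloc_transform:
  "dirD (gloc c) u (snd c x) v w =
    dirD (gloc c') (dirD \<tau> u (snd c x)) (snd c' x) (dirD \<tau> v (snd c x)) (dirD \<tau> w (snd c x))
    + gloc c' (snd c' x) (dirD (dirD \<tau> v) u (snd c x)) (dirD \<tau> w (snd c x))
    + gloc c' (snd c' x) (dirD \<tau> v (snd c x)) (dirD (dirD \<tau> w) u (snd c x))"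
proof -
  let ?S = "snd c ` (fst c \<inter> fst c')" and ?y = "snd c x"
  have S: "open ?S" "?y \<in> ?S" using overlap_point open_overlap by auto
  have C: "Ck_on 2 ?S \<tau>" unfolding \<tau>_def by (rule transition_Ck) (use overlap_point in auto)
  have 0: "((\<lambda>y. gloc c' (\<tau> y)) has_derivative (\<lambda>u. dirD (gloc c') (dirD \<tau> u ?y) (snd c' x))) (at ?y)"
    using has_derivative_compose[OF has_derivative_dirD[OF Ck_on_2D(1)[OF C S(2)]], of "gloc c'"]
      has_derivative_dirD[OF gloc_differentiable[OF overlap_point(2) overlap_point(6)]]
    by (simp add: overlap_point)
  have "((\<lambda>y. gloc c' (\<tau> y) (dirD \<tau> v y) (dirD \<tau> w y)) has_derivative
    (\<lambda>u. dirD (gloc c') (dirD \<tau> u ?y) (snd c' x) (dirD \<tau> v ?y) (dirD \<tau> w ?y)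
      + gloc c' (snd c' x) (dirD (dirD \<tau> v) u ?y) (dirD \<tau> w ?y)
      + gloc c' (snd c' x) (dirD \<tau> v ?y) (dirD (dirD \<tau> w) u ?y))) (at ?y)"
    using blinfun.FDERIV[OF blinfun.FDERIV[OF 0 has_derivative_dirD[OF Ck_on_2D(2)[OF C S(2)], of v]]
       has_derivative_dirD[OF Ck_on_2D(2)[OF C S(2)], of w]]
    by (rule has_derivative_eq_rhs) (simp add: overlap_point blinfun.bilinear_simps algebra_simps)
  then have 1: "((\<lambda>y. gloc c y v w) has_derivative
    (\<lambda>u. dirD (gloc c') (dirD \<tau> u ?y) (snd c' x) (dirD \<tau> v ?y) (dirD \<tau> w ?y)
      + gloc c' (snd c' x) (dirD (dirD \<tau> v) u ?y) (dirD \<tau> w ?y)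
      + gloc c' (snd c' x) (dirD \<tau> v ?y) (dirD (dirD \<tau> w) u ?y))) (at ?y)"
    by (rule has_derivative_transform_within_open[OF _ S])
       (use gloc_transform[OF overlap_point(1,2)] in \<open>simp add: \<tau>_def\<close>)
  show ?thesis
    using fun_cong[OF frechet_derivative_eqI[OF 1], of u] dirD_metric_at[OF overlap_point(1,4), of v w u]
    unfolding metric_at_def by simp
qed

text \<open>In the half-sum of three metric derivatives, the terms with second derivatives of
  \<open>\<tau>\<close> cancel in pairs by symmetry of the metric and of second derivatives; two
  equal ones survive and give the inhomogeneous term.\<close>

lemma christoffel_transform:
  "dirD \<tau> (christoffel g c (snd c x) v w) (snd c x) =
     christoffel g c' (snd c' x) (dirD \<tau> v (snd c x)) (dirD \<tau> w (snd c x))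
     + dirD (dirD \<tau> w) v (snd c x)"
proof -
  let ?S = "snd c ` (fst c \<inter> fst c')" and ?y = "snd c x"
  have S: "open ?S" "?y \<in> ?S" using overlap_point open_overlap by auto
  have C: "Ck_on 2 ?S \<tau>" unfolding \<tau>_def by (rule transition_Ck) (use overlap_point in auto)
  have sym: "dirD (dirD \<tau> w) v ?y = dirD (dirD \<tau> v) w ?y" for v w
    using euclidean_dirD2_symmetric[OF S C] .
  have gt: "gloc c ?y v w = gloc c' (snd c' x) (dirD \<tau> v ?y) (dirD \<tau> w ?y)" for v w
    using gloc_transform[OF overlap_point(1,2,3), of v w] overlap_point(5)
    by (simp add: \<tau>_def)
  have lin: "linear (\<lambda>v. dirD \<tau> v ?y)"
    using linear_frechet_derivative[OF Ck_on_2D(1)[OF C S(2)]] .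
  \<comment> \<open>The differential of \<open>\<tau>\<close> pulls a positive form back to a
    positive form, hence is injective and so surjective. Every test vector \<open>k'\<close> in the
    target chart is therefore an image.\<close>
  have "v = 0" if "dirD \<tau> v ?y = 0" for v
    using gloc_pos[OF overlap_point(1,4), of v] gt[of v v] that by (auto simp: blinfun.bilinear_simps)
  then have "inj (\<lambda>v. dirD \<tau> v ?y)" using lin by (simp add: linear_injective_0)
  then have surj: "surj (\<lambda>v. dirD \<tau> v ?y)" using lin by (simp add: linear_injective_imp_surjective)
  have gs: "gloc c' (snd c' x) v w = gloc c' (snd c' x) w v" for v w
    by (rule gloc_sym) (use overlap_point in auto)
  have lower: "christoffel_lower c ?y v w k =
     christoffel_lower c' (snd c' x) (dirD \<tau> v ?y) (dirD \<tau> w ?y) (dirD \<tau> k ?y)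
     + gloc c' (snd c' x) (dirD (dirD \<tau> w) v ?y) (dirD \<tau> k ?y)" for k
  proof -
    have "gloc c' (snd c' x) (dirD \<tau> w ?y) (dirD (dirD \<tau> k) v ?y) = gloc c' (snd c' x) (dirD (dirD \<tau> v) k ?y) (dirD \<tau> w ?y)"
      using gs sym by metis
    moreover have "gloc c' (snd c' x) (dirD \<tau> v ?y) (dirD (dirD \<tau> k) w ?y) = gloc c' (snd c' x) (dirD \<tau> v ?y) (dirD (dirD \<tau> w) k ?y)"
      using sym by metis
    moreover have "gloc c' (snd c' x) (dirD (dirD \<tau> v) w ?y) (dirD \<tau> k ?y) = gloc c' (snd c' x) (dirD (dirD \<tau> w) v ?y) (dirD \<tau> k ?y)"
      using sym by metis
    ultimately show ?thesis
      unfolding christoffel_lower_def dirD_gloc_transform by (simp add: field_simps)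
  qed
  have "gloc c' (snd c' x) (dirD \<tau> (christoffel g c ?y v w) ?y - dirD (dirD \<tau> w) v ?y) k'
    = christoffel_lower c' (snd c' x) (dirD \<tau> v ?y) (dirD \<tau> w ?y) k'" for k'
  proof -
    obtain k where k: "k' = dirD \<tau> k ?y" using surj by (metis surjD)
    show ?thesis
      using gt[of "christoffel g c ?y v w" k] gloc_christoffel[OF overlap_point(1,4), of v w k] lower[of k] k
      by (simp add: blinfun.bilinear_simps)
  qed
  then have "dirD \<tau> (christoffel g c ?y v w) ?y - dirD (dirD \<tau> w) v ?y
     = christoffel g c' (snd c' x) (dirD \<tau> v ?y) (dirD \<tau> w ?y)"
    using christoffel_eq_iff[OF overlap_point(2,6)] by blast
  then show ?thesis by (simp add: algebra_simps)
qed

end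

section \<open>Continuity of the Christoffel symbols\<close>

lemma dirD_gloc_continuous: "c \<in> \<A> \<Longrightarrow> continuous_on (snd c ` fst c) (dirD (gloc c) v)"
  using Ck_on_2D(4)[OF gloc_Ck] .

lemma christoffel_continuous:
  assumes c: "c \<in> \<A>"
  shows "continuous_on (snd c ` fst c) (\<lambda>y. christoffel g c y v w)"
proof (rule continuous_at_imp_continuous_on, rule ballI)
  let ?S = "snd c ` fst c"
  fix y assume y: "y \<in> ?S"
  have [simp]: "open ?S" using c by simp
  define z where "z = christoffel g c y v w"
  \<comment> \<open>The coercivity constant is the minimum of the quadratic form on the unit
    sphere.\<close>
  obtain m where m: "m > 0" "\<And>u. gloc c y u u \<ge> m * (norm u)^2"
  proof -
    have 1: "compact (sphere (0::'e) 1)" by simp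
    have 2: "sphere (0::'e) 1 \<noteq> {}" by simp
    have 3: "continuous_on (sphere 0 1) (\<lambda>u. gloc c y u u)"
      by (intro continuous_intros)
    obtain u0 where u0: "u0 \<in> sphere 0 1" "\<And>u. u \<in> sphere 0 1 \<Longrightarrow> gloc c y u0 u0 \<le> gloc c y u u"
      using continuous_attains_inf[OF 1 2 3] by blast
    show thesis
    proof (rule that)
      show "gloc c y u0 u0 > 0" by (rule gloc_pos[OF c y]) (use u0 in auto)
      show "gloc c y u0 u0 * (norm u)^2 \<le> gloc c y u u" for u
      proof (cases "u = 0")
        case False
        have "gloc c y u0 u0 \<le> gloc c y (u /\<^sub>R norm u) (u /\<^sub>R norm u)"
          by (rule u0(2)) (use False in simp)
        then show ?thesis using False
          by (simp add: blinfun.bilinear_simps power2_eq_square field_simps)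
      qed (simp add: blinfun.bilinear_simps)
    qed
  qed
  define E where "E y' = norm (gloc c y' - gloc c y)" for y'
  \<comment> \<open>The defect of the vector \<open>z\<close> in the equation that characterizes the
    Christoffel vector at \<open>y'\<close>; it vanishes at \<open>y\<close>.\<close>
  define b where "b y' = Blinfun (christoffel_lower c y' v w) - gloc c y' z" for y'
  have cg: "continuous_on ?S (gloc c)" using Ck_on_2D(3)[OF gloc_Ck[OF c]] .
  have app: "blinfun_apply (Blinfun (christoffel_lower c y' v w)) = christoffel_lower c y' v w" if "y' \<in> ?S" for y'
    by (rule bounded_linear_Blinfun_apply)
       (use christoffel_lower_linear(1)[OF c that] in \<open>simp add: linear_conv_bounded_linear\<close>)
  have "continuous_on ?S (\<lambda>y'. Blinfun (christoffel_lower c y' v w))"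
  proof (rule continuous_on_blinfun_componentwise)
    fix k :: 'e
    have "continuous_on ?S (\<lambda>y'. christoffel_lower c y' v w k)"
      unfolding christoffel_lower_def
      by (intro continuous_intros dirD_gloc_continuous[OF c])
         (auto intro!: continuous_intros dirD_gloc_continuous[OF c])
    then show "continuous_on ?S (\<lambda>y'. Blinfun (christoffel_lower c y' v w) k)"
      by (rule continuous_on_eq) (simp add: app)
  qed
  then have "continuous_on ?S b" unfolding b_def using cg by (auto intro!: continuous_intros)
  then have "continuous_on ?S (\<lambda>y'. norm (b y'))" by (intro continuous_intros)
  moreover have "b y = 0"
    by (rule blinfun_eqI) (simp add: b_def blinfun.bilinear_simps app[OF y] z_def gloc_christoffel[OF c y])
  moreover have "continuous_on ?S E" unfolding E_def using cg by (intro continuous_intros)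
  moreover have "E y = 0" by (simp add: E_def)
  ultimately have "isCont (\<lambda>y'. norm (b y')) y" "norm (b y) = 0" "isCont E y" "E y = 0"
    using y by (auto simp: continuous_on_eq_continuous_at[OF \<open>open ?S\<close>])
  then have lb: "(\<lambda>y'. norm (b y')) \<midarrow>y\<rightarrow> 0" and lE: "E \<midarrow>y\<rightarrow> 0"
    using isContD by fastforce+
  have evS: "\<forall>\<^sub>F y' in at y. y' \<in> ?S" using y \<open>open ?S\<close> by (rule eventually_at_in_open'[rotated])
  \<comment> \<open>The variation of the metric may absorb half of the coercivity; the other half
    yields the factor \<open>2 / m\<close> below.\<close>
  have evE: "\<forall>\<^sub>F y' in at y. E y' < m / 2" using order_tendstoD(2)[OF lE, of "m/2"] m by simp
  have bound: "\<forall>\<^sub>F y' in at y. norm (christoffel g c y' v w - z) \<le> norm (b y') * (2 / m)"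
    using evS evE
  proof eventually_elim
    case (elim y')
    define d where "d = christoffel g c y' v w - z"
    have "m * (norm d)^2 \<le> gloc c y d d" by (rule m)
    also have "\<dots> = gloc c y' d d - (gloc c y' - gloc c y) d d"
      by (simp add: blinfun.bilinear_simps)
    also have "gloc c y' d d = b y' d"
      using gloc_christoffel[OF c elim(1)] app[OF elim(1)]
      by (simp add: d_def b_def blinfun.bilinear_simps)
    also have "b y' d - (gloc c y' - gloc c y) d d \<le> norm (b y') * norm d + E y' * norm d * norm d"
    proof -
      have "\<bar>b y' d\<bar> \<le> norm (b y') * norm d" using norm_blinfun[of "b y'" d] by simp
      moreover have "\<bar>(gloc c y' - gloc c y) d d\<bar> \<le> E y' * norm d * norm d"
      proof -
        have "\<bar>(gloc c y' - gloc c y) d d\<bar> \<le> norm ((gloc c y' - gloc c y) d) * norm d"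
          using norm_blinfun[of "(gloc c y' - gloc c y) d" d] by simp
        also have "\<dots> \<le> E y' * norm d * norm d"
          unfolding E_def by (intro mult_right_mono norm_blinfun) auto
        finally show ?thesis .
      qed
      ultimately show ?thesis by linarith
    qed
    also have "\<dots> \<le> norm (b y') * norm d + m / 2 * norm d * norm d"
      using elim(2) by (intro add_left_mono mult_right_mono) auto
    finally have *: "m / 2 * norm d * norm d \<le> norm (b y') * norm d"
      by (simp add: power2_eq_square field_simps)
    have "m / 2 * norm d \<le> norm (b y')"
    proof (cases "norm d = 0")
      case False
      then have "0 < norm d" by simp
      then show ?thesis using * by (rule mult_right_le_imp_le[rotated])
    qed simp
    then have "norm d \<le> norm (b y') * (2 / m)" using m(1) by (simp add: field_simps)
    then show ?case unfolding d_def .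
  qed
  have "(\<lambda>y'. norm (b y') * (2 / m)) \<midarrow>y\<rightarrow> 0" using tendsto_mult_right[OF lb, of "2/m"] by simp
  then have "(\<lambda>y'. christoffel g c y' v w - z) \<midarrow>y\<rightarrow> 0"
    using bound by (rule Lim_null_comparison[rotated])
  then have "(\<lambda>y'. christoffel g c y' v w) \<midarrow>y\<rightarrow> z" by (rule LIM_zero_cancel)
  then show "isCont (\<lambda>y. christoffel g c y v w) y" unfolding isCont_def z_def .
qed

end

section \<open>Jets of twice differentiable functions\<close>

text \<open>On the line through \<open>y\<close> in direction \<open>v\<close>, a negative second
  derivative would make the first derivative negative just to the right of 0, and by the mean value
  theorem \<open>h\<close> would fall below its minimum.\<close>

lemma local_min_second_derivative:
  fixes h :: "'e::euclidean_space \<Rightarrow> real"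
  assumes S: "open S" "y \<in> S" and C: "Ck_on 2 S h" and min: "\<And>z. z \<in> S \<Longrightarrow> h y \<le> h z"
  shows "dirD h v y = 0" and "0 \<le> dirD (dirD h v) v y"
proof -
  have zero: "dirD h v y = 0" for v
    using differential_zero_maxmin[OF S(2,1) has_derivative_dirD[OF Ck_on_2D(1)[OF C S(2)]]] min
    by metis
  then show "dirD h v y = 0" .
  show "0 \<le> dirD (dirD h v) v y"
  proof (rule ccontr)
    assume neg: "\<not> ?thesis"
    have "continuous_on UNIV (\<lambda>t::real. y + t *\<^sub>R v)" by (intro continuous_intros)
    then have "open ((\<lambda>t::real. y + t *\<^sub>R v) -` S)" using S(1) by (rule open_vimage[rotated])
    moreover have "0 \<in> (\<lambda>t::real. y + t *\<^sub>R v) -` S" using S(2) by simp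
    ultimately obtain d where d: "d > 0" "ball 0 d \<subseteq> (\<lambda>t::real. y + t *\<^sub>R v) -` S"
      using open_contains_ball by blast
    then have inS: "y + t *\<^sub>R v \<in> S" if "\<bar>t\<bar> < d" for t using that by (auto simp: dist_real_def)
    have line: "((\<lambda>t. y + t *\<^sub>R v) has_derivative (\<lambda>r. r *\<^sub>R v)) (at t)" for t
      by (auto intro!: derivative_eq_intros)
    have k1: "((\<lambda>t. h (y + t *\<^sub>R v)) has_real_derivative dirD h v (y + t *\<^sub>R v)) (at t)" if "\<bar>t\<bar> < d" for t
      unfolding has_field_derivative_def
      by (rule has_derivative_eq_rhs[OF has_derivative_compose[OF line has_derivative_dirD[OF Ck_on_2D(1)[OF C inS[OF that]]]]])
        (simp add: fun_eq_iff dirD_lin(2)[OF Ck_on_2D(1)[OF C inS[OF that]]])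
    have "((\<lambda>t. dirD h v (y + t *\<^sub>R v)) has_real_derivative dirD (dirD h v) v (y + 0 *\<^sub>R v)) (at 0)"
      unfolding has_field_derivative_def
      by (rule has_derivative_eq_rhs[OF has_derivative_compose[OF line has_derivative_dirD[OF Ck_on_2D(2)[OF C inS]]]])
        (use d(1) in \<open>simp_all add: fun_eq_iff dirD_lin(2)[OF Ck_on_2D(2)[OF C S(2)]]\<close>)
    then have "((\<lambda>t. dirD h v (y + t *\<^sub>R v)) has_real_derivative dirD (dirD h v) v y) (at 0)" by simp
    from DERIV_neg_dec_right[OF this] neg obtain d' where d': "d' > 0"
      "\<And>t. 0 < t \<Longrightarrow> t < d' \<Longrightarrow> dirD h v (y + t *\<^sub>R v) < 0"
      using zero by auto
    define s where "s = min d d' / 2"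
    have s: "0 < s" "s < d" "s < d'" using d d' by (auto simp: s_def)
    obtain t where t: "0 < t" "t < s" "h (y + s *\<^sub>R v) - h (y + 0 *\<^sub>R v) = (s - 0) * dirD h v (y + t *\<^sub>R v)"
      using MVT2[OF s(1), of "\<lambda>t. h (y + t *\<^sub>R v)" "\<lambda>t. dirD h v (y + t *\<^sub>R v)"] k1 s by auto
    then have "h (y + s *\<^sub>R v) < h y"
      using d'(2)[of t] s mult_pos_neg[of s "dirD h v (y + t *\<^sub>R v)"] by auto
    then show False using min[OF inS, of s] s by auto
  qed
qed

lemma Ck_fun_on_subset: "Ck_fun_on \<A> k W f \<Longrightarrow> V \<subseteq> W \<Longrightarrow> Ck_fun_on \<A> k V f"
  unfolding Ck_fun_on_def using Ck_on_subset by (metis image_mono Int_mono order_refl)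

text \<open>The conditions on the fibres of a subequation that do not involve its topology.\<close>

definition monotone_jets :: "('m, 'e::euclidean_space) chart set \<Rightarrow> ('m, 'e) jet set \<Rightarrow> bool" where
  "monotone_jets \<A> G \<longleftrightarrow> G \<subseteq> jet_bundle \<A> \<and>
     (\<forall>x r p A B. (x, r, p, A) \<in> G \<and> B \<in> sym2_nonneg \<A> x \<longrightarrow> (x, r, p, (\<lambda>c. A c + B c)) \<in> G) \<and>
     (\<forall>x r p A s. (x, r, p, A) \<in> G \<and> s \<le> 0 \<longrightarrow> (x, r + s, p, A) \<in> G)"

lemma subequation_monotone: "subequation \<A> F \<Longrightarrow> monotone_jets \<A> F"
  unfolding subequation_def monotone_jets_def by (elim conjE) (intro conjI)

context riemannian
begin

section \<open>Differential and Hessian in charts, and their tensor laws\<close>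

lemma Ck_fun_on_locD:
  "Ck_fun_on \<A> k W f \<Longrightarrow> c \<in> \<A> \<Longrightarrow> Ck_on k (snd c ` (W \<inter> fst c)) (f \<circ> chart_inv c)"
  unfolding Ck_fun_on_def by blast

lemma Ck_fun_on_affine:
  assumes "open W" "Ck_fun_on \<A> k W f" "Ck_fun_on \<A> k W \<psi>"
  shows "Ck_fun_on \<A> k W (\<lambda>y. a * f y + e * \<psi> y + s)"
  unfolding Ck_fun_on_def
proof
  fix c assume c: "c \<in> \<A>"
  have o: "open (snd c ` (W \<inter> fst c))" using open_chart_image[OF c assms(1)] .
  have "Ck_on k (snd c ` (W \<inter> fst c)) (\<lambda>y. a * (f \<circ> chart_inv c) y + e * (\<psi> \<circ> chart_inv c) y + s)"
    by (intro Ck_on_add[OF o] Ck_on_const Ck_on_bounded_linear[OF o bounded_linear_mult_right] Ck_fun_on_locD[OF _ c] assms)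
  then show "Ck_on k (snd c ` (W \<inter> fst c)) ((\<lambda>y. a * f y + e * \<psi> y + s) \<circ> chart_inv c)"
    by (simp add: comp_def)
qed

text \<open>The universal perturbation of test functions: with \<open>p\<close> the image of a point
  of the chart, it vanishes there only and is bounded below on the rim of a chart ball.\<close>

lemma Ck_fun_on_sq_dist:
  assumes c: "c \<in> \<A>"
  shows "Ck_fun_on \<A> k (fst c) (\<lambda>x. (dist (snd c x) p)\<^sup>2)"
  unfolding Ck_fun_on_def
proof
  fix c' assume c': "c' \<in> \<A>"
  let ?S = "snd c' ` (fst c \<inter> fst c')"
  have o: "open ?S" using open_overlap[OF c' c] by (simp add: Int_commute)
  have "Ck_on k ?S (snd c \<circ> chart_inv c')"
    using transition_Ck[OF c' c] by (simp add: Int_commute)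
  then have 1: "Ck_on k ?S (\<lambda>y. (snd c \<circ> chart_inv c') y + (- p))"
    by (intro Ck_on_add[OF o] Ck_on_const)
  have "Ck_on k ?S (\<lambda>y. ((snd c \<circ> chart_inv c') y + (- p)) \<bullet> ((snd c \<circ> chart_inv c') y + (- p)))"
    by (rule Ck_on_inner[OF o 1 1])
  then show "Ck_on k ?S ((\<lambda>x. (dist (snd c x) p)\<^sup>2) \<circ> chart_inv c')"
    by (simp add: comp_def dist_norm power2_norm_eq_inner)
qed

text \<open>The scalar form behind \<open>hessian\<close>, free of \<open>Blinfun\<close>, on which
  the calculus rules act directly.\<close>

definition hess_form :: "('m, 'e) chart \<Rightarrow> ('m \<Rightarrow> real) \<Rightarrow> 'e \<Rightarrow> 'e \<Rightarrow> 'e \<Rightarrow> real" where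
  "hess_form c f y v w = dirD (dirD (f \<circ> chart_inv c) w) v y
     - dirD (f \<circ> chart_inv c) (christoffel g c y v w) y"

context
  fixes f W x c
  assumes W: "open W" "x \<in> W" and f: "Ck_fun_on \<A> 2 W f" and c: "c \<in> charts_at \<A> x"
begin

lemma loc_C2: "open (snd c ` (W \<inter> fst c))" "snd c x \<in> snd c ` (W \<inter> fst c)"
    "Ck_on 2 (snd c ` (W \<inter> fst c)) (f \<circ> chart_inv c)" "c \<in> \<A>" "snd c x \<in> snd c ` fst c"
  using open_chart_image[OF _ W(1)] charts_atD[OF c] W(2) Ck_fun_on_locD[OF f] by blast+

lemma differential_apply: "differential \<A> x f c v = dirD (f \<circ> chart_inv c) v (snd c x)"
proof -
  have "linear (frechet_derivative (f \<circ> chart_inv c) (at (snd c x)))"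
    by (rule linear_frechet_derivative[OF Ck_on_2D(1)[OF loc_C2(3,2)]])
  then show ?thesis using c
    unfolding differential_def by (simp add: bounded_linear_Blinfun_apply linear_conv_bounded_linear)
qed

lemma hess_form_linear: "linear (hess_form c f (snd c x) v)" "linear (\<lambda>v. hess_form c f (snd c x) v w)"
proof -
  note d = Ck_on_2D(1)[OF loc_C2(3,2)] Ck_on_2D(2)[OF loc_C2(3,2)]
  note simps = dirD_lin[OF d(1)] dirD_lin[OF d(2)] dirD2_lin_inner[OF loc_C2(1,2,3)]
     linear_add[OF christoffel_linear(1)[OF loc_C2(4,5)]] linear_scale[OF christoffel_linear(1)[OF loc_C2(4,5)]]
     linear_add[OF christoffel_linear(2)[OF loc_C2(4,5)]] linear_scale[OF christoffel_linear(2)[OF loc_C2(4,5)]]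
  show "linear (hess_form c f (snd c x) v)" "linear (\<lambda>v. hess_form c f (snd c x) v w)"
    unfolding hess_form_def by (rule linearI; simp add: simps algebra_simps)+
qed

lemma hessian_apply: "hessian \<A> g x f c v w = hess_form c f (snd c x) v w"
proof -
  have "hessian \<A> g x f c = Blinfun (\<lambda>v. Blinfun (hess_form c f (snd c x) v))"
    using c unfolding hessian_def hess_form_def by simp
  then show ?thesis using blinfun2_apply[OF hess_form_linear] by simp
qed

lemma hess_form_sym: "hess_form c f (snd c x) v w = hess_form c f (snd c x) w v"
  unfolding hess_form_def
  using dirD2_symmetric[OF loc_C2(1,2,3), of v w] christoffel_sym[OF loc_C2(4,5), of v w] by simp

end

text \<open>The extra term of the second-order chain rule cancels against the inhomogeneous term in
  the law for the Christoffel symbols; this is why the covariant Hessian is a tensor.\<close>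

lemma differential_transform:
  assumes W: "open W" "x \<in> W" and f: "Ck_fun_on \<A> 2 W f"
    and cc: "c \<in> charts_at \<A> x" "c' \<in> charts_at \<A> x"
  shows "differential \<A> x f c v = differential \<A> x f c' (tangent_transition c c' x v)"
    and "hessian \<A> g x f c v w = hessian \<A> g x f c' (tangent_transition c c' x v) (tangent_transition c c' x w)"
proof -
  define \<tau> where "\<tau> = snd c' \<circ> chart_inv c"
  let ?S = "snd c ` (W \<inter> fst c \<inter> fst c')" and ?T = "snd c' ` (W \<inter> fst c')" and ?y = "snd c x"
  note A = overlap_point[OF cc]
  have S: "open ?S" "?y \<in> ?S"
    using open_chart_image[OF A(1) open_Int[OF W(1) open_fst[OF A(2)]]] W A(1,2) charts_atD[OF cc(1)] charts_atD[OF cc(2)]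
    by (auto simp: ac_simps)
  have T: "\<tau> ` ?S \<subseteq> ?T" using A(1) by (auto simp: \<tau>_def)
  have C: "Ck_on 2 ?S \<tau>" unfolding \<tau>_def
    by (rule Ck_on_subset[OF transition_Ck[OF A(1,2)]]) auto
  have f': "Ck_on 2 ?T (f \<circ> chart_inv c')" using Ck_fun_on_locD[OF f A(2)] .
  have fc: "Ck_on 2 ?S (f \<circ> chart_inv c)" by (rule Ck_on_subset[OF Ck_fun_on_locD[OF f A(1)]]) auto
  have eq: "(f \<circ> chart_inv c) y = ((f \<circ> chart_inv c') \<circ> \<tau>) y" if "y \<in> ?S" for y
    using that A(1,2) by (auto simp: \<tau>_def)
  have 1: "dirD (f \<circ> chart_inv c) v ?y = dirD (f \<circ> chart_inv c') (dirD \<tau> v ?y) (\<tau> ?y)" for v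
    using dirD_cong[OF S eq Ck_on_2D(1)[OF fc S(2)], of v] unfolding dirD2_chain(1)[OF S C T f'] .
  have 2: "dirD (dirD (f \<circ> chart_inv c) w) v ?y =
     dirD (dirD (f \<circ> chart_inv c') (dirD \<tau> w ?y)) (dirD \<tau> v ?y) (\<tau> ?y)
     + dirD (f \<circ> chart_inv c') (dirD (dirD \<tau> w) v ?y) (\<tau> ?y)"
    using dirD2_cong[OF S eq fc, of w v] unfolding dirD2_chain(2)[OF S C T f'] .
  have \<tau>y: "\<tau> ?y = snd c' x" using A(5) by (simp add: \<tau>_def)
  have tt: "tangent_transition c c' x v = dirD \<tau> v ?y" for v by (simp add: tangent_transition_def \<tau>_def)
  show "differential \<A> x f c v = differential \<A> x f c' (tangent_transition c c' x v)"
    unfolding differential_apply[OF W f cc(1)] differential_apply[OF W f cc(2)] tt 1 \<tau>y ..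
  have d': "f \<circ> chart_inv c' differentiable (at (snd c' x))"
    using Ck_on_2D(1)[OF loc_C2(3,2)[OF W f cc(2)]] .
  have "dirD (f \<circ> chart_inv c) (christoffel g c ?y v w) ?y
     = dirD (f \<circ> chart_inv c') (christoffel g c' (snd c' x) (dirD \<tau> v ?y) (dirD \<tau> w ?y)) (snd c' x)
     + dirD (f \<circ> chart_inv c') (dirD (dirD \<tau> w) v ?y) (snd c' x)"
    unfolding 1 \<tau>y using christoffel_transform[OF cc, of v w, folded \<tau>_def] dirD_lin(1)[OF d'] by simp
  then show "hessian \<A> g x f c v w = hessian \<A> g x f c' (tangent_transition c c' x v) (tangent_transition c c' x w)"
    unfolding hessian_apply[OF W f cc(1)] hessian_apply[OF W f cc(2)] tt hess_form_def 2 \<tau>y by simp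
qed

lemma jets_in_bundle:
  assumes W: "open W" "x \<in> W" and f: "Ck_fun_on \<A> 2 W f"
  shows "differential \<A> x f \<in> covectors \<A> x" "hessian \<A> g x f \<in> sym2 \<A> x"
    "jet2 \<A> g x f \<in> jet_bundle \<A>" "red_jet2 \<A> g x f \<in> red_jet_bundle \<A>"
proof -
  show 1: "differential \<A> x f \<in> covectors \<A> x"
    unfolding covectors_def
    by (intro CollectI conjI allI impI ballI differential_transform(1)[OF W f]) (simp_all add: differential_def)
  have "hessian \<A> g x f c v w = hessian \<A> g x f c w v" if "c \<in> charts_at \<A> x" for c v w
    unfolding hessian_apply[OF W f that] by (rule hess_form_sym[OF W f that])
  moreover have "hessian \<A> g x f c = 0" if "c \<notin> charts_at \<A> x" for c
    using that by (simp add: hessian_def)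
  ultimately show 2: "hessian \<A> g x f \<in> sym2 \<A> x"
    unfolding sym2_def mem_Collect_eq by (intro conjI allI ballI impI differential_transform(2)[OF W f])
  show "jet2 \<A> g x f \<in> jet_bundle \<A>" "red_jet2 \<A> g x f \<in> red_jet_bundle \<A>"
    using 1 2 by (auto simp: jet2_def red_jet2_def jet_bundle_def red_jet_bundle_def)
qed

lemma differential_outside: "c \<notin> charts_at \<A> x \<Longrightarrow> differential \<A> x f c = 0"
  and hessian_outside: "c \<notin> charts_at \<A> x \<Longrightarrow> hessian \<A> g x f c = 0"
  by (simp_all add: differential_def hessian_def)

text \<open>One formula for all later modifications of a test function: adding
  \<open>e * q + s\<close>, negating, and steepening a barrier.\<close>

lemma jet_affine:
  assumes W: "open W" "x \<in> W" and f: "Ck_fun_on \<A> 2 W f" and \<psi>: "Ck_fun_on \<A> 2 W \<psi>"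
  shows "differential \<A> x (\<lambda>y. a * f y + e * \<psi> y + s) c
      = a *\<^sub>R differential \<A> x f c + e *\<^sub>R differential \<A> x \<psi> c"
    and "hessian \<A> g x (\<lambda>y. a * f y + e * \<psi> y + s) c
      = a *\<^sub>R hessian \<A> g x f c + e *\<^sub>R hessian \<A> g x \<psi> c"
proof -
  let ?h = "\<lambda>y. a * f y + e * \<psi> y + s"
  have h: "Ck_fun_on \<A> 2 W ?h" by (rule Ck_fun_on_affine[OF W(1) f \<psi>])
  have *: "differential \<A> x ?h c = a *\<^sub>R differential \<A> x f c + e *\<^sub>R differential \<A> x \<psi> c \<and>
     hessian \<A> g x ?h c = a *\<^sub>R hessian \<A> g x f c + e *\<^sub>R hessian \<A> g x \<psi> c"
  proof (cases "c \<in> charts_at \<A> x")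
    case False
    then show ?thesis by (simp add: differential_outside hessian_outside)
  next
    case c: True
    let ?S = "snd c ` (W \<inter> fst c)" and ?y = "snd c x"
    let ?f = "f \<circ> chart_inv c" and ?p = "\<psi> \<circ> chart_inv c"
    note F = loc_C2[OF W f c] and P = loc_C2[OF W \<psi> c]
    have hc: "?h \<circ> chart_inv c = (\<lambda>y. a * ?f y + (e * ?p y + s))" by (auto simp: fun_eq_iff)
    have C1: "Ck_on 2 ?S (\<lambda>y. a * ?f y)"
      by (rule Ck_on_bounded_linear[OF F(1) bounded_linear_mult_right F(3)])
    have C2: "Ck_on 2 ?S (\<lambda>y. e * ?p y)"
      by (rule Ck_on_bounded_linear[OF F(1) bounded_linear_mult_right P(3)])
    have C3: "Ck_on 2 ?S (\<lambda>y. s)" by (rule Ck_on_const)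
    have C23: "Ck_on 2 ?S (\<lambda>y. e * ?p y + s)" by (rule Ck_on_add[OF F(1) C2 C3])
    note D = Ck_on_2D(1)[OF _ F(2)]
    have d1: "dirD (?h \<circ> chart_inv c) v ?y = a * dirD ?f v ?y + e * dirD ?p v ?y" for v
      unfolding hc dirD_add[OF D[OF C1] D[OF C23]] dirD_add[OF D[OF C2] D[OF C3]]
        dirD_bounded_linear[OF bounded_linear_mult_right D[OF F(3)]]
        dirD_bounded_linear[OF bounded_linear_mult_right D[OF P(3)]] by simp
    have d2: "dirD (dirD (?h \<circ> chart_inv c) w) v ?y = a * dirD (dirD ?f w) v ?y + e * dirD (dirD ?p w) v ?y" for v w
      unfolding hc dirD2_add[OF F(1,2) C1 C23] dirD2_add[OF F(1,2) C2 C3]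
        dirD2_bounded_linear[OF F(1,2) F(3) bounded_linear_mult_right]
        dirD2_bounded_linear[OF F(1,2) P(3) bounded_linear_mult_right] by simp
    show ?thesis
      unfolding hess_form_def
      by (intro conjI blinfun_eqI) (simp_all add: differential_apply[OF W h c] differential_apply[OF W f c] differential_apply[OF W \<psi> c]
          hessian_apply[OF W h c] hessian_apply[OF W f c] hessian_apply[OF W \<psi> c]
          blinfun.bilinear_simps d1 d2 hess_form_def right_diff_distrib)
  qed
  then show "differential \<A> x ?h c = a *\<^sub>R differential \<A> x f c + e *\<^sub>R differential \<A> x \<psi> c"
    "hessian \<A> g x ?h c = a *\<^sub>R hessian \<A> g x f c + e *\<^sub>R hessian \<A> g x \<psi> c" by auto
qed

lemma jet_continuous:
  assumes W: "open W" and f: "Ck_fun_on \<A> 2 W f" and c: "c \<in> \<A>"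
  shows "continuous_on (W \<inter> fst c) f"
    and "continuous_on (W \<inter> fst c) (\<lambda>x. differential \<A> x f c)"
    and "continuous_on (W \<inter> fst c) (\<lambda>x. hessian \<A> g x f c)"
proof -
  let ?S = "snd c ` (W \<inter> fst c)" and ?f = "f \<circ> chart_inv c"
  have C: "Ck_on 2 ?S ?f" by (rule Ck_fun_on_locD[OF f c])
  have pull: "continuous_on (W \<inter> fst c) (\<lambda>x. h (snd c x))" if "continuous_on ?S h" for h :: "'e \<Rightarrow> real"
    by (rule continuous_on_compose2[OF that]) (use chart_continuous[OF c] in \<open>auto intro: continuous_on_subset\<close>)
  have chrt: "c \<in> charts_at \<A> x" if "x \<in> W \<inter> fst c" for x using that c by (simp add: charts_at_def)
  show "continuous_on (W \<inter> fst c) f"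
    by (rule continuous_on_eq[OF pull[OF Ck_on_2D(3)[OF C]]]) (use c in auto)
  show "continuous_on (W \<inter> fst c) (\<lambda>x. differential \<A> x f c)"
  proof (rule continuous_on_blinfun_componentwise)
    fix v :: 'e
    show "continuous_on (W \<inter> fst c) (\<lambda>x. differential \<A> x f c v)"
      by (rule continuous_on_eq[OF pull[OF Ck_on_2D(4)[OF C, of v]]])
         (use differential_apply[OF W _ f chrt] in auto)
  qed
  show "continuous_on (W \<inter> fst c) (\<lambda>x. hessian \<A> g x f c)"
  proof (rule continuous_on_blinfun_componentwise, rule continuous_on_blinfun_componentwise)
    fix v w :: 'e
    have G: "continuous_on ?S (\<lambda>y. christoffel g c y v w)"
      by (rule continuous_on_subset[OF christoffel_continuous[OF c]]) auto
    \<comment> \<open>The direction moves with the point, so it is expanded in the basis to use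
      continuity of the derivatives in fixed directions.\<close>
    have "continuous_on ?S (\<lambda>y. \<Sum>b\<in>Basis. (christoffel g c y v w \<bullet> b) * dirD ?f b y)"
      by (intro continuous_intros G Ck_on_2D(4)[OF C])
    then have "continuous_on ?S (\<lambda>y. dirD ?f (christoffel g c y v w) y)"
    proof (rule continuous_on_eq)
      fix y assume "y \<in> ?S"
      then have "linear (\<lambda>v. dirD ?f v y)" by (intro linear_frechet_derivative Ck_on_2D(1)[OF C])
      from Linear_Algebra.linear_componentwise[OF this, of "christoffel g c y v w" 1]
      show "(\<Sum>b\<in>Basis. (christoffel g c y v w \<bullet> b) * dirD ?f b y) = dirD ?f (christoffel g c y v w) y"
        by simp
    qed
    then have "continuous_on ?S (\<lambda>y. hess_form c f y v w)"
      unfolding hess_form_def by (intro continuous_intros Ck_on_2D(5)[OF C])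
    from pull[OF this] show "continuous_on (W \<inter> fst c) (\<lambda>x. hessian \<A> g x f c v w)"
      by (rule continuous_on_eq) (use hessian_apply[OF W _ f chrt] in auto)
  qed
qed

lemma C2_continuous:
  assumes W: "open W" and f: "Ck_fun_on \<A> 2 W f"
  shows "continuous_on W f"
proof (rule continuous_at_imp_continuous_on, rule ballI)
  fix x assume x: "x \<in> W"
  obtain c where c: "c \<in> charts_at \<A> x" using charts_at_exists by blast
  show "isCont f x"
    using jet_continuous(1)[OF W f charts_atD(1)[OF c]] x charts_atD[OF c] W
    by (simp add: continuous_on_eq_continuous_at open_Int)
qed

section \<open>Topology of the jet bundles and stability of open jet conditions\<close>

lemma topspace_jet_topology: "topspace (jet_topology \<A>) = jet_bundle \<A>"
proof
  show "topspace (jet_topology \<A>) \<subseteq> jet_bundle \<A>" unfolding jet_topology_def by auto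
  show "jet_bundle \<A> \<subseteq> topspace (jet_topology \<A>)"
  proof
    fix J assume J: "J \<in> jet_bundle \<A>"
    obtain x r p A where x: "J = (x, r, p, A)" by (cases J) auto
    obtain c where c: "c \<in> charts_at \<A> x" using charts_at_exists by blast
    have "J \<in> {(x, r, p, A). (x, r, p, A) \<in> jet_bundle \<A> \<and> x \<in> fst c \<and> (snd c x, r, p c, A c) \<in> UNIV}"
      using J charts_atD[OF c] unfolding x by simp
    then show "J \<in> topspace (jet_topology \<A>)"
      unfolding jet_topology_def topology_generated_by_topspace
      by (rule UnionI[rotated]) (rule CollectI, rule exI[of _ c], rule exI[of _ UNIV], intro conjI refl charts_atD(1)[OF c] open_UNIV)
  qed
qed

text \<open>Over \<open>W\<close> the jet is affine in the parameters with coefficients continuous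
  in the point, so preimages of the generating sets can be computed in one chart.\<close>

lemma jet2_perturbed_continuous:
  assumes W: "open W" and f: "Ck_fun_on \<A> 2 W f" and \<psi>: "Ck_fun_on \<A> 2 W \<psi>"
  shows "continuous_map (top_of_set (W \<times> UNIV)) (jet_topology \<A>)
     (\<lambda>(y, e, s). jet2 \<A> g y (\<lambda>z. f z + e * \<psi> z + s))"
    (is "continuous_map ?T _ ?J")
  unfolding jet_topology_def
proof (rule continuous_on_generated_topo)
  have J: "?J (y, e, s) = (y, f y + e * \<psi> y + s,
      (\<lambda>c. differential \<A> y f c + e *\<^sub>R differential \<A> y \<psi> c), (\<lambda>c. hessian \<A> g y f c + e *\<^sub>R hessian \<A> g y \<psi> c))"
    if "y \<in> W" for y e s
    using jet_affine[OF W that f \<psi>, of 1 e s] by (simp add: jet2_def fun_eq_iff)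
  have inbun: "?J (y, e, s) \<in> jet_bundle \<A>" if "y \<in> W" for y e s
    using jets_in_bundle(3)[OF W that Ck_fun_on_affine[OF W f \<psi>, of 1 e s]] by simp
  let ?\<S> = "{{(x, r, p, A). (x, r, p, A) \<in> jet_bundle \<A> \<and> x \<in> fst c \<and> (snd c x, r, p c, A c) \<in> Q}
      | c Q. c \<in> \<A> \<and> open Q}"
  show "openin ?T (?J -` U \<inter> topspace ?T)" if US: "U \<in> ?\<S>" for U
  proof -
    obtain c Q where c: "c \<in> \<A>" and Q: "open Q"
      and U: "U = {(x, r, p, A). (x, r, p, A) \<in> jet_bundle \<A> \<and> x \<in> fst c \<and> (snd c x, r, p c, A c) \<in> Q}"
      using US by blast
    let ?D = "(W \<inter> fst c) \<times> (UNIV :: (real \<times> real) set)"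
    let ?h = "\<lambda>z::'m \<times> real \<times> real. (snd c (fst z), f (fst z) + fst (snd z) * \<psi> (fst z) + snd (snd z),
       differential \<A> (fst z) f c + fst (snd z) *\<^sub>R differential \<A> (fst z) \<psi> c,
       hessian \<A> g (fst z) f c + fst (snd z) *\<^sub>R hessian \<A> g (fst z) \<psi> c)"
    have fst_cont: "continuous_on ?D (\<lambda>z. h (fst z))" if "continuous_on (W \<inter> fst c) h"
      for h :: "'m \<Rightarrow> 'z::topological_space"
      by (rule continuous_on_compose2[OF that]) (auto intro: continuous_intros)
    have "continuous_on ?D ?h"
      by (intro continuous_intros fst_cont jet_continuous[OF W _ c] f \<psi> continuous_on_subset[OF chart_continuous[OF c]]) auto
    moreover have "open ?D" using W c by (intro open_Times) auto
    ultimately have "open (?D \<inter> ?h -` Q)" using Q by (rule continuous_open_preimage)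
    then have "open (?h -` Q \<inter> ?D)" by (simp only: Int_commute)
    moreover have "?J -` U \<inter> topspace ?T = ?h -` Q \<inter> ?D"
    proof (rule set_eqI)
      fix z :: "'m \<times> real \<times> real"
      obtain y e s where z: "z = (y, e, s)" by (cases z) auto
      show "z \<in> ?J -` U \<inter> topspace ?T \<longleftrightarrow> z \<in> ?h -` Q \<inter> ?D"
      proof (cases "y \<in> W")
        case True
        have "z \<in> ?J -` U \<inter> topspace ?T \<longleftrightarrow> ?J (y,e,s) \<in> U" using True by (simp add: z)
        also have "\<dots> \<longleftrightarrow> y \<in> fst c \<and> ?h z \<in> Q"
          using inbun[OF True, of e s] unfolding J[OF True] U by (simp add: z)
        finally show ?thesis using True by (auto simp: z)
      qed (simp add: z)
    qed
    moreover have "?h -` Q \<inter> ?D \<subseteq> W \<times> UNIV" by auto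
    ultimately show ?thesis by (simp only: open_subset)
  qed
  show "?J ` topspace ?T \<subseteq> \<Union>?\<S>"
    using inbun topspace_jet_topology unfolding jet_topology_def topology_generated_by_topspace by auto
qed

text \<open>An open condition on a jet survives moving the point, adding a small multiple of
  \<open>\<psi>\<close> and adding a small constant, all at once.\<close>

lemma jet2_perturbed_nbhd:
  assumes W: "open W" "x \<in> W" and f: "Ck_fun_on \<A> 2 W f" and \<psi>: "Ck_fun_on \<A> 2 W \<psi>"
    and N: "openin (jet_topology \<A>) N" "jet2 \<A> g x f \<in> N"
  obtains V \<delta> where "open V" "x \<in> V" "V \<subseteq> W" "\<delta> > 0"
    "\<And>y e s. y \<in> V \<Longrightarrow> \<bar>e\<bar> < \<delta> \<Longrightarrow> \<bar>s\<bar> < \<delta> \<Longrightarrow> jet2 \<A> g y (\<lambda>z. f z + e * \<psi> z + s) \<in> N"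
proof -
  let ?J = "\<lambda>(y, e, s). jet2 \<A> g y (\<lambda>z. f z + e * \<psi> z + s)"
  have "openin (top_of_set (W \<times> UNIV)) {z \<in> topspace (top_of_set (W \<times> UNIV)). ?J z \<in> N}"
    by (rule openin_continuous_map_preimage[OF jet2_perturbed_continuous[OF W(1) f \<psi>] N(1)])
  then have o: "open {z \<in> W \<times> UNIV. ?J z \<in> N}"
    using W(1) by (simp add: openin_open_eq open_Times)
  have "(x, 0, 0) \<in> {z \<in> W \<times> UNIV. ?J z \<in> N}" using W(2) N(2) by simp
  with o obtain V E where VE: "open V" "open E" "(x, 0, 0) \<in> V \<times> E" "V \<times> E \<subseteq> {z \<in> W \<times> UNIV. ?J z \<in> N}"
    by (rule open_prod_elim)
  then obtain \<delta> where \<delta>: "\<delta> > 0" "ball (0::real\<times>real) \<delta> \<subseteq> E"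
    using open_contains_ball[of E] by (auto simp: zero_prod_def)
  show thesis
  proof (rule that[of V "\<delta>/2"])
    fix y e s assume a: "y \<in> V" "\<bar>e\<bar> < \<delta>/2" "\<bar>s\<bar> < \<delta>/2"
    have "norm (e, s) \<le> \<bar>e\<bar> + \<bar>s\<bar>" using norm_Pair_le[of e s] by simp
    then have "(e, s) \<in> ball 0 \<delta>" using a by simp
    then have "(y, e, s) \<in> V \<times> E" using \<delta>(2) a(1) by blast
    from subsetD[OF VE(4) this] show "jet2 \<A> g y (\<lambda>z. f z + e * \<psi> z + s) \<in> N" by simp
  qed (use VE \<delta> in auto)
qed

text \<open>The map that forgets the value is continuous, so this reduces to full jets with constant
  \<open>s = 0\<close>.\<close>

lemma red_jet2_perturbed_nbhd:
  assumes W: "open W" "x \<in> W" and f: "Ck_fun_on \<A> 2 W f" and \<psi>: "Ck_fun_on \<A> 2 W \<psi>"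
    and N: "openin (red_jet_topology \<A>) N" "red_jet2 \<A> g x f \<in> N"
  obtains V \<delta> where "open V" "x \<in> V" "V \<subseteq> W" "\<delta> > 0"
    "\<And>y e. y \<in> V \<Longrightarrow> \<bar>e\<bar> < \<delta> \<Longrightarrow> red_jet2 \<A> g y (\<lambda>z. f z + e * \<psi> z) \<in> N"
proof -
  let ?N = "{(x, r, p, A). (x, p, A) \<in> N}"
  have sub: "N \<subseteq> red_jet_bundle \<A>"
  proof -
    have "N \<subseteq> topspace (red_jet_topology \<A>)" by (rule openin_subset[OF N(1)])
    then show ?thesis unfolding red_jet_topology_def by auto
  qed
  have cont: "continuous_map (jet_topology \<A>) (red_jet_topology \<A>) (\<lambda>(x, r, p, A). (x, p, A))"
    (is "continuous_map ?T _ ?\<pi>")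
    unfolding red_jet_topology_def
  proof (rule continuous_on_generated_topo)
    let ?\<S> = "{{(x, p, A). (x, p, A) \<in> red_jet_bundle \<A> \<and> x \<in> fst c \<and> (snd c x, p c, A c) \<in> Q}
      | c Q. c \<in> \<A> \<and> open Q}"
    have top: "topspace ?T \<subseteq> jet_bundle \<A>" unfolding jet_topology_def by auto
    show "openin ?T (?\<pi> -` U \<inter> topspace ?T)" if US: "U \<in> ?\<S>" for U
    proof -
      obtain c Q where c: "c \<in> \<A>" and Q: "open Q"
        and U: "U = {(x, p, A). (x, p, A) \<in> red_jet_bundle \<A> \<and> x \<in> fst c \<and> (snd c x, p c, A c) \<in> Q}"
        using US by blast
      let ?Q = "(\<lambda>(y, r, p, A). (y, p, A)) -` Q :: ('e \<times> real \<times> ('e \<Rightarrow>\<^sub>L real) \<times> ('e \<Rightarrow>\<^sub>L 'e \<Rightarrow>\<^sub>L real)) set"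
      have Q': "open ?Q"
        using Q unfolding case_prod_unfold by (rule open_vimage) (intro continuous_intros)
      let ?U = "{(x, r, p, A). (x, r, p, A) \<in> jet_bundle \<A> \<and> x \<in> fst c \<and> (snd c x, r, p c, A c) \<in> ?Q}"
      have "openin ?T ?U" unfolding jet_topology_def
        by (rule topology_generated_by_Basis) (use c Q' in blast)
      moreover have "?\<pi> -` U \<inter> topspace ?T = ?U"
        using top openin_subset[OF \<open>openin ?T ?U\<close>]
        unfolding U by (auto simp: red_jet_bundle_def jet_bundle_def)
      ultimately show ?thesis by simp
    qed
    show "?\<pi> ` topspace ?T \<subseteq> \<Union>?\<S>"
    proof (rule image_subsetI)
      fix z assume z: "z \<in> topspace ?T"
      obtain y r p A where zz: "z = (y, r, p, A)" by (cases z) auto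
      obtain c where c: "c \<in> charts_at \<A> y" using charts_at_exists by blast
      have "?\<pi> z \<in> {(x, p, A). (x, p, A) \<in> red_jet_bundle \<A> \<and> x \<in> fst c \<and> (snd c x, p c, A c) \<in> UNIV}"
        using z top charts_atD[OF c] unfolding zz by (auto simp: red_jet_bundle_def jet_bundle_def)
      then show "?\<pi> z \<in> \<Union>?\<S>"
        by (rule UnionI[rotated]) (rule CollectI, rule exI[of _ c], rule exI[of _ UNIV], intro conjI refl charts_atD(1)[OF c] open_UNIV)
    qed
  qed
  have "openin (jet_topology \<A>) {J \<in> topspace (jet_topology \<A>). (\<lambda>(x, r, p, A). (x, p, A)) J \<in> N}"
    by (rule openin_continuous_map_preimage[OF cont N(1)])
  moreover have "jet2 \<A> g x f \<in> topspace (jet_topology \<A>)"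
    using jets_in_bundle(3)[OF W f] topspace_jet_topology by simp
  then have "jet2 \<A> g x f \<in> {J \<in> topspace (jet_topology \<A>). (\<lambda>(x, r, p, A). (x, p, A)) J \<in> N}"
    using N(2) by (simp add: jet2_def red_jet2_def)
  ultimately obtain V \<delta> where V: "open V" "x \<in> V" "V \<subseteq> W" "\<delta> > 0"
    "\<And>y e s. y \<in> V \<Longrightarrow> \<bar>e\<bar> < \<delta> \<Longrightarrow> \<bar>s\<bar> < \<delta> \<Longrightarrow>
        jet2 \<A> g y (\<lambda>z. f z + e * \<psi> z + s) \<in> {J \<in> topspace (jet_topology \<A>). (\<lambda>(x, r, p, A). (x, p, A)) J \<in> N}"
    using jet2_perturbed_nbhd[OF W f \<psi>] by blast
  show thesis
    by (rule that[OF V(1-4)]) (use V(4) V(5)[of _ _ 0] in \<open>auto simp: jet2_def red_jet2_def\<close>)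
qed

text \<open>If \<open>\<phi>\<close> touches \<open>f\<close> from above at \<open>x\<close>, then
  \<open>\<phi> - f\<close> has a local minimum there: the differentials agree and the Hessians
  differ by a nonnegative form, which condition (P) absorbs.\<close>

lemma C2_subharmonic:
  assumes V: "open V" and f: "Ck_fun_on \<A> 2 V f" and G: "monotone_jets \<A> G"
    and jets: "\<And>y. y \<in> V \<Longrightarrow> jet2 \<A> g y f \<in> G"
  shows "subharmonic_on \<A> g G V (\<lambda>y. ereal (f y))"
  unfolding subharmonic_on_def
proof (intro conjI ballI allI impI)
  have cf: "continuous_on V f" by (rule C2_continuous[OF V f])
  show "usc_on V (\<lambda>y. ereal (f y))" unfolding usc_on_def
  proof (intro conjI ballI allI)
    fix a :: ereal
    have "continuous_on V (\<lambda>y. ereal (f y))" using cf by (intro continuous_intros)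
    from continuous_openin_preimage_gen[OF this open_lessThan, of a]
    show "openin (top_of_set V) {x \<in> V. ereal (f x) < a}" by (simp add: vimage_def Int_def)
  qed simp
  fix x \<phi> W
  assume x: "x \<in> V" and H: "open W \<and> x \<in> W \<and> W \<subseteq> V \<and> Ck_fun_on \<A> 2 W \<phi> \<and>
        (\<forall>y\<in>W. ereal (f y) \<le> ereal (\<phi> y)) \<and> ereal (f x) = ereal (\<phi> x)"
  have W: "open W" "x \<in> W" and \<phi>: "Ck_fun_on \<A> 2 W \<phi>" and fW: "Ck_fun_on \<A> 2 W f"
    using H Ck_fun_on_subset[OF f] by auto
  define h where "h = (\<lambda>y. 1 * \<phi> y + (-1) * f y + 0)"
  have h: "Ck_fun_on \<A> 2 W h" unfolding h_def by (rule Ck_fun_on_affine[OF W(1) \<phi> fW])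
  have dh: "differential \<A> x h c = differential \<A> x \<phi> c - differential \<A> x f c"
    and hh: "hessian \<A> g x h c = hessian \<A> g x \<phi> c - hessian \<A> g x f c" for c
    unfolding h_def jet_affine[OF W \<phi> fW] by simp_all
  have min: "(h \<circ> chart_inv c) (snd c x) \<le> (h \<circ> chart_inv c) z"
    if "c \<in> charts_at \<A> x" "z \<in> snd c ` (W \<inter> fst c)" for c z
    using that H charts_atD[OF that(1)] by (auto simp: h_def)
  have 1: "dirD (h \<circ> chart_inv c) v (snd c x) = 0" "0 \<le> dirD (dirD (h \<circ> chart_inv c) v) v (snd c x)"
    if "c \<in> charts_at \<A> x" for c v
    by (rule local_min_second_derivative[OF loc_C2(1,2,3)[OF W h that]]; rule min[OF that]; assumption)+
  have "differential \<A> x h c = 0" for c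
    by (cases "c \<in> charts_at \<A> x")
       (auto intro!: blinfun_eqI simp: 1 differential_apply[OF W h] differential_outside)
  then have d: "differential \<A> x \<phi> = differential \<A> x f" using dh by (simp add: fun_eq_iff)
  have "hessian \<A> g x h \<in> sym2_nonneg \<A> x"
    unfolding sym2_nonneg_def using jets_in_bundle(2)[OF W h]
    by (auto simp: hessian_apply[OF W h] hess_form_def 1)
  moreover have "(x, f x, differential \<A> x f, hessian \<A> g x f) \<in> G"
    using jets[OF x] by (simp add: jet2_def)
  ultimately have "(x, f x, differential \<A> x f, (\<lambda>c. hessian \<A> g x f c + hessian \<A> g x h c)) \<in> G"
    using G unfolding monotone_jets_def by blast
  then show "jet2 \<A> g x \<phi> \<in> G"
    using H by (simp add: jet2_def d hh)
qed

end

section \<open>Semicontinuous regularization and the dual subequation\<close>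

lemma usc_on_iff:
  "usc_on S u \<longleftrightarrow> (\<forall>x\<in>S. u x < \<infinity> \<and> (\<forall>a>u x. \<exists>V. open V \<and> x \<in> V \<and> (\<forall>y\<in>V \<inter> S. u y < a)))"
  (is "_ \<longleftrightarrow> ?R")
proof
  assume L: "usc_on S u"
  show ?R
  proof (intro ballI conjI allI impI)
    fix x assume x: "x \<in> S"
    show "u x < \<infinity>" using L x unfolding usc_on_def by blast
    fix a assume a: "u x < a"
    have "openin (top_of_set S) {x \<in> S. u x < a}" using L unfolding usc_on_def by blast
    then obtain V where V: "open V" "{x \<in> S. u x < a} = S \<inter> V" unfolding openin_open by blast
    have "x \<in> S \<inter> V" unfolding V(2)[symmetric] using x a by simp
    moreover have "u y < a" if "y \<in> V \<inter> S" for y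
    proof -
      have "y \<in> S \<inter> V" using that by blast
      then show ?thesis unfolding V(2)[symmetric] by simp
    qed
    ultimately show "\<exists>V. open V \<and> x \<in> V \<and> (\<forall>y\<in>V \<inter> S. u y < a)" using V(1) by blast
  qed
next
  assume R: ?R
  show "usc_on S u" unfolding usc_on_def
  proof (intro conjI ballI allI)
    fix x assume "x \<in> S" then show "u x < \<infinity>" using R by blast
  next
    fix a
    define W where "W = \<Union>{V. open V \<and> (\<forall>y\<in>V \<inter> S. u y < a)}"
    have "open W" unfolding W_def by blast
    moreover have "{x \<in> S. u x < a} = S \<inter> W"
    proof (intro set_eqI iffI)
      fix x assume "x \<in> {x \<in> S. u x < a}"
      then have x: "x \<in> S" "u x < a" by auto
      obtain V where "open V" "x \<in> V" "\<forall>y\<in>V \<inter> S. u y < a"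
        using R[THEN bspec, OF x(1), THEN conjunct2, rule_format, OF x(2)] by blast
      then show "x \<in> S \<inter> W" using x unfolding W_def by fast
    next
      fix x assume "x \<in> S \<inter> W"
      then show "x \<in> {x \<in> S. u x < a}" unfolding W_def by fast
    qed
    ultimately show "openin (top_of_set S) {x \<in> S. u x < a}" by (simp only: openin_open_Int)
  qed
qed

lemma usc_onD: "usc_on S u \<Longrightarrow> x \<in> S \<Longrightarrow> u x < \<infinity>"
  and usc_on_nbhd: "usc_on S u \<Longrightarrow> x \<in> S \<Longrightarrow> u x < a \<Longrightarrow> \<exists>V. open V \<and> x \<in> V \<and> (\<forall>y\<in>V \<inter> S. u y < a)"
  by (simp_all add: usc_on_iff)

lemma usc_on_subset: "usc_on S u \<Longrightarrow> T \<subseteq> S \<Longrightarrow> usc_on T u"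
  unfolding usc_on_iff
proof (intro ballI conjI allI impI)
  fix x a
  assume A: "\<forall>x\<in>S. u x < \<infinity> \<and> (\<forall>a>u x. \<exists>V. open V \<and> x \<in> V \<and> (\<forall>y\<in>V \<inter> S. u y < a))" "T \<subseteq> S" "x \<in> T"
  then have x: "x \<in> S" by fast
  show "u x < \<infinity>" using A(1)[THEN bspec, OF x] by simp
  assume a: "u x < a"
  obtain V where "open V" "x \<in> V" "\<forall>y\<in>V \<inter> S. u y < a"
    using A(1)[THEN bspec, OF x, THEN conjunct2, rule_format, OF a] by blast
  then show "\<exists>V. open V \<and> x \<in> V \<and> (\<forall>y\<in>V \<inter> T. u y < a)" using A(2) by fast
qed

text \<open>Otherwise open sets on which \<open>u\<close> stays below some value of \<open>u\<close>
  cover \<open>K\<close>. In a finite subcover the largest of these values is taken at a point of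
  some covering set, hence lies below another one of them.\<close>

lemma usc_attains_max:
  assumes "compact K" "K \<noteq> {}" "usc_on K u"
  shows "\<exists>x\<in>K. \<forall>y\<in>K. u y \<le> u x"
proof (rule ccontr)
  assume "\<not> ?thesis"
  then have no: "\<And>x. x \<in> K \<Longrightarrow> \<exists>y\<in>K. u x < u y" by (auto simp: not_le)
  define \<V> where "\<V> = {V. open V \<and> (\<exists>z\<in>K. \<forall>y\<in>V \<inter> K. u y < u z)}"
  have "K \<subseteq> \<Union>\<V>"
  proof
    fix x assume x: "x \<in> K"
    obtain z where z: "z \<in> K" "u x < u z" using no x by blast
    then obtain V where "open V" "x \<in> V" "\<forall>y\<in>V \<inter> K. u y < u z" using usc_on_nbhd[OF assms(3) x] by blast
    then show "x \<in> \<Union>\<V>" using z(1) unfolding \<V>_def by blast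
  qed
  moreover have "\<forall>V\<in>\<V>. open V" by (simp add: \<V>_def)
  ultimately obtain \<F> where F: "\<F> \<subseteq> \<V>" "finite \<F>" "K \<subseteq> \<Union>\<F>"
    using compactE[OF assms(1), of \<V>] by metis
  have "\<forall>V\<in>\<F>. \<exists>z\<in>K. \<forall>y\<in>V \<inter> K. u y < u z" using F(1) by (auto simp: \<V>_def)
  then obtain z where z: "\<And>V. V \<in> \<F> \<Longrightarrow> z V \<in> K" "\<And>V y. V \<in> \<F> \<Longrightarrow> y \<in> V \<inter> K \<Longrightarrow> u y < u (z V)"
    by metis
  have ne: "\<F> \<noteq> {}" using F(3) assms(2) by blast
  have fin: "finite ((\<lambda>V. u (z V)) ` \<F>)" using F(2) by simp
  have "Max ((\<lambda>V. u (z V)) ` \<F>) \<in> (\<lambda>V. u (z V)) ` \<F>" using fin ne by (intro Max_in) auto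
  then obtain V where V: "V \<in> \<F>" "Max ((\<lambda>V. u (z V)) ` \<F>) = u (z V)" by blast
  obtain V' where V': "V' \<in> \<F>" "z V \<in> V'" using F(3) z(1)[OF V(1)] by blast
  have "u (z V) < u (z V')" using z(2)[OF V'(1)] V'(2) z(1)[OF V(1)] by blast
  moreover have "u (z V') \<le> u (z V)" using Max_ge[OF fin, of "u (z V')"] V V'(1) by auto
  ultimately show False by simp
qed

lemma usc_on_ereal: "continuous_on S f \<Longrightarrow> usc_on S (\<lambda>x. ereal (f x))"
proof -
  assume f: "continuous_on S f"
  have "continuous_on S (\<lambda>y. ereal (f y))" using f by (intro continuous_intros)
  from continuous_openin_preimage_gen[OF this open_lessThan]
  have "openin (top_of_set S) {x \<in> S. ereal (f x) < a}" for a by (simp add: vimage_def Int_def)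
  then show ?thesis unfolding usc_on_def by simp
qed

lemma usc_on_add_continuous:
  fixes f :: "'m::topological_space \<Rightarrow> real"
  assumes u: "usc_on S u" and f: "continuous_on S f"
  shows "usc_on S (\<lambda>x. u x + ereal (f x))"
  unfolding usc_on_iff
proof (intro ballI conjI allI impI)
  fix x assume x: "x \<in> S"
  show "u x + ereal (f x) < \<infinity>" using usc_onD[OF u x] by simp
  fix a assume a: "u x + ereal (f x) < a"
  then have "u x < a - ereal (f x)" by (simp add: ereal_less_minus)
  \<comment> \<open>A real number strictly in between splits the inequality into one for
    \<open>u\<close> and one for \<open>f\<close>, keeping infinite values out of the
    subtraction.\<close>
  then obtain b where b: "u x < ereal b" "ereal b < a - ereal (f x)" using ereal_dense2 by blast
  obtain V1 where V1: "open V1" "x \<in> V1" "\<forall>y\<in>V1 \<inter> S. u y < ereal b"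
    using usc_on_nbhd[OF u x b(1)] by blast
  have "ereal (f x) < a - ereal b" using b(2) by (cases a) auto
  then obtain V2 where V2: "open V2" "x \<in> V2" "\<forall>y\<in>V2 \<inter> S. ereal (f y) < a - ereal b"
    using usc_on_nbhd[OF usc_on_ereal[OF f] x] by blast
  have "u y + ereal (f y) < a" if "y \<in> V1 \<inter> V2 \<inter> S" for y
  proof -
    have "u y < ereal b" "ereal (f y) < a - ereal b" using that V1 V2 by auto
    then show ?thesis by (cases a; cases "u y") auto
  qed
  then show "\<exists>V. open V \<and> x \<in> V \<and> (\<forall>y\<in>V \<inter> S. u y + ereal (f y) < a)"
    using V1 V2 by (intro exI[of _ "V1 \<inter> V2"]) auto
qed

text \<open>The regularization relative to \<open>S\<close>: with \<open>S = closure U\<close>, its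
  values at boundary points take into account all values on the closure nearby, from inside and
  along the boundary.\<close>

definition usc_reg :: "'m::topological_space set \<Rightarrow> ('m \<Rightarrow> ereal) \<Rightarrow> 'm \<Rightarrow> ereal" where
  "usc_reg S P x = (INF V\<in>{V. open V \<and> x \<in> V}. SUP y\<in>V \<inter> S. P y)"

lemma usc_reg_ge: "x \<in> S \<Longrightarrow> P x \<le> usc_reg S P x"
  unfolding usc_reg_def by (auto intro!: INF_greatest SUP_upper)

lemma usc_reg_le_nbhd:
  assumes "open V" "x \<in> V" "\<And>y. y \<in> V \<inter> S \<Longrightarrow> P y \<le> b"
  shows "usc_reg S P x \<le> b"
proof -
  have "usc_reg S P x \<le> (SUP y\<in>V \<inter> S. P y)" unfolding usc_reg_def by (rule INF_lower) (use assms in auto)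
  also have "\<dots> \<le> b" by (rule SUP_least) (rule assms(3))
  finally show ?thesis .
qed

lemma usc_reg_usc:
  assumes "\<And>x. x \<in> S \<Longrightarrow> usc_reg S P x < \<infinity>"
  shows "usc_on S (usc_reg S P)"
  unfolding usc_on_iff
proof (intro ballI conjI allI impI)
  fix x assume "x \<in> S" then show "usc_reg S P x < \<infinity>" by (rule assms)
  fix a assume "usc_reg S P x < a"
  then obtain V where V: "open V" "x \<in> V" "(SUP y\<in>V \<inter> S. P y) < a"
    unfolding usc_reg_def INF_less_iff by blast
  have "usc_reg S P y < a" if "y \<in> V \<inter> S" for y
    by (rule le_less_trans[OF usc_reg_le_nbhd[OF V(1)] V(3)]) (use that in \<open>auto intro: SUP_upper\<close>)
  then show "\<exists>V. open V \<and> x \<in> V \<and> (\<forall>y\<in>V \<inter> S. usc_reg S P y < a)" using V by blast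
qed

lemma less_usc_regD:
  assumes "a < usc_reg S P x" "open V" "x \<in> V"
  shows "\<exists>y\<in>V \<inter> S. a < P y"
proof -
  have "a < (SUP y\<in>V \<inter> S. P y)"
    by (rule less_le_trans[OF assms(1)[unfolded usc_reg_def] INF_lower]) (use assms in simp)
  then show ?thesis unfolding less_SUP_iff .
qed

section \<open>Local properties of subharmonic functions\<close>

lemma subharmonic_on_usc: "subharmonic_on \<A> g F V u \<Longrightarrow> usc_on V u"
  unfolding subharmonic_on_def by blast

lemma subharmonic_onD:
  assumes "subharmonic_on \<A> g F V u" "x \<in> W" "open W" "W \<subseteq> V" "Ck_fun_on \<A> 2 W \<phi>"
    "\<And>y. y \<in> W \<Longrightarrow> u y \<le> ereal (\<phi> y)" "u x = ereal (\<phi> x)"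
  shows "jet2 \<A> g x \<phi> \<in> F"
  using assms unfolding subharmonic_on_def by blast

text \<open>A test function above \<open>u\<close> that touches it at \<open>x\<close> also touches
  every smaller \<open>f\<close> with \<open>f x = u x\<close>. Maxima and glued functions thus need
  only one subharmonic piece per point; where \<open>u\<close> is \<open>-\<infinity>\<close>
  nothing touches.\<close>

lemma subharmonic_pieces:
  assumes usc: "usc_on V u"
    and pieces: "\<And>x. x \<in> V \<Longrightarrow> u x \<noteq> -\<infinity> \<Longrightarrow> \<exists>W f. open W \<and> x \<in> W \<and> W \<subseteq> V \<and>
      subharmonic_on \<A> g F W f \<and> (\<forall>y\<in>W. f y \<le> u y) \<and> f x = u x"
  shows "subharmonic_on \<A> g F V u"
  unfolding subharmonic_on_def
proof (intro conjI ballI allI impI)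
  fix x \<phi> W
  assume x: "x \<in> V" and H: "open W \<and> x \<in> W \<and> W \<subseteq> V \<and> Ck_fun_on \<A> 2 W \<phi> \<and>
        (\<forall>y\<in>W. u y \<le> ereal (\<phi> y)) \<and> u x = ereal (\<phi> x)"
  obtain W' f where f: "open W'" "x \<in> W'" "W' \<subseteq> V" "subharmonic_on \<A> g F W' f" "\<forall>y\<in>W'. f y \<le> u y" "f x = u x"
    using pieces[OF x] H by auto
  show "jet2 \<A> g x \<phi> \<in> F"
  proof (rule subharmonic_onD[OF f(4), of x "W \<inter> W'"])
    show "Ck_fun_on \<A> 2 (W \<inter> W') \<phi>" using H Ck_fun_on_subset by blast
    show "f y \<le> ereal (\<phi> y)" if "y \<in> W \<inter> W'" for y using that f(5) H order_trans by blast
  qed (use f H in auto)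
qed (rule usc)

lemma subharmonic_on_subset:
  assumes "subharmonic_on \<A> g F V u" "W \<subseteq> V"
  shows "subharmonic_on \<A> g F W u"
  unfolding subharmonic_on_def
proof (intro conjI ballI allI impI)
  show "usc_on W u" by (rule usc_on_subset[OF subharmonic_on_usc]) (use assms in auto)
  fix x \<phi> W'
  assume "x \<in> W" and H: "open W' \<and> x \<in> W' \<and> W' \<subseteq> W \<and> Ck_fun_on \<A> 2 W' \<phi> \<and>
        (\<forall>y\<in>W'. u y \<le> ereal (\<phi> y)) \<and> u x = ereal (\<phi> x)"
  then show "jet2 \<A> g x \<phi> \<in> F"
    by (intro subharmonic_onD[OF assms(1), of x W']) (use assms(2) in auto)
qed

lemma neg_jet_neg_jet [simp]: "neg_jet (neg_jet J) = J"
  unfolding neg_jet_def by (cases J) auto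

context riemannian
begin

lemma jet2_affine:
  assumes "open W" "x \<in> W" "Ck_fun_on \<A> 2 W f" "Ck_fun_on \<A> 2 W \<psi>"
  shows "jet2 \<A> g x (\<lambda>y. a * f y + e * \<psi> y + s) = (x, a * f x + e * \<psi> x + s,
      (\<lambda>c. a *\<^sub>R differential \<A> x f c + e *\<^sub>R differential \<A> x \<psi> c),
      (\<lambda>c. a *\<^sub>R hessian \<A> g x f c + e *\<^sub>R hessian \<A> g x \<psi> c))"
  by (simp add: jet2_def jet_affine[OF assms] fun_eq_iff)

text \<open>A test function for the shifted \<open>u\<close> is raised back by \<open>- s\<close>;
  condition (N) then lowers the value of its jet. The summand \<open>0 * \<phi> y\<close> merely
  fits the form of the affine jet formula.\<close>

lemma subharmonic_shift:
  assumes u: "subharmonic_on \<A> g G V u" and G: "monotone_jets \<A> G" and s: "s \<le> 0"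
  shows "subharmonic_on \<A> g G V (\<lambda>x. u x + ereal s)"
  unfolding subharmonic_on_def
proof (intro conjI ballI allI impI)
  show "usc_on V (\<lambda>x. u x + ereal s)"
    by (rule usc_on_add_continuous[OF subharmonic_on_usc[OF u]]) simp
  fix x \<phi> W
  assume x: "x \<in> V" and H: "open W \<and> x \<in> W \<and> W \<subseteq> V \<and> Ck_fun_on \<A> 2 W \<phi> \<and>
        (\<forall>y\<in>W. u y + ereal s \<le> ereal (\<phi> y)) \<and> u x + ereal s = ereal (\<phi> x)"
  have W: "open W" "x \<in> W" and \<phi>: "Ck_fun_on \<A> 2 W \<phi>" using H by auto
  let ?p = "\<lambda>y. 1 * \<phi> y + 0 * \<phi> y + (- s)"
  have "jet2 \<A> g x ?p \<in> G"
  proof (rule subharmonic_onD[OF u W(2,1)])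
    show "Ck_fun_on \<A> 2 W ?p" by (rule Ck_fun_on_affine[OF W(1) \<phi> \<phi>])
    show "u y \<le> ereal (?p y)" if "y \<in> W" for y
    proof -
      have "u y + ereal s \<le> ereal (\<phi> y)" using H that by blast
      then show ?thesis by (cases "u y") auto
    qed
    show "u x = ereal (?p x)" using H by (cases "u x") auto
  qed (use H in auto)
  then have "(x, \<phi> x - s, differential \<A> x \<phi>, hessian \<A> g x \<phi>) \<in> G"
    unfolding jet2_affine[OF W \<phi> \<phi>] by simp
  then have "(x, \<phi> x - s + s, differential \<A> x \<phi>, hessian \<A> g x \<phi>) \<in> G"
    using G s unfolding monotone_jets_def by blast
  then show "jet2 \<A> g x \<phi> \<in> G" by (simp add: jet2_def)
qed

text \<open>Small closed chart balls are images of Euclidean ones under the continuous inverse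
  chart, hence compact, and then closed in the whole Hausdorff manifold, as gluing requires.\<close>

lemma chart_ball:
  assumes c: "c \<in> charts_at \<A> x" and W: "open W" "x \<in> W"
  obtains r where "r > 0" "{y \<in> fst c. dist (snd c y) (snd c x) \<le> r} \<subseteq> W"
    "\<And>s. s \<le> r \<Longrightarrow> compact {y \<in> fst c. dist (snd c y) (snd c x) \<le> s}"
proof -
  have cA: "c \<in> \<A>" "x \<in> fst c" using charts_atD[OF c] by auto
  have "open (snd c ` (W \<inter> fst c))" "snd c x \<in> snd c ` (W \<inter> fst c)"
    using open_chart_image[OF cA(1) W(1)] W cA by auto
  then obtain r where r: "r > 0" "cball (snd c x) r \<subseteq> snd c ` (W \<inter> fst c)"
    using open_contains_cball by blast
  show thesis
  proof (rule that[OF r(1)])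
    show "{y \<in> fst c. dist (snd c y) (snd c x) \<le> r} \<subseteq> W"
    proof safe
      fix y assume y: "y \<in> fst c" "dist (snd c y) (snd c x) \<le> r"
      then have "snd c y \<in> snd c ` (W \<inter> fst c)" using r(2) by (auto simp: dist_commute)
      then obtain z where "z \<in> W" "z \<in> fst c" "snd c y = snd c z" by blast
      then show "y \<in> W" using chart_inj[OF cA(1) y(1)] by blast
    qed
    fix s assume s: "s \<le> r"
    have sub: "cball (snd c x) s \<subseteq> snd c ` fst c" using r(2) s subset_cball[OF s] by blast
    have eq: "{y \<in> fst c. dist (snd c y) (snd c x) \<le> s} = chart_inv c ` cball (snd c x) s"
    proof (intro set_eqI iffI)
      fix y assume "y \<in> {y \<in> fst c. dist (snd c y) (snd c x) \<le> s}"
      then have "y = chart_inv c (snd c y)" "snd c y \<in> cball (snd c x) s" using cA by (auto simp: dist_commute)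
      then show "y \<in> chart_inv c ` cball (snd c x) s" by blast
    next
      fix y assume "y \<in> chart_inv c ` cball (snd c x) s"
      then obtain z where z: "z \<in> cball (snd c x) s" "y = chart_inv c z" by blast
      have "z \<in> snd c ` fst c" using z sub by blast
      then have "y \<in> fst c" "snd c y = z" using z(2) cA(1) chart_inv_in by auto
      then show "y \<in> {y \<in> fst c. dist (snd c y) (snd c x) \<le> s}" using z(1) by (simp add: dist_commute)
    qed
    show "compact {y \<in> fst c. dist (snd c y) (snd c x) \<le> s}"
      unfolding eq
      by (rule compact_continuous_image[OF continuous_on_subset[OF chart_inv_continuous[OF cA(1)] sub]]) simp
  qed
qed

lemma open_chart_ball:
  assumes c: "c \<in> \<A>"
  shows "open {y \<in> fst c. dist (snd c y) p < s}"
proof -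
  have "open (fst c \<inter> (\<lambda>y. dist (snd c y) p) -` {..<s})"
    by (rule continuous_open_preimage) (use c in \<open>auto intro!: continuous_intros chart_continuous\<close>)
  then show ?thesis by (simp add: vimage_def Int_def)
qed

text \<open>If the jet of \<open>\<phi>\<close> lay outside the closed set \<open>F\<close>, so
  would the nearby jets of \<open>\<phi> + e q + m\<close> for small \<open>e\<close> and
  \<open>m\<close>. A member \<open>w\<close> that almost attains the supremum near
  \<open>x0\<close> is touched from above by such a function at an inner point of a small ball, a
  contradiction.\<close>

lemma usc_reg_Sup_subharmonic:
  assumes F: "closedin (jet_topology \<A>) F"
    and U: "open U" "U \<subseteq> S"
    and fam: "\<And>w. w \<in> \<F> \<Longrightarrow> subharmonic_on \<A> g F U w"
    and fin: "\<And>x. x \<in> S \<Longrightarrow> usc_reg S (\<lambda>y. SUP w\<in>\<F>. w y) x < \<infinity>"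
  shows "subharmonic_on \<A> g F U (usc_reg S (\<lambda>y. SUP w\<in>\<F>. w y))"
  unfolding subharmonic_on_def
proof (intro conjI ballI allI impI)
  define P where "P = (\<lambda>y. SUP w\<in>\<F>. w y)"
  show "usc_on U (usc_reg S (\<lambda>y. SUP w\<in>\<F>. w y))"
    by (rule usc_on_subset[OF usc_reg_usc[OF fin] U(2)])
  fix x0 \<phi> W
  assume x0: "x0 \<in> U" and H: "open W \<and> x0 \<in> W \<and> W \<subseteq> U \<and> Ck_fun_on \<A> 2 W \<phi> \<and>
        (\<forall>y\<in>W. usc_reg S (\<lambda>y. SUP w\<in>\<F>. w y) y \<le> ereal (\<phi> y)) \<and> usc_reg S (\<lambda>y. SUP w\<in>\<F>. w y) x0 = ereal (\<phi> x0)"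
  show "jet2 \<A> g x0 \<phi> \<in> F"
  proof (rule ccontr)
    assume notF: "jet2 \<A> g x0 \<phi> \<notin> F"
    obtain c where c: "c \<in> charts_at \<A> x0" using charts_at_exists by blast
    have cA: "c \<in> \<A>" "x0 \<in> fst c" using charts_atD[OF c] by auto
    define q where "q = (\<lambda>y. (dist (snd c y) (snd c x0))\<^sup>2)"
    have W': "open (W \<inter> fst c)" "x0 \<in> W \<inter> fst c" using H cA by auto
    have \<phi>: "Ck_fun_on \<A> 2 (W \<inter> fst c) \<phi>" using H Ck_fun_on_subset by blast
    have q: "Ck_fun_on \<A> 2 (W \<inter> fst c) q"
      unfolding q_def by (rule Ck_fun_on_subset[OF Ck_fun_on_sq_dist[OF cA(1)]]) blast
    have "openin (jet_topology \<A>) (topspace (jet_topology \<A>) - F)" using F by blast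
    moreover have "jet2 \<A> g x0 \<phi> \<in> topspace (jet_topology \<A>) - F"
      using notF jets_in_bundle(3)[OF W' \<phi>] topspace_jet_topology by blast
    ultimately obtain V \<delta> where V: "open V" "x0 \<in> V" "V \<subseteq> W \<inter> fst c" "\<delta> > 0"
      and VJ: "\<And>y e s. y \<in> V \<Longrightarrow> \<bar>e\<bar> < \<delta> \<Longrightarrow> \<bar>s\<bar> < \<delta> \<Longrightarrow>
        jet2 \<A> g y (\<lambda>z. \<phi> z + e * q z + s) \<in> topspace (jet_topology \<A>) - F"
      using jet2_perturbed_nbhd[OF W' \<phi> q] by blast
    obtain r where r: "r > 0" "{y \<in> fst c. dist (snd c y) (snd c x0) \<le> r} \<subseteq> V"
      and rc: "\<And>s. s \<le> r \<Longrightarrow> compact {y \<in> fst c. dist (snd c y) (snd c x0) \<le> s}"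
      using chart_ball[OF c V(1,2)] by blast
    define D where "D = {y \<in> fst c. dist (snd c y) (snd c x0) \<le> r}"
    define B where "B = {y \<in> fst c. dist (snd c y) (snd c x0) < r}"
    have B: "open B" "x0 \<in> B" "B \<subseteq> D" "D \<subseteq> V" "V \<subseteq> W"
      unfolding B_def D_def using open_chart_ball[OF cA(1)] cA(2) r V(3) by auto
    define e where "e = \<delta> / 2"
    \<comment> \<open>\<open>s0\<close> bounds the depth of the constant \<open>m\<close> below: at
      most \<open>\<delta> / 2\<close> to keep the perturbed jet outside \<open>F\<close>, and below
      \<open>e * r\<^sup>2\<close> to keep the touching point off the rim.\<close>
    define s0 where "s0 = min (\<delta> / 2) (e * r\<^sup>2 / 2)"
    have e: "0 < e" "e < \<delta>" using V(4) by (auto simp: e_def)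
    have s0: "0 < s0" "s0 < \<delta>" "s0 < e * r\<^sup>2" using e r(1) V(4) by (auto simp: s0_def min_def)
    define \<psi> where "\<psi> = (\<lambda>y. 1 * \<phi> y + e * q y + 0)"
    have \<psi>2: "Ck_fun_on \<A> 2 (W \<inter> fst c) \<psi>" unfolding \<psi>_def by (rule Ck_fun_on_affine[OF W'(1) \<phi> q])
    have \<psi>c: "continuous_on V \<psi>" by (rule continuous_on_subset[OF C2_continuous[OF W'(1) \<psi>2] V(3)])
    have \<psi>x0: "\<psi> x0 = \<phi> x0" by (simp add: \<psi>_def q_def)
    \<comment> \<open>\<open>\<psi>\<close> and \<open>w\<close> each lose at most
      \<open>s0 / 2\<close> against \<open>\<phi> x0\<close> at the chosen point, so the maximum of
      \<open>w - \<psi>\<close> exceeds \<open>- s0\<close>.\<close>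
    define V1 where "V1 = B \<inter> (V \<inter> \<psi> -` {..<\<phi> x0 + s0 / 2})"
    have V1: "open V1" "x0 \<in> V1"
      unfolding V1_def using B V(1,2) s0(1) \<psi>x0 continuous_open_preimage[OF \<psi>c V(1) open_lessThan] by auto
    have "ereal (\<phi> x0 - s0 / 2) < usc_reg S P x0" using H s0(1) by (simp add: P_def)
    then obtain y1 where y1: "y1 \<in> V1 \<inter> S" "ereal (\<phi> x0 - s0 / 2) < P y1"
      using less_usc_regD[OF _ V1] by blast
    then obtain w where w: "w \<in> \<F>" "ereal (\<phi> x0 - s0 / 2) < w y1" unfolding P_def less_SUP_iff by blast
    have wU: "usc_on U w" using subharmonic_on_usc[OF fam[OF w(1)]] .
    have DU: "D \<subseteq> U" using B H by blast
    have D1: "compact D" unfolding D_def by (rule rc) simp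
    have D2: "D \<noteq> {}" using B by blast
    have D3: "usc_on D (\<lambda>y. w y + ereal (- \<psi> y))"
      by (intro usc_on_add_continuous usc_on_subset[OF wU DU] continuous_on_minus continuous_on_subset[OF \<psi>c] B)
    obtain y where y: "y \<in> D" "\<And>z. z \<in> D \<Longrightarrow> w z + ereal (- \<psi> z) \<le> w y + ereal (- \<psi> y)"
      using usc_attains_max[OF D1 D2 D3] by blast
    have "y1 \<in> D" "\<psi> y1 < \<phi> x0 + s0 / 2" using y1 B unfolding V1_def by auto
    then have "ereal (- s0) < w y1 + ereal (- \<psi> y1)" using w(2) by (cases "w y1") auto
    then have gt: "ereal (- s0) < w y + ereal (- \<psi> y)" using y(2)[OF \<open>y1 \<in> D\<close>] by (rule less_le_trans)
    have wle: "w z \<le> ereal (\<phi> z)" if "z \<in> D" for z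
    proof -
      have "z \<in> S" using that DU U by blast
      have "w z \<le> P z" unfolding P_def by (rule SUP_upper[OF w(1)])
      also have "\<dots> \<le> usc_reg S P z" by (rule usc_reg_ge[OF \<open>z \<in> S\<close>])
      also have "\<dots> \<le> ereal (\<phi> z)" using H that B by (auto simp: P_def)
      finally show ?thesis .
    qed
    obtain a where a: "w y = ereal a" using gt wle[OF y(1)] by (cases "w y") auto
    define m where "m = a - \<psi> y"
    have m: "- s0 < m" using gt a by (simp add: m_def)
    have "a \<le> \<phi> y" using wle[OF y(1)] a by simp
    then have m0: "m \<le> - (e * q y)" unfolding m_def \<psi>_def by simp
    have "q y \<ge> 0" by (simp add: q_def)
    then have "m \<le> 0" using m0 e(1) by (smt (verit) mult_nonneg_nonneg)
    have yB: "y \<in> B"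
    proof (rule ccontr)
      assume "y \<notin> B"
      then have "dist (snd c y) (snd c x0) = r" using y(1) unfolding B_def D_def by auto
      then have "m \<le> - (e * r\<^sup>2)" using m0 by (simp add: q_def)
      then show False using m s0(3) by simp
    qed
    have "jet2 \<A> g y (\<lambda>z. 1 * \<phi> z + e * q z + m) \<in> F"
    proof (rule subharmonic_onD[OF fam[OF w(1)] yB B(1)])
      show "B \<subseteq> U" using B DU by blast
      show "Ck_fun_on \<A> 2 B (\<lambda>z. 1 * \<phi> z + e * q z + m)"
        by (rule Ck_fun_on_subset[OF Ck_fun_on_affine[OF W'(1) \<phi> q]]) (use B V(3) in blast)
      show "w z \<le> ereal (1 * \<phi> z + e * q z + m)" if "z \<in> B" for z
      proof -
        have "z \<in> D" using that B by blast
        have "w z + ereal (- \<psi> z) \<le> ereal m" using y(2)[OF \<open>z \<in> D\<close>] a by (simp add: m_def)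
        then show ?thesis by (cases "w z") (auto simp: \<psi>_def)
      qed
      show "w y = ereal (1 * \<phi> y + e * q y + m)" by (simp add: a m_def \<psi>_def)
    qed
    moreover have "\<bar>m\<bar> < \<delta>" using m \<open>m \<le> 0\<close> s0(2) by simp
    ultimately show False using VJ[of y e m] y(1) B e by auto
  qed
qed

lemma sym2_add:
  assumes A: "A \<in> sym2 \<A> x" and B: "B \<in> sym2 \<A> x"
  shows "(\<lambda>c. A c + B c) \<in> sym2 \<A> x"
proof -
  have L: "c \<notin> charts_at \<A> x \<Longrightarrow> C c = 0"
      "c \<in> charts_at \<A> x \<Longrightarrow> C c v w = C c w v"
      "c \<in> charts_at \<A> x \<Longrightarrow> c' \<in> charts_at \<A> x \<Longrightarrow>
        C c v w = C c' (tangent_transition c c' x v) (tangent_transition c c' x w)"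
      if "C \<in> sym2 \<A> x" for C c c' v w
    using that unfolding sym2_def by blast+
  show ?thesis unfolding sym2_def
  proof (intro CollectI conjI allI ballI impI)
    fix c assume "c \<notin> charts_at \<A> x" then show "A c + B c = 0" using L(1)[OF A] L(1)[OF B] by simp
  next
    fix c v w assume c: "c \<in> charts_at \<A> x"
    show "(A c + B c) v w = (A c + B c) w v"
      using L(2)[OF A c, of v w] L(2)[OF B c, of v w] by (simp add: blinfun.bilinear_simps)
    fix c' assume c': "c' \<in> charts_at \<A> x"
    show "(A c + B c) v w = (A c' + B c') (tangent_transition c c' x v) (tangent_transition c c' x w)"
      using L(3)[OF A c c', of v w] L(3)[OF B c c', of v w] by (simp add: blinfun.bilinear_simps)
  qed
qed

lemma sym2_minus:
  assumes A: "A \<in> sym2 \<A> x"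
  shows "(\<lambda>c. - A c) \<in> sym2 \<A> x"
proof -
  have L: "c \<notin> charts_at \<A> x \<Longrightarrow> A c = 0"
      "c \<in> charts_at \<A> x \<Longrightarrow> A c v w = A c w v"
      "c \<in> charts_at \<A> x \<Longrightarrow> c' \<in> charts_at \<A> x \<Longrightarrow>
        A c v w = A c' (tangent_transition c c' x v) (tangent_transition c c' x w)" for c c' v w
    using A unfolding sym2_def by blast+
  show ?thesis unfolding sym2_def
  proof (intro CollectI conjI allI ballI impI)
    fix c assume "c \<notin> charts_at \<A> x" then show "- A c = 0" using L(1) by simp
  next
    fix c v w assume c: "c \<in> charts_at \<A> x"
    show "(- A c) v w = (- A c) w v"
      using L(2)[OF c, of v w] by (simp add: blinfun.bilinear_simps)
    fix c' assume c': "c' \<in> charts_at \<A> x"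
    show "(- A c) v w = (- A c') (tangent_transition c c' x v) (tangent_transition c c' x w)"
      using L(3)[OF c c', of v w] by (simp add: blinfun.bilinear_simps)
  qed
qed

lemma neg_jet_bundle:
  assumes "J \<in> jet_bundle \<A>" shows "neg_jet J \<in> jet_bundle \<A>"
proof -
  obtain x r p A where J: "J = (x, r, p, A)" by (cases J) auto
  have p: "p \<in> covectors \<A> x" and A: "A \<in> sym2 \<A> x" using assms by (auto simp: J jet_bundle_def)
  have L: "c \<notin> charts_at \<A> x \<Longrightarrow> p c = 0"
      "c \<in> charts_at \<A> x \<Longrightarrow> c' \<in> charts_at \<A> x \<Longrightarrow> p c v = p c' (tangent_transition c c' x v)" for c c' v
    using p unfolding covectors_def by blast+
  have "(\<lambda>c. - p c) \<in> covectors \<A> x" unfolding covectors_def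
  proof (intro CollectI conjI allI ballI impI)
    fix c assume "c \<notin> charts_at \<A> x" then show "- p c = 0" using L(1) by simp
  next
    fix c c' v assume c: "c \<in> charts_at \<A> x" "c' \<in> charts_at \<A> x"
    show "(- p c) v = (- p c') (tangent_transition c c' x v)"
      using L(2)[OF c, of v] by (simp add: blinfun.bilinear_simps)
  qed
  then show ?thesis using sym2_minus[OF A] by (simp add: J neg_jet_def jet_bundle_def)
qed

lemma jet2_neg:
  assumes W: "open W" "x \<in> W" and f: "Ck_fun_on \<A> 2 W f"
  shows "jet2 \<A> g x (\<lambda>y. - f y) = neg_jet (jet2 \<A> g x f)"
  using jet2_affine[OF W f f, of "-1" 0 0] by (simp add: jet2_def neg_jet_def)

text \<open>A smooth bump at a point where the dual condition fails would contradict maximality.\<close>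

lemma maximal_dual_subharmonic:
  assumes U: "open U" "U \<subseteq> S"
    and fin: "\<And>x. x \<in> S \<Longrightarrow> usc_reg S (\<lambda>y. - u y) x < \<infinity>"
    and maximal: "\<And>f B L. open B \<Longrightarrow> B \<subseteq> U \<Longrightarrow> closed L \<Longrightarrow> L \<subseteq> B \<Longrightarrow> Ck_fun_on \<A> 2 B f \<Longrightarrow>
      (\<And>y. y \<in> B \<Longrightarrow> jet2 \<A> g y f \<in> F) \<Longrightarrow> (\<And>y. y \<in> B - L \<Longrightarrow> ereal (f y) \<le> u y) \<Longrightarrow>
      (\<And>y. y \<in> B \<Longrightarrow> ereal (f y) \<le> u y)"
  shows "subharmonic_on \<A> g (dual_subequation \<A> F) U (usc_reg S (\<lambda>y. - u y))"
  unfolding subharmonic_on_def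
proof (intro conjI ballI allI impI)
  let ?v = "usc_reg S (\<lambda>y. - u y)"
  show "usc_on U ?v"
    by (rule usc_on_subset[OF usc_reg_usc[OF fin] U(2)])
  fix x0 \<phi> W
  assume x0: "x0 \<in> U" and H: "open W \<and> x0 \<in> W \<and> W \<subseteq> U \<and> Ck_fun_on \<A> 2 W \<phi> \<and>
        (\<forall>y\<in>W. ?v y \<le> ereal (\<phi> y)) \<and> ?v x0 = ereal (\<phi> x0)"
  show "jet2 \<A> g x0 \<phi> \<in> dual_subequation \<A> F"
  proof (rule ccontr)
    assume notin: "jet2 \<A> g x0 \<phi> \<notin> dual_subequation \<A> F"
    obtain c where c: "c \<in> charts_at \<A> x0" using charts_at_exists by blast
    have cA: "c \<in> \<A>" "x0 \<in> fst c" using charts_atD[OF c] by auto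
    define q where "q = (\<lambda>y. (dist (snd c y) (snd c x0))\<^sup>2)"
    have W': "open (W \<inter> fst c)" "x0 \<in> W \<inter> fst c" using H cA by auto
    have \<phi>: "Ck_fun_on \<A> 2 (W \<inter> fst c) \<phi>" using H Ck_fun_on_subset by blast
    have q: "Ck_fun_on \<A> 2 (W \<inter> fst c) q"
      unfolding q_def by (rule Ck_fun_on_subset[OF Ck_fun_on_sq_dist[OF cA(1)]]) blast
    have n\<phi>: "Ck_fun_on \<A> 2 (W \<inter> fst c) (\<lambda>y. - \<phi> y)"
      using Ck_fun_on_affine[OF W'(1) \<phi> \<phi>, of "-1" 0 0] by simp
    let ?I = "jet_topology \<A> interior_of F"
    \<comment> \<open>By the definition of the dual, a jet of the bundle outside it has its negative
      in the interior of \<open>F\<close>.\<close>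
    have "jet2 \<A> g x0 (\<lambda>y. - \<phi> y) \<in> ?I"
    proof (rule ccontr)
      assume "jet2 \<A> g x0 (\<lambda>y. - \<phi> y) \<notin> ?I"
      then have "neg_jet (jet2 \<A> g x0 (\<lambda>y. - \<phi> y)) \<in> dual_subequation \<A> F"
        unfolding dual_subequation_def using jets_in_bundle(3)[OF W' n\<phi>] by blast
      then show False using notin jet2_neg[OF W' \<phi>] by simp
    qed
    then obtain V \<delta> where V: "open V" "x0 \<in> V" "V \<subseteq> W \<inter> fst c" "\<delta> > 0"
      and VJ: "\<And>y e s. y \<in> V \<Longrightarrow> \<bar>e\<bar> < \<delta> \<Longrightarrow> \<bar>s\<bar> < \<delta> \<Longrightarrow>
        jet2 \<A> g y (\<lambda>z. - \<phi> z + e * q z + s) \<in> ?I"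
      using jet2_perturbed_nbhd[OF W' n\<phi> q openin_interior_of] by blast
    obtain r where r: "r > 0" "{y \<in> fst c. dist (snd c y) (snd c x0) \<le> r} \<subseteq> V"
      and rc: "\<And>s. s \<le> r \<Longrightarrow> compact {y \<in> fst c. dist (snd c y) (snd c x0) \<le> s}"
      using chart_ball[OF c V(1,2)] by blast
    define B where "B = {y \<in> fst c. dist (snd c y) (snd c x0) < r}"
    define L where "L = {y \<in> fst c. dist (snd c y) (snd c x0) \<le> r / 2}"
    have B: "open B" "x0 \<in> B" "B \<subseteq> V" unfolding B_def using open_chart_ball[OF cA(1)] cA(2) r by auto
    have L: "closed L" "L \<subseteq> B" using compact_imp_closed[OF rc[of "r/2"]] r(1) by (auto simp: L_def B_def)
    define e where "e = \<delta> / 2"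
    \<comment> \<open>Outside \<open>L\<close> the quadratic loss is at least \<open>s\<close>, so
      \<open>f\<close> is at most \<open>- \<phi>\<close> and hence at most \<open>u\<close> there,
      while at \<open>x0\<close> it exceeds \<open>- \<phi>\<close> by the full
      \<open>s\<close>.\<close>
    define s where "s = min (\<delta> / 2) (e * (r / 2)\<^sup>2)"
    have e: "0 < e" "e < \<delta>" using V(4) by (auto simp: e_def)
    have s: "0 < s" "s < \<delta>" "s \<le> e * (r / 2)\<^sup>2" using e r(1) V(4) by (auto simp: s_def min_def)
    define f where "f = (\<lambda>y. - \<phi> y + (- e) * q y + s)"
    have BW: "B \<subseteq> W \<inter> fst c" "B \<subseteq> U" using B V H by blast+
    have f2: "Ck_fun_on \<A> 2 (W \<inter> fst c) f"
      using Ck_fun_on_affine[OF W'(1) n\<phi> q, of 1 "-e" s] by (simp add: f_def)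
    have ge: "ereal (- \<phi> y) \<le> u y" if "y \<in> B" for y
    proof -
      have "- u y \<le> ?v y" by (rule usc_reg_ge) (use that BW U in blast)
      also have "\<dots> \<le> ereal (\<phi> y)" using H that BW by blast
      finally show ?thesis by (metis ereal_uminus_le_reorder uminus_ereal.simps(1))
    qed
    have fu: "ereal (f y) \<le> u y" if "y \<in> B" for y
    proof (rule maximal[OF B(1) BW(2) L Ck_fun_on_subset[OF f2 BW(1)] _ _ that])
      show "jet2 \<A> g y f \<in> F" if "y \<in> B" for y
        using VJ[of y "-e" s] that B e s interior_of_subset[of "jet_topology \<A>" F] by (auto simp: f_def)
      show "ereal (f y) \<le> u y" if "y \<in> B - L" for y
      proof -
        have "(r/2)\<^sup>2 \<le> q y" using that r(1) unfolding B_def L_def q_def by (intro power_mono) auto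
        then have "e * (r/2)\<^sup>2 \<le> e * q y" using e(1) by simp
        then have "f y \<le> - \<phi> y" using s(3) by (simp add: f_def)
        then show ?thesis using ge[of y] that by (metis DiffD1 ereal_less_eq(3) order_trans)
      qed
    qed
    have cf: "continuous_on B f" by (rule continuous_on_subset[OF C2_continuous[OF W'(1) f2] BW(1)])
    define V2 where "V2 = B \<inter> f -` {- \<phi> x0 + s / 2<..}"
    have V2: "open V2" "x0 \<in> V2"
      unfolding V2_def using continuous_open_preimage[OF cf B(1) open_greaterThan] B(2) s(1) by (auto simp: f_def q_def)
    \<comment> \<open>Near \<open>x0\<close> the bump forces \<open>u\<close> above
      \<open>- \<phi> x0 + s / 2\<close>, so \<open>\<phi>\<close> cannot touch the regularization
      of \<open>- u\<close> at \<open>x0\<close>.\<close>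
    have "?v x0 \<le> ereal (\<phi> x0 - s / 2)"
    proof (rule usc_reg_le_nbhd[OF V2])
      fix y assume y: "y \<in> V2 \<inter> S"
      then have "ereal (- \<phi> x0 + s / 2) \<le> u y" using fu[of y] unfolding V2_def
        by (auto intro: order_trans[of _ "ereal (f y)"])
      then show "- u y \<le> ereal (\<phi> x0 - s / 2)" by (cases "u y") auto
    qed
    then show False using H s(1) by simp
  qed
qed

section \<open>Translations within a fibre and monotonicity of the dual\<close>

lemma fibre_translation_continuous:
  assumes B: "B \<in> sym2 \<A> x"
  defines "T \<equiv> subtopology (jet_topology \<A>) (jet_fibre \<A> x)"
  shows "continuous_map T T (\<lambda>(y, r, p, A). (y, r + s, p, (\<lambda>c. A c + B c)))" (is "continuous_map _ _ ?t")
proof -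
  have top: "topspace T = jet_fibre \<A> x"
    unfolding T_def by (auto simp: topspace_jet_topology jet_fibre_def)
  have maps: "?t J \<in> jet_fibre \<A> x" if J: "J \<in> jet_fibre \<A> x" for J
  proof -
    obtain r p A where J': "J = (x, r, p, A)" using J by (cases J) (auto simp: jet_fibre_def)
    have pA: "p \<in> covectors \<A> x" "A \<in> sym2 \<A> x" using J by (auto simp: J' jet_fibre_def jet_bundle_def)
    have "(\<lambda>c. A c + B c) \<in> sym2 \<A> x" by (rule sym2_add[OF pA(2) B])
    then show ?thesis using pA by (simp add: J' jet_fibre_def jet_bundle_def)
  qed
  have "continuous_map T (jet_topology \<A>) ?t"
    unfolding jet_topology_def
  proof (rule continuous_on_generated_topo)
    let ?\<S> = "{{(x, r, p, A). (x, r, p, A) \<in> jet_bundle \<A> \<and> x \<in> fst c \<and> (snd c x, r, p c, A c) \<in> Q}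
      | c Q. c \<in> \<A> \<and> open Q}"
    show "openin T (?t -` U \<inter> topspace T)" if US: "U \<in> ?\<S>" for U
    proof -
      obtain c Q where c: "c \<in> \<A>" and Q: "open Q"
        and U: "U = {(x, r, p, A). (x, r, p, A) \<in> jet_bundle \<A> \<and> x \<in> fst c \<and> (snd c x, r, p c, A c) \<in> Q}"
        using US by blast
      let ?Q = "(\<lambda>(y, r, p, A). (y, r + s, p, A + B c)) -` Q"
      have Q': "open ?Q"
        using Q unfolding case_prod_unfold by (rule open_vimage) (intro continuous_intros)
      let ?U = "{(x, r, p, A). (x, r, p, A) \<in> jet_bundle \<A> \<and> x \<in> fst c \<and> (snd c x, r, p c, A c) \<in> ?Q}"
      have "openin (jet_topology \<A>) ?U" unfolding jet_topology_def
        by (rule topology_generated_by_Basis) (use c Q' in blast)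
      then have "openin T (?U \<inter> jet_fibre \<A> x)" unfolding T_def by (rule openin_subtopology_Int)
      moreover have "?t -` U \<inter> topspace T = ?U \<inter> jet_fibre \<A> x"
      proof (rule set_eqI)
        fix J :: "('m, 'e) jet"
        obtain y r p A where J': "J = (y, r, p, A)" by (cases J) auto
        show "J \<in> ?t -` U \<inter> topspace T \<longleftrightarrow> J \<in> ?U \<inter> jet_fibre \<A> x"
          using maps[of J] unfolding top U J' by (auto simp: jet_fibre_def)
      qed
      ultimately show ?thesis by simp
    qed
    show "?t ` topspace T \<subseteq> \<Union>?\<S>"
      unfolding topology_generated_by_topspace[symmetric] jet_topology_def[symmetric] topspace_jet_topology top
      using maps by (auto simp: jet_fibre_def)
  qed
  then show ?thesis
    using maps top unfolding T_def by (auto simp: continuous_map_in_subtopology)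
qed

text \<open>A tensor \<open>B\<close> at \<open>x\<close> translates the fibre over \<open>x\<close>
  only, and condition (T) makes the fibre interior agree with the interior of \<open>F\<close>.
  Within the fibre, the translate of an open subset of \<open>F\<close> is open, and stays in
  \<open>F\<close> by (P) and (N).\<close>

lemma interior_monotone:
  assumes F: "subequation \<A> F" and J: "(x, r, p, A) \<in> jet_topology \<A> interior_of F"
    and B: "B \<in> sym2_nonneg \<A> x" and s: "s \<le> 0"
  shows "(x, r + s, p, (\<lambda>c. A c + B c)) \<in> jet_topology \<A> interior_of F"
proof -
  define T where "T = subtopology (jet_topology \<A>) (jet_fibre \<A> x)"
  define Fx where "Fx = F \<inter> jet_fibre \<A> x"
  have int: "T interior_of Fx = (jet_topology \<A> interior_of F) \<inter> jet_fibre \<A> x"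
    using F unfolding subequation_def Let_def T_def Fx_def by blast
  note mono = subequation_monotone[OF F, unfolded monotone_jets_def]
  have top: "topspace T = jet_fibre \<A> x"
    unfolding T_def by (auto simp: topspace_jet_topology jet_fibre_def)
  have nB: "(\<lambda>c. - B c) \<in> sym2 \<A> x"
    using B sym2_minus unfolding sym2_nonneg_def by blast
  \<comment> \<open>The backward translation: its preimage of the interior is the forward translate,
    and openness follows from continuity.\<close>
  let ?t = "\<lambda>(y, r, p, A). (y, r + (- s), p, (\<lambda>c. A c + (- B c)))"
  let ?O = "{z \<in> topspace T. ?t z \<in> T interior_of Fx}"
  have "openin T ?O"
    using openin_continuous_map_preimage[OF fibre_translation_continuous[OF nB, of "- s", folded T_def] openin_interior_of] .
  moreover have "?O \<subseteq> Fx"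
  proof
    fix z assume z: "z \<in> ?O"
    obtain r' p' A' where z': "z = (x, r', p', A')" using z top by (cases z) (auto simp: jet_fibre_def)
    have "?t z \<in> Fx" using z[THEN CollectD, THEN conjunct2] by (rule subsetD[OF interior_of_subset])
    then have "(x, r' + (- s), p', (\<lambda>c. A' c + (- B c))) \<in> F" by (simp add: z' Fx_def)
    then have "(x, r' + (- s) + s, p', (\<lambda>c. A' c + (- B c))) \<in> F" using mono s by blast
    then have "(x, r' + (- s) + s, p', (\<lambda>c. (A' c + (- B c)) + B c)) \<in> F" using mono B by blast
    then show "z \<in> Fx" using z top by (simp add: z' Fx_def)
  qed
  ultimately have sub: "?O \<subseteq> T interior_of Fx" by (rule interior_of_maximal[rotated])
  have JF: "(x, r, p, A) \<in> F" by (rule subsetD[OF interior_of_subset J])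
  then have "(x, r + s, p, A) \<in> F" using mono s by blast
  then have "(x, r + s, p, (\<lambda>c. A c + B c)) \<in> F" using mono B by blast
  then have "(x, r + s, p, (\<lambda>c. A c + B c)) \<in> topspace T"
    using subsetD[OF conjunct1[OF mono]] unfolding top jet_fibre_def by simp
  moreover have "(x, r, p, A) \<in> T interior_of Fx"
    using J subsetD[OF conjunct1[OF mono] JF] unfolding int jet_fibre_def by simp
  ultimately have "(x, r + s, p, (\<lambda>c. A c + B c)) \<in> ?O" by simp
  from subsetD[OF sub this] show ?thesis unfolding int by (rule IntD1)
qed

text \<open>Negation turns an upward move in the dual into a downward move outside the interior of
  \<open>F\<close>, so this is the contrapositive of monotonicity of that interior.\<close>

lemma dual_monotone:
  assumes F: "subequation \<A> F"
  shows "monotone_jets \<A> (dual_subequation \<A> F)"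
proof -
  have mem: "(x, r, p, A) \<in> dual_subequation \<A> F \<longleftrightarrow> (x, r, p, A) \<in> jet_bundle \<A> \<and>
      (x, - r, (\<lambda>c. - p c), (\<lambda>c. - A c)) \<notin> jet_topology \<A> interior_of F" for x r p A
  proof -
    have "J \<in> dual_subequation \<A> F \<longleftrightarrow> neg_jet J \<in> jet_bundle \<A> - jet_topology \<A> interior_of F" for J
    proof
      assume "J \<in> dual_subequation \<A> F"
      then obtain K where "J = neg_jet K" "K \<in> jet_bundle \<A> - jet_topology \<A> interior_of F"
        unfolding dual_subequation_def by blast
      then show "neg_jet J \<in> jet_bundle \<A> - jet_topology \<A> interior_of F" by simp
    next
      assume "neg_jet J \<in> jet_bundle \<A> - jet_topology \<A> interior_of F"
      then have "neg_jet (neg_jet J) \<in> dual_subequation \<A> F" unfolding dual_subequation_def by (rule imageI)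
      then show "J \<in> dual_subequation \<A> F" by simp
    qed
    moreover have "neg_jet J \<in> jet_bundle \<A> \<longleftrightarrow> J \<in> jet_bundle \<A>" for J
      using neg_jet_bundle[of J] neg_jet_bundle[of "neg_jet J"] by auto
    ultimately have "(x, r, p, A) \<in> dual_subequation \<A> F \<longleftrightarrow> (x, r, p, A) \<in> jet_bundle \<A> \<and>
        neg_jet (x, r, p, A) \<notin> jet_topology \<A> interior_of F" by blast
    then show ?thesis by (simp add: neg_jet_def)
  qed
  have zero: "(\<lambda>c. 0) \<in> sym2_nonneg \<A> x" for x unfolding sym2_nonneg_def sym2_def by simp
  show ?thesis unfolding monotone_jets_def
  proof (intro conjI allI impI)
    show "dual_subequation \<A> F \<subseteq> jet_bundle \<A>" unfolding dual_subequation_def using neg_jet_bundle by blast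
  next
    fix x r p A B assume H: "(x, r, p, A) \<in> dual_subequation \<A> F \<and> B \<in> sym2_nonneg \<A> x"
    then have B: "B \<in> sym2 \<A> x" by (simp add: sym2_nonneg_def)
    have "(x, r, p, A) \<in> jet_fibre \<A> x" using H mem by (auto simp: jet_fibre_def)
    then have "(x, r, p, A) \<in> topspace (subtopology (jet_topology \<A>) (jet_fibre \<A> x))"
      by (auto simp: topspace_jet_topology jet_fibre_def)
    from funcset_mem[OF continuous_map_funspace[OF fibre_translation_continuous[OF B, of 0]] this]
    have 1: "(x, r, p, (\<lambda>c. A c + B c)) \<in> jet_bundle \<A>"
      by (auto simp: topspace_jet_topology jet_fibre_def)
    have "(x, - r, (\<lambda>c. - p c), (\<lambda>c. - (A c + B c))) \<notin> jet_topology \<A> interior_of F"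
    proof
      assume "(x, - r, (\<lambda>c. - p c), (\<lambda>c. - (A c + B c))) \<in> jet_topology \<A> interior_of F"
      from interior_monotone[OF F this, of B 0] H
      have "(x, - r, (\<lambda>c. - p c), (\<lambda>c. - A c)) \<in> jet_topology \<A> interior_of F" by simp
      then show False using H mem by blast
    qed
    then show "(x, r, p, (\<lambda>c. A c + B c)) \<in> dual_subequation \<A> F" using 1 mem by blast
  next
    fix x r p A and s :: real assume H: "(x, r, p, A) \<in> dual_subequation \<A> F \<and> s \<le> 0"
    have "(x, - (r + s), (\<lambda>c. - p c), (\<lambda>c. - A c)) \<notin> jet_topology \<A> interior_of F"
    proof
      assume "(x, - (r + s), (\<lambda>c. - p c), (\<lambda>c. - A c)) \<in> jet_topology \<A> interior_of F"
      from interior_monotone[OF F this zero[of x], of s] H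
      have "(x, - r, (\<lambda>c. - p c), (\<lambda>c. - A c)) \<in> jet_topology \<A> interior_of F" by simp
      then show False using H mem by blast
    qed
    moreover have "(x, r + s, p, A) \<in> jet_bundle \<A>" using H mem by (auto simp: jet_bundle_def)
    ultimately show "(x, r + s, p, A) \<in> dual_subequation \<A> F" using mem by blast
  qed
qed

lemma subequation_closed: "subequation \<A> F \<Longrightarrow> closedin (jet_topology \<A>) F"
  unfolding subequation_def by (metis closedin_closure_of)

section \<open>The boundary of a manifold with corners\<close>

text \<open>Follows from maximality of the atlas. It allows a corner chart to be shrunk until a
  single defining coordinate remains.\<close>

lemma restrict_chart:
  assumes c: "c \<in> \<A>" and V: "open V" "V \<subseteq> fst c"
  shows "(V, snd c) \<in> \<A>"
proof -
  have inj: "inj_on (snd c) (fst c)" by (rule inj_onI) (rule chart_inj[OF c])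
  have inv: "chart_inv (V, snd c) y = chart_inv c y" if y: "y \<in> snd c ` V" for y
  proof -
    obtain x where x: "x \<in> V" "y = snd c x" using y by blast
    have "chart_inv (V, snd c) y = x"
      unfolding chart_inv_def x(2) fst_conv snd_conv by (rule inv_into_f_f[OF inj_on_subset[OF inj V(2)] x(1)])
    moreover have "chart_inv c y = x" using x V(2) c by auto
    ultimately show ?thesis by simp
  qed
  have img: "open (snd c ` V)" using open_chart_image[OF c V(1)] V(2) by (simp add: Int_absorb2)
  have hom: "homeomorphism V (snd c ` V) (snd c) (chart_inv (V, snd c))"
  proof (rule homeomorphismI)
    show "continuous_on V (snd c)" by (rule continuous_on_subset[OF chart_continuous[OF c] V(2)])
    have "continuous_on (snd c ` V) (chart_inv c)"
      by (rule continuous_on_subset[OF chart_inv_continuous[OF c]]) (use V(2) in blast)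
    then show "continuous_on (snd c ` V) (chart_inv (V, snd c))"
      by (rule continuous_on_eq) (simp add: inv)
    show "snd c ` V \<subseteq> snd c ` V" by simp
    show "chart_inv (V, snd c) ` snd c ` V \<subseteq> V" using V(2) c inv by auto
    show "chart_inv (V, snd c) (snd c x) = x" if "x \<in> V" for x using that V(2) c inv by auto
    show "snd c (chart_inv (V, snd c) y) = y" if "y \<in> snd c ` V" for y using that V(2) c inv by auto
  qed
  then have 1: "is_chart (V, snd c)" using V img by (simp add: is_chart_def)
  have 2: "compatible_charts (V, snd c) c'" if c': "c' \<in> \<A>" for c'
    unfolding compatible_charts_def fst_conv snd_conv smooth_on_def
  proof (intro conjI allI)
    fix k
    have "open (snd c ` (V \<inter> fst c'))"
    proof -
      have "V \<inter> fst c' \<inter> fst c = V \<inter> fst c'" using V(2) by blast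
      then show ?thesis using open_chart_image[OF c open_Int[OF V(1) open_fst[OF c']]] by simp
    qed
    then show "Ck_on k (snd c ` (V \<inter> fst c')) (snd c' \<circ> chart_inv (V, snd c))"
    proof (rule Ck_on_cong)
      show "Ck_on k (snd c ` (V \<inter> fst c')) (snd c' \<circ> chart_inv c)"
        by (rule Ck_on_subset[OF transition_Ck[OF c c']]) (use V(2) in blast)
      show "(snd c' \<circ> chart_inv c) x = (snd c' \<circ> chart_inv (V, snd c)) x" if "x \<in> snd c ` (V \<inter> fst c')" for x
        using inv[of x] that by auto
    qed
    have "snd c' ` (V \<inter> fst c') \<subseteq> snd c' ` (fst c' \<inter> fst c)" using V(2) by blast
    then show "Ck_on k (snd c' ` (V \<inter> fst c')) (snd c \<circ> chart_inv c')"
      by (rule Ck_on_subset[OF transition_Ck[OF c' c]])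
  qed
  have "\<forall>c. is_chart c \<and> (\<forall>c'\<in>\<A>. compatible_charts c c') \<longrightarrow> c \<in> \<A>"
    using smooth_structure unfolding smooth_structure_def by (elim conjE)
  from this[THEN spec, of "(V, snd c)"] show ?thesis using 1 2 by simp
qed

section \<open>Faces of corner charts and the boundary germs they define\<close>

definition face :: "('m, 'e) chart \<Rightarrow> 'e set \<Rightarrow> 'e \<Rightarrow> 'm set" where
  "face c I i = {z \<in> fst c. snd c z \<bullet> i = 0 \<and> (\<forall>j\<in>I - {i}. 0 < snd c z \<bullet> j)}"

text \<open>In coordinates a convex set, which provides connected pieces of the depth one stratum
  accumulating at \<open>y\<close>.\<close>

definition face_ball :: "('m, 'e) chart \<Rightarrow> 'e set \<Rightarrow> 'e \<Rightarrow> 'm \<Rightarrow> real \<Rightarrow> 'm set" where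
  "face_ball c I i y s = {z \<in> face c I i. dist (snd c z) (snd c y) < s}"

text \<open>The local boundary component at \<^term>\<open>y\<close> that is given by the face \<open>y\<^sub>i = 0\<close> of a corner chart.\<close>

definition face_germ :: "'m set \<Rightarrow> ('m, 'e) chart \<Rightarrow> 'e set \<Rightarrow> 'e \<Rightarrow> 'm \<Rightarrow> 'm set \<Rightarrow> 'm set" where
  "face_germ X c I i y V = (if openin (top_of_set X) V \<and> y \<in> V
     then {z. \<exists>s>0. \<forall>p\<in>face_ball c I i y s. connected_component (V \<inter> depth1_stratum \<A> X) p z} else {})"

context
  fixes X c I x
  assumes cc: "corner_chart \<A> X x I c"
begin

lemma corner_chartD: "c \<in> \<A>" "x \<in> fst c" "I \<subseteq> Basis" "finite I" "\<And>i. i \<in> I \<Longrightarrow> snd c x \<bullet> i = 0"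
  using cc finite_subset[OF _ finite_Basis] charts_atD unfolding corner_chart_def by blast+

lemma in_corner_iff: "z \<in> fst c \<Longrightarrow> z \<in> X \<longleftrightarrow> (\<forall>i\<in>I. 0 \<le> snd c z \<bullet> i)"
proof -
  assume z: "z \<in> fst c"
  have "z \<in> X \<longleftrightarrow> snd c z \<in> snd c ` (X \<inter> fst c)"
    using z chart_inj[OF corner_chartD(1) z] by blast
  also have "\<dots> \<longleftrightarrow> (\<forall>i\<in>I. 0 \<le> snd c z \<bullet> i)"
    using cc z unfolding corner_chart_def by auto
  finally show ?thesis .
qed

text \<open>Restricting \<open>c\<close> to the open set where the other corner coordinates are
  positive gives a corner chart at \<open>z\<close> with the single index \<open>i\<close>.\<close>

lemma face_subset_stratum:
  assumes i: "i \<in> I"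
  shows "face c I i \<subseteq> depth1_stratum \<A> X"
proof
  fix z assume z: "z \<in> face c I i"
  then have z': "z \<in> fst c" "snd c z \<bullet> i = 0" "\<And>j. j \<in> I - {i} \<Longrightarrow> 0 < snd c z \<bullet> j"
    unfolding face_def by auto
  have zX: "z \<in> X" using in_corner_iff[OF z'(1)] z'(2,3) by (metis Diff_iff less_eq_real_def singletonD)
  define V where "V = fst c \<inter> snd c -` (\<Inter>j\<in>I - {i}. {y. 0 < y \<bullet> j})"
  have "open (\<Inter>j\<in>I - {i}. {y::'e. 0 < y \<bullet> j})"
    using corner_chartD(4) by (intro open_INT ballI open_Collect_less continuous_intros) auto
  then have V: "open V" "V \<subseteq> fst c"
    unfolding V_def using continuous_open_preimage[OF chart_continuous open_fst, OF corner_chartD(1,1)] by auto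
  have inV: "w \<in> V \<longleftrightarrow> w \<in> fst c \<and> (\<forall>j\<in>I - {i}. 0 < snd c w \<bullet> j)" for w
    unfolding V_def by auto
  have zV: "z \<in> V" using z' inV by blast
  have "corner_chart \<A> X z {i} (V, snd c)"
    unfolding corner_chart_def fst_conv snd_conv
  proof (intro conjI)
    show "(V, snd c) \<in> charts_at \<A> z"
      unfolding charts_at_def using restrict_chart[OF corner_chartD(1) V] zV by simp
    show "{i} \<subseteq> Basis" using i corner_chartD(3) by blast
    show "\<forall>i\<in>{i}. snd c z \<bullet> i = 0" using z'(2) by simp
    show "snd c ` (X \<inter> V) = {y \<in> snd c ` V. \<forall>i\<in>{i}. 0 \<le> y \<bullet> i}"
    proof (intro set_eqI iffI)
      fix y assume "y \<in> snd c ` (X \<inter> V)"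
      then obtain w where w: "w \<in> X" "w \<in> V" "y = snd c w" by blast
      then show "y \<in> {y \<in> snd c ` V. \<forall>i\<in>{i}. 0 \<le> y \<bullet> i}"
        using in_corner_iff[of w] V(2) i by auto
    next
      fix y assume "y \<in> {y \<in> snd c ` V. \<forall>i\<in>{i}. 0 \<le> y \<bullet> i}"
      then obtain w where w: "w \<in> V" "y = snd c w" "0 \<le> snd c w \<bullet> i" by auto
      then have "\<forall>j\<in>I. 0 \<le> snd c w \<bullet> j" using inV[of w] by (metis Diff_iff less_eq_real_def singletonD)
      then have "w \<in> X" using in_corner_iff[of w] w(1) V(2) by blast
      then show "y \<in> snd c ` (X \<inter> V)" using w by blast
    qed
  qed
  then show "z \<in> depth1_stratum \<A> X"
    unfolding depth1_stratum_def using zX by (intro CollectI conjI exI[of _ "{i}"]) auto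
qed

context
  fixes i y
  assumes i: "i \<in> I" and y: "y \<in> fst c" "y \<in> X" "snd c y \<bullet> i = 0"
begin

text \<open>A short step from \<open>y\<close> along \<open>n\<close>, the sum of the other corner
  directions, keeps coordinate \<open>i\<close> at 0 and makes the remaining ones positive.\<close>

lemma face_ball_nonempty:
  assumes "s > 0" "ball (snd c y) s \<subseteq> snd c ` fst c"
  shows "face_ball c I i y s \<noteq> {}"
proof -
  define n where "n = (\<Sum>j\<in>I - {i}. j)"
  have n: "n \<bullet> j = (if j \<in> I - {i} then 1 else 0)" if "j \<in> Basis" for j
    unfolding n_def using corner_chartD(3,4) that
    by (auto simp: inner_sum_left inner_Basis subset_iff if_distrib sum.delta' cong: if_cong)
  define t where "t = s / (2 * (norm n + 1))"
  have t: "t > 0" unfolding t_def using assms(1) by (simp add: add_nonneg_pos)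
  have "t * norm n < s"
  proof -
    have "t * norm n \<le> t * (norm n + 1)" using t by simp
    also have "\<dots> = s / 2" unfolding t_def using norm_ge_zero[of n]
      by (metis add_nonneg_eq_0_iff divide_divide_eq_left' mult.commute nonzero_eq_divide_eq times_divide_eq_right zero_le_one zero_neq_one)
    also have "\<dots> < s" using assms(1) by simp
    finally show ?thesis .
  qed
  define w where "w = snd c y + t *\<^sub>R n"
  have d: "dist w (snd c y) < s" using \<open>t * norm n < s\<close> t by (simp add: w_def dist_norm)
  then have "w \<in> snd c ` fst c" using assms(2) by (auto simp: dist_commute)
  then obtain z where z: "z \<in> fst c" "w = snd c z" by blast
  have "w \<bullet> i = 0" using y(3) n[of i] i corner_chartD(3) by (auto simp: w_def inner_left_distrib)
  moreover have "0 < w \<bullet> j" if "j \<in> I - {i}" for j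
  proof -
    have "0 \<le> snd c y \<bullet> j" using in_corner_iff[OF y(1)] y(2) that by blast
    then show ?thesis using n[of j] that corner_chartD(3) t by (auto simp: w_def inner_left_distrib)
  qed
  ultimately have "z \<in> face_ball c I i y s" using z d by (simp add: face_ball_def face_def)
  then show ?thesis by blast
qed

text \<open>Its coordinate image is the intersection of a ball, a hyperplane and
  half-spaces.\<close>

lemma face_ball_connected:
  assumes "ball (snd c y) s \<subseteq> snd c ` fst c"
  shows "connected (face_ball c I i y s)"
proof -
  let ?K = "ball (snd c y) s \<inter> ({w. i \<bullet> w = 0} \<inter> (\<Inter>j\<in>I - {i}. {w. j \<bullet> w > 0}))"
  have "convex ?K"
    by (intro convex_Int convex_ball convex_hyperplane convex_INT convex_halfspace_gt)
  then have "connected ?K" by (rule convex_connected)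
  moreover have "continuous_on ?K (chart_inv c)"
    by (rule continuous_on_subset[OF chart_inv_continuous[OF corner_chartD(1)]]) (use assms in blast)
  ultimately have "connected (chart_inv c ` ?K)" by (rule connected_continuous_image[rotated])
  moreover have "chart_inv c ` ?K = face_ball c I i y s"
  proof (intro set_eqI iffI)
    fix z assume "z \<in> chart_inv c ` ?K"
    then obtain w where w: "w \<in> ?K" "z = chart_inv c w" by blast
    have "w \<in> snd c ` fst c" using w(1) assms by blast
    then have "z \<in> fst c" "snd c z = w" using w(2) corner_chartD(1) chart_inv_in by auto
    then show "z \<in> face_ball c I i y s" using w(1) by (auto simp: face_ball_def face_def dist_commute inner_commute)
  next
    fix z assume z: "z \<in> face_ball c I i y s"
    then have "snd c z \<in> ?K" "z = chart_inv c (snd c z)"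
      using corner_chartD(1) by (auto simp: face_ball_def face_def dist_commute inner_commute)
    then show "z \<in> chart_inv c ` ?K" by blast
  qed
  ultimately show ?thesis by simp
qed

lemma face_ball_nbhd:
  assumes "open O'" "y \<in> O'"
  obtains s where "s > 0" "ball (snd c y) s \<subseteq> snd c ` fst c"
    "{z \<in> fst c. dist (snd c z) (snd c y) < s} \<subseteq> O'"
proof -
  have "c \<in> charts_at \<A> y" using y(1) corner_chartD(1) by (simp add: charts_at_def)
  then obtain r where r: "r > 0" "{z \<in> fst c. dist (snd c z) (snd c y) \<le> r} \<subseteq> O'"
    using chart_ball[OF _ assms] by blast
  obtain r' where r': "r' > 0" "ball (snd c y) r' \<subseteq> snd c ` fst c"
    using open_img[OF corner_chartD(1)] y(1) open_contains_ball by blast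
  show thesis
    by (rule that[of "min r r'"]) (use r r' in auto)
qed

lemma face_ball_in_stratum: "face_ball c I i y s \<subseteq> depth1_stratum \<A> X \<inter> X"
  using face_subset_stratum[OF i] by (auto simp: face_ball_def depth1_stratum_def)

text \<open>Face balls at \<open>y\<close> are nested and, when small, nonempty and connected, so
  they all lie in one component. Hence the radius in \<open>face_germ\<close> does not affect the
  component it selects.\<close>

lemma face_germ_component:
  assumes V: "openin (top_of_set X) V" "y \<in> V"
    and s: "s > 0" "ball (snd c y) s \<subseteq> snd c ` fst c" "face_ball c I i y s \<subseteq> V"
  shows "face_germ X c I i y V \<in> components (V \<inter> depth1_stratum \<A> X)"
    and "face_ball c I i y s \<subseteq> face_germ X c I i y V"
proof -
  let ?D = "V \<inter> depth1_stratum \<A> X"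
  obtain p0 where p0: "p0 \<in> face_ball c I i y s" using face_ball_nonempty[OF s(1,2)] by blast
  have sub: "face_ball c I i y s \<subseteq> ?D" using face_ball_in_stratum[of s] s(3) by blast
  have conn: "connected_component ?D p q" if "p \<in> face_ball c I i y s" "q \<in> face_ball c I i y s" for p q
    unfolding connected_component_def using face_ball_connected[OF s(2)] sub that by blast
  have eq: "face_germ X c I i y V = connected_component_set ?D p0"
  proof (intro set_eqI iffI)
    fix z assume "z \<in> face_germ X c I i y V"
    then obtain s' where s': "s' > 0" "\<And>p. p \<in> face_ball c I i y s' \<Longrightarrow> connected_component ?D p z"
      using V unfolding face_germ_def by auto
    have "face_ball c I i y (min s s') \<noteq> {}"
      by (rule face_ball_nonempty) (use s s' in auto)
    then obtain p where p: "p \<in> face_ball c I i y s" "p \<in> face_ball c I i y s'"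
      by (auto simp: face_ball_def)
    show "z \<in> connected_component_set ?D p0"
      using connected_component_trans[OF conn[OF p0 p(1)] s'(2)[OF p(2)]] by simp
  next
    fix z assume z: "z \<in> connected_component_set ?D p0"
    have "connected_component ?D p z" if "p \<in> face_ball c I i y s" for p
      using connected_component_trans[OF conn[OF that p0]] z by simp
    then show "z \<in> face_germ X c I i y V" using V s(1) unfolding face_germ_def by auto
  qed
  show "face_germ X c I i y V \<in> components ?D"
    unfolding eq components_def using sub p0 by blast
  show "face_ball c I i y s \<subseteq> face_germ X c I i y V"
    unfolding eq using conn[OF p0] by blast
qed

lemma face_germ_nbhd:
  assumes V: "openin (top_of_set X) V" "y \<in> V"
  obtains s where "s > 0" "ball (snd c y) s \<subseteq> snd c ` fst c"
    "X \<inter> {z \<in> fst c. dist (snd c z) (snd c y) < s} \<subseteq> V" "face_ball c I i y s \<subseteq> V"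
proof -
  obtain O' where O': "open O'" "V = X \<inter> O'" using V(1) unfolding openin_open by blast
  have "y \<in> O'" using V O' by blast
  obtain s where s: "s > 0" "ball (snd c y) s \<subseteq> snd c ` fst c"
    "{z \<in> fst c. dist (snd c z) (snd c y) < s} \<subseteq> O'"
    by (rule face_ball_nbhd[OF O'(1) \<open>y \<in> O'\<close>])
  have "face_ball c I i y s \<subseteq> X \<inter> {z \<in> fst c. dist (snd c z) (snd c y) < s}"
    using face_ball_in_stratum[of s] by (auto simp: face_ball_def face_def)
  then show thesis using that[OF s(1,2)] s(3) O'(2) by blast
qed

lemma in_closure_face_ball:
  assumes "s > 0" "ball (snd c y) s \<subseteq> snd c ` fst c" "face_ball c I i y s \<subseteq> C"
  shows "y \<in> closure C"
proof -
  have "O' \<inter> C \<noteq> {}" if O': "open O'" "y \<in> O'" for O'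
  proof -
    obtain s' where s': "s' > 0" "ball (snd c y) s' \<subseteq> snd c ` fst c"
        "{z \<in> fst c. dist (snd c z) (snd c y) < s'} \<subseteq> O'"
      by (rule face_ball_nbhd[OF O'])
    have "face_ball c I i y (min s s') \<noteq> {}"
      by (rule face_ball_nonempty) (use assms s' in auto)
    then obtain p where p: "p \<in> face_ball c I i y s" "p \<in> face_ball c I i y s'"
      by (auto simp: face_ball_def)
    then have "p \<in> O'" using s'(3) by (auto simp: face_ball_def face_def)
    then show ?thesis using p(1) assms(3) by blast
  qed
  then show ?thesis unfolding closure_iff_nhds_not_empty by blast
qed

text \<open>The choices are compatible because a common smaller face ball lies in the components
  chosen for both neighbourhoods and accumulates at \<open>y\<close>.\<close>

lemma face_germ_local_boundary_component: "local_boundary_component \<A> X y (face_germ X c I i y)"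
  unfolding local_boundary_component_def Let_def
proof (intro conjI ballI allI impI)
  fix V assume "V \<in> {V. openin (top_of_set X) V \<and> y \<in> V}"
  then have V: "openin (top_of_set X) V" "y \<in> V" by auto
  obtain s where s0: "s > 0" "ball (snd c y) s \<subseteq> snd c ` fst c"
      "X \<inter> {z \<in> fst c. dist (snd c z) (snd c y) < s} \<subseteq> V" "face_ball c I i y s \<subseteq> V"
    by (rule face_germ_nbhd[OF V])
  note s = s0(1,2,4)
  show "face_germ X c I i y V \<in> components (V \<inter> depth1_stratum \<A> X)"
    by (rule face_germ_component(1)[OF V s])
  show "y \<in> closure (face_germ X c I i y V)"
    by (rule in_closure_face_ball[OF s(1,2) face_germ_component(2)[OF V s]])
  fix V' assume "V' \<in> {V. openin (top_of_set X) V \<and> y \<in> V}"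
  then have V': "openin (top_of_set X) V'" "y \<in> V'" by auto
  obtain s' where s1: "s' > 0" "ball (snd c y) s' \<subseteq> snd c ` fst c"
      "X \<inter> {z \<in> fst c. dist (snd c z) (snd c y) < s'} \<subseteq> V'" "face_ball c I i y s' \<subseteq> V'"
    by (rule face_germ_nbhd[OF V'])
  note s' = s1(1,2,4)
  have "face_ball c I i y (min s s') \<subseteq> face_germ X c I i y V \<inter> face_germ X c I i y V'"
    using face_germ_component(2)[OF V s] face_germ_component(2)[OF V' s'] by (auto simp: face_ball_def)
  then show "y \<in> closure (face_germ X c I i y V \<inter> face_germ X c I i y V')"
    by (rule in_closure_face_ball[rotated 2]) (use s s' in auto)
next
  fix V assume "V \<notin> {V. openin (top_of_set X) V \<and> y \<in> V}"
  then show "face_germ X c I i y V = {}" unfolding face_germ_def by auto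
qed

end

text \<open>A small face ball at \<open>y\<close> is contained in the one at \<open>x\<close>, so
  the two components of the stratum in \<open>V\<close> meet.\<close>

lemma face_germ_eq:
  assumes i: "i \<in> I" and xX: "x \<in> X" and y: "y \<in> fst c" "y \<in> X" "snd c y \<bullet> i = 0"
    and V: "openin (top_of_set X) V" "x \<in> V" "y \<in> V"
    and s: "s > 0" "ball (snd c x) s \<subseteq> snd c ` fst c" "face_ball c I i x s \<subseteq> V"
    and d: "dist (snd c y) (snd c x) < s"
  shows "face_germ X c I i y V = face_germ X c I i x V"
proof -
  define s' where "s' = s - dist (snd c y) (snd c x)"
  have s': "s' > 0" using d by (simp add: s'_def)
  have b: "ball (snd c y) s' \<subseteq> ball (snd c x) s"
  proof
    fix w assume "w \<in> ball (snd c y) s'"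
    then show "w \<in> ball (snd c x) s"
      using dist_triangle[of "snd c x" w "snd c y"] by (simp add: s'_def dist_commute)
  qed
  have f: "face_ball c I i y s' \<subseteq> face_ball c I i x s"
  proof
    fix z assume "z \<in> face_ball c I i y s'"
    then show "z \<in> face_ball c I i x s"
      using dist_triangle[of "snd c z" "snd c x" "snd c y"] by (simp add: s'_def face_ball_def)
  qed
  have b': "ball (snd c y) s' \<subseteq> snd c ` fst c" using b s(2) by blast
  have f': "face_ball c I i y s' \<subseteq> V" using f s(3) by blast
  note Cy = face_germ_component[OF i y V(1,3) s' b' f']
  note Cx = face_germ_component[OF i corner_chartD(2) xX corner_chartD(5)[OF i] V(1,2) s]
  have "face_ball c I i y s' \<noteq> {}" by (rule face_ball_nonempty[OF i y s' b'])
  then have "face_germ X c I i y V \<inter> face_germ X c I i x V \<noteq> {}" using Cy(2) Cx(2) f by blast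
  then show ?thesis using components_eq[OF Cy(1) Cx(1)] by blast
qed

text \<open>Along a face, sending a point to its face germ is continuous at \<open>x\<close>. The
  boundary topology is given by generators, so the proof is an induction over the generation of
  \<open>N\<close>; on a generator it is local constancy of the germs.\<close>

lemma face_germ_open:
  assumes i: "i \<in> I" and xX: "x \<in> X" and N: "openin (bdry_topology \<A> X) N" "(x, face_germ X c I i x) \<in> N"
  shows "\<exists>s>0. \<forall>y\<in>fst c \<inter> X. snd c y \<bullet> i = 0 \<and> dist (snd c y) (snd c x) < s \<longrightarrow> (y, face_germ X c I i y) \<in> N"
proof -
  let ?P = "\<lambda>N. (x, face_germ X c I i x) \<in> N \<longrightarrow>
    (\<exists>s>0. \<forall>y\<in>fst c \<inter> X. snd c y \<bullet> i = 0 \<and> dist (snd c y) (snd c x) < s \<longrightarrow> (y, face_germ X c I i y) \<in> N)"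
  let ?G = "{{(x, \<beta>). (x, \<beta>) \<in> bdry \<A> X \<and> x \<in> V \<and> \<beta> V = W}
      | V W. openin (top_of_set X) V \<and> W \<in> components (V \<inter> depth1_stratum \<A> X)}"
  have "generate_topology_on ?G N"
    using openin_topology_generated_by N(1) unfolding bdry_topology_def by blast
  then have "?P N"
  proof (induction rule: generate_topology_on.induct)
    case Empty
    show ?case by simp
  next
    case (Int a b)
    show ?case
    proof
      assume x: "(x, face_germ X c I i x) \<in> a \<inter> b"
      obtain s1 where s1: "s1 > 0" "\<forall>y\<in>fst c \<inter> X. snd c y \<bullet> i = 0 \<and> dist (snd c y) (snd c x) < s1 \<longrightarrow> (y, face_germ X c I i y) \<in> a"
        using Int.IH(1) x by blast
      obtain s2 where s2: "s2 > 0" "\<forall>y\<in>fst c \<inter> X. snd c y \<bullet> i = 0 \<and> dist (snd c y) (snd c x) < s2 \<longrightarrow> (y, face_germ X c I i y) \<in> b"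
        using Int.IH(2) x by blast
      show "\<exists>s>0. \<forall>y\<in>fst c \<inter> X. snd c y \<bullet> i = 0 \<and> dist (snd c y) (snd c x) < s \<longrightarrow> (y, face_germ X c I i y) \<in> a \<inter> b"
        by (rule exI[of _ "min s1 s2"]) (use s1 s2 in auto)
    qed
  next
    case (UN K)
    show ?case
    proof
      assume "(x, face_germ X c I i x) \<in> \<Union>K"
      then obtain k where k: "k \<in> K" "(x, face_germ X c I i x) \<in> k" by blast
      then obtain s where "s > 0" "\<forall>y\<in>fst c \<inter> X. snd c y \<bullet> i = 0 \<and> dist (snd c y) (snd c x) < s \<longrightarrow> (y, face_germ X c I i y) \<in> k"
        using UN.IH[OF k(1)] by blast
      then show "\<exists>s>0. \<forall>y\<in>fst c \<inter> X. snd c y \<bullet> i = 0 \<and> dist (snd c y) (snd c x) < s \<longrightarrow> (y, face_germ X c I i y) \<in> \<Union>K"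
        using k(1) by blast
    qed
  next
    case (Basis N)
    then obtain V W where VW: "N = {(x, \<beta>). (x, \<beta>) \<in> bdry \<A> X \<and> x \<in> V \<and> \<beta> V = W}" "openin (top_of_set X) V"
      by blast
    show ?case
    proof
      assume "(x, face_germ X c I i x) \<in> N"
      then have x: "x \<in> V" "face_germ X c I i x V = W" by (auto simp: VW(1))
      obtain s where s: "s > 0" "ball (snd c x) s \<subseteq> snd c ` fst c"
         "X \<inter> {z \<in> fst c. dist (snd c z) (snd c x) < s} \<subseteq> V" "face_ball c I i x s \<subseteq> V"
        by (rule face_germ_nbhd[OF i corner_chartD(2) xX corner_chartD(5)[OF i] VW(2) x(1)])
      have "(y, face_germ X c I i y) \<in> N"
        if y: "y \<in> fst c" "y \<in> X" "snd c y \<bullet> i = 0" "dist (snd c y) (snd c x) < s" for y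
      proof -
        have yV: "y \<in> V" using s(3) y by blast
        have "face_germ X c I i y V = W"
          using face_germ_eq[OF i xX y(1-3) VW(2) x(1) yV s(1,2,4) y(4)] x(2) by simp
        moreover have "(y, face_germ X c I i y) \<in> bdry \<A> X"
          using face_germ_local_boundary_component[OF i y(1-3)] y(2) by (simp add: bdry_def)
        ultimately show ?thesis using yV by (simp add: VW(1))
      qed
      then show "\<exists>s>0. \<forall>y\<in>fst c \<inter> X. snd c y \<bullet> i = 0 \<and> dist (snd c y) (snd c x) < s \<longrightarrow> (y, face_germ X c I i y) \<in> N"
        using s(1) by blast
    qed
  qed
  then show ?thesis using N(2) by blast
qed

text \<open>If all corner coordinates were positive, they would remain so on a neighbourhood, which
  would then lie in \<open>X\<close>.\<close>

lemma boundary_point_on_face: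
  assumes y: "y \<in> fst c" "y \<in> X" "y \<notin> interior X"
  shows "\<exists>i\<in>I. snd c y \<bullet> i = 0"
proof (rule ccontr)
  assume no: "\<not> ?thesis"
  have pos: "\<forall>i\<in>I. 0 < snd c y \<bullet> i"
    using no in_corner_iff[OF y(1)] y(2) by (metis order_le_less)
  define O' where "O' = fst c \<inter> snd c -` (\<Inter>j\<in>I. {y. 0 < y \<bullet> j})"
  have "open (\<Inter>j\<in>I. {y::'e. 0 < y \<bullet> j})"
    using corner_chartD(4) by (intro open_INT ballI open_Collect_less continuous_intros) auto
  then have "open O'"
    unfolding O'_def using continuous_open_preimage[OF chart_continuous open_fst, OF corner_chartD(1,1)] by auto
  moreover have "O' \<subseteq> X"
  proof
    fix z assume z: "z \<in> O'"
    then have "z \<in> fst c" "\<forall>i\<in>I. 0 \<le> snd c z \<bullet> i" by (auto simp: O'_def less_imp_le)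
    then show "z \<in> X" using in_corner_iff by blast
  qed
  moreover have "y \<in> O'" using y(1) pos by (auto simp: O'_def)
  ultimately show False using y(3) interiorI by blast
qed

text \<open>A short step against the single corner direction leaves \<open>X\<close>.\<close>

lemma depth1_not_interior:
  assumes "card I = 1"
  shows "x \<notin> interior X"
proof
  assume xi: "x \<in> interior X"
  obtain i where I: "I = {i}" using assms card_1_singletonE by blast
  have i: "i \<in> Basis" using corner_chartD(3) I by blast
  have "open (snd c ` (interior X \<inter> fst c))" "snd c x \<in> snd c ` (interior X \<inter> fst c)"
    using open_chart_image[OF corner_chartD(1) open_interior] xi corner_chartD(2) by auto
  then obtain r where r: "r > 0" "ball (snd c x) r \<subseteq> snd c ` (interior X \<inter> fst c)"
    using open_contains_ball by blast
  have "snd c x - (r/2) *\<^sub>R i \<in> ball (snd c x) r" using r(1) i by (simp add: dist_norm)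
  from subsetD[OF r(2) this] obtain z where z: "z \<in> interior X" "z \<in> fst c" "snd c z = snd c x - (r/2) *\<^sub>R i"
    by auto
  have "z \<in> X" using z(1) interior_subset by blast
  then have "0 \<le> snd c z \<bullet> i" using in_corner_iff[OF z(2)] I by simp
  moreover have "snd c z \<bullet> i = - (r/2)" using corner_chartD(5)[of i] I i z(3) by (simp add: inner_diff_left)
  ultimately show False using r(1) by simp
qed

end

section \<open>The boundary as a point set, and the descent of consistent data\<close>

lemma bdry_not_interior:
  assumes "b \<in> bdry \<A> X"
  shows "fst b \<in> X - interior X"
proof -
  obtain x \<beta> where b: "b = (x, \<beta>)" "x \<in> X" "local_boundary_component \<A> X x \<beta>"
    using assms unfolding bdry_def by auto
  have "x \<notin> interior X"
  proof
    assume x: "x \<in> interior X"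
    have "openin (top_of_set X) (interior X)"
      by (rule open_subset[OF interior_subset open_interior])
    \<comment> \<open>A germ at an interior point would select a nonempty component inside
      \<open>interior X\<close>, where there are no points of depth one.\<close>
    then have "\<beta> (interior X) \<in> components (interior X \<inter> depth1_stratum \<A> X)"
      using b(3) x unfolding local_boundary_component_def Let_def by blast
    then obtain z where z: "z \<in> interior X" "z \<in> depth1_stratum \<A> X"
      using in_components_nonempty in_components_subset by blast
    then obtain I c where "corner_chart \<A> X z I c" "card I = 1"
      unfolding depth1_stratum_def by blast
    then show False using depth1_not_interior z(1) by blast
  qed
  then show ?thesis using b by simp
qed

text \<open>Conversely to the preceding lemma, each remaining point of \<open>X\<close> lies on a
  face of its corner chart and carries the germ of that face.\<close>

lemma fst_bdry:
  assumes "manifold_with_corners \<A> X"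
  shows "fst ` bdry \<A> X = X - interior X"
proof
  show "fst ` bdry \<A> X \<subseteq> X - interior X" using bdry_not_interior by blast
  show "X - interior X \<subseteq> fst ` bdry \<A> X"
  proof
    fix x assume x: "x \<in> X - interior X"
    then obtain I c where cc: "corner_chart \<A> X x I c" using assms unfolding manifold_with_corners_def by blast
    obtain i where i: "i \<in> I" "snd c x \<bullet> i = 0"
      using boundary_point_on_face[OF cc corner_chartD(2)[OF cc]] x by blast
    have "(x, face_germ X c I i x) \<in> bdry \<A> X"
      using face_germ_local_boundary_component[OF cc i(1) corner_chartD(2)[OF cc] _ i(2)] x by (simp add: bdry_def)
    then show "x \<in> fst ` bdry \<A> X" by force
  qed
qed

text \<open>For continuity at a corner \<open>x\<close>: every boundary point near \<open>x\<close>
  lies on one of the finitely many faces through \<open>x\<close>, and along each of them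
  \<open>\<phi>\<close> of the face germ is continuous at \<open>x\<close>. Intersecting the
  finitely many neighbourhoods gives one for \<open>h\<close>.\<close>

lemma consistent_descends:
  assumes X: "manifold_with_corners \<A> X"
    and cont: "continuous_map (bdry_topology \<A> X) euclideanreal \<phi>" and cons: "consistent \<A> X \<phi>"
  obtains h where "continuous_on (X - interior X) h" "\<And>b. b \<in> bdry \<A> X \<Longrightarrow> \<phi> b = h (fst b)"
proof -
  define h where "h x = \<phi> (SOME b. b \<in> bdry \<A> X \<and> fst b = x)" for x
  have h: "\<phi> b = h (fst b)" if b: "b \<in> bdry \<A> X" for b
  proof -
    define b' where "b' = (SOME b'. b' \<in> bdry \<A> X \<and> fst b' = fst b)"
    have b': "b' \<in> bdry \<A> X \<and> fst b' = fst b"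
      unfolding b'_def by (rule someI[of _ b]) (use b in simp)
    have "\<phi> b = \<phi> b'"
      using cons[unfolded consistent_def, THEN bspec, OF b, THEN bspec, of b'] b' by simp
    then show ?thesis unfolding h_def b'_def .
  qed
  have "continuous_on (X - interior X) h"
    unfolding continuous_on_topological
  proof (intro ballI allI impI)
    fix x B assume x: "x \<in> X - interior X" and B: "open B" "h x \<in> B"
    obtain I c where cc: "corner_chart \<A> X x I c" using X x unfolding manifold_with_corners_def by blast
    have xX: "x \<in> X" using x by blast
    let ?N = "{b \<in> topspace (bdry_topology \<A> X). \<phi> b \<in> B}"
    have N: "openin (bdry_topology \<A> X) ?N"
      by (rule openin_continuous_map_preimage[OF cont]) (use B in simp)
    have top: "bdry \<A> X \<subseteq> topspace (bdry_topology \<A> X)"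
    proof
      fix b assume "b \<in> bdry \<A> X"
      then obtain y \<beta> where b: "b = (y, \<beta>)" "(y, \<beta>) \<in> bdry \<A> X" by (cases b) auto
      then have yX: "y \<in> X" and L: "local_boundary_component \<A> X y \<beta>" by (auto simp: bdry_def)
      have oX: "openin (top_of_set X) X" by simp
      have "\<beta> X \<in> components (X \<inter> depth1_stratum \<A> X)"
        using L oX yX unfolding local_boundary_component_def Let_def by blast
      then have "{(x, \<beta>'). (x, \<beta>') \<in> bdry \<A> X \<and> x \<in> X \<and> \<beta>' X = \<beta> X} \<subseteq> topspace (bdry_topology \<A> X)"
        unfolding bdry_topology_def
        by (intro openin_subset topology_generated_by_Basis CollectI exI[of _ X] exI[of _ "\<beta> X"]) simp
      then show "b \<in> topspace (bdry_topology \<A> X)" using b yX by blast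
    qed
    have germ: "(y, face_germ X c I i y) \<in> bdry \<A> X" if "i \<in> I" "y \<in> fst c" "y \<in> X" "snd c y \<bullet> i = 0" for i y
      using face_germ_local_boundary_component[OF cc that] that by (simp add: bdry_def)
    have "\<exists>s>0. \<forall>y\<in>fst c \<inter> X. snd c y \<bullet> i = 0 \<and> dist (snd c y) (snd c x) < s \<longrightarrow> (y, face_germ X c I i y) \<in> ?N"
      if i: "i \<in> I" for i
    proof (rule face_germ_open[OF cc i xX N])
      have "(x, face_germ X c I i x) \<in> bdry \<A> X"
        by (rule germ[OF i corner_chartD(2)[OF cc] xX corner_chartD(5)[OF cc i]])
      then show "(x, face_germ X c I i x) \<in> ?N" using h top B(2) by auto
    qed
    then have "\<forall>i\<in>I. \<exists>s>0. \<forall>y\<in>fst c \<inter> X. snd c y \<bullet> i = 0 \<and> dist (snd c y) (snd c x) < s \<longrightarrow> (y, face_germ X c I i y) \<in> ?N"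
      by (rule ballI)
    from bchoice[OF this] obtain s where s0: "\<forall>i\<in>I. s i > 0 \<and> (\<forall>y\<in>fst c \<inter> X. snd c y \<bullet> i = 0 \<and>
        dist (snd c y) (snd c x) < s i \<longrightarrow> (y, face_germ X c I i y) \<in> ?N)" ..
    have s: "s i > 0" "y \<in> fst c \<inter> X \<Longrightarrow> snd c y \<bullet> i = 0 \<Longrightarrow>
       dist (snd c y) (snd c x) < s i \<Longrightarrow> (y, face_germ X c I i y) \<in> ?N" if "i \<in> I" for i y
      using s0[THEN bspec, OF that, THEN conjunct1] s0[THEN bspec, OF that, THEN conjunct2, THEN bspec, of y] by simp_all
    define V where "V = (\<Inter>i\<in>I. {y \<in> fst c. dist (snd c y) (snd c x) < s i}) \<inter> fst c"
    have "open V" unfolding V_def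
      by (intro open_Int open_INT ballI open_chart_ball corner_chartD[OF cc] open_fst)
    moreover have "x \<in> V" unfolding V_def using s(1) corner_chartD(2)[OF cc] by auto
    moreover have "h y \<in> B" if y: "y \<in> X - interior X" "y \<in> V" for y
    proof -
      have yc: "y \<in> fst c" "y \<in> X" using y by (auto simp: V_def)
      obtain i where i: "i \<in> I" "snd c y \<bullet> i = 0"
        using boundary_point_on_face[OF cc yc] y(1) by blast
      have "dist (snd c y) (snd c x) < s i" using y(2) i(1) by (auto simp: V_def)
      then have "(y, face_germ X c I i y) \<in> ?N" using s(2)[OF i(1) _ i(2)] yc by blast
      then show "h y \<in> B" using h[OF germ[OF i(1) yc i(2)]] by simp
    qed
    ultimately show "\<exists>A. open A \<and> x \<in> A \<and> (\<forall>y\<in>X - interior X. y \<in> A \<longrightarrow> h y \<in> B)" by blast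
  qed
  then show thesis using that h by blast
qed

end

section \<open>Barriers at the boundary\<close>

text \<open>The functions have different domains. At a point outside \<open>B k\<close> the open set
  \<open>- L k\<close> is a neighbourhood on which, within \<open>B k\<close>, only the small rim
  values occur.\<close>

lemma usc_on_finite_glue:
  fixes \<beta> :: "'k \<Rightarrow> 'm::topological_space \<Rightarrow> real"
  assumes "finite K"
    and B: "\<And>k. k \<in> K \<Longrightarrow> open (B k)" and \<beta>: "\<And>k. k \<in> K \<Longrightarrow> continuous_on (B k) (\<beta> k)"
    and L: "\<And>k. k \<in> K \<Longrightarrow> closed (L k)"
    and x: "\<And>k. k \<in> K \<Longrightarrow> x \<in> B k \<Longrightarrow> ereal (\<beta> k x) < a"
    and small: "\<And>k y. k \<in> K \<Longrightarrow> y \<in> (B k - L k) \<inter> S \<Longrightarrow> x \<notin> B k \<Longrightarrow> ereal (\<beta> k y) < a"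
    and LB: "\<And>k. k \<in> K \<Longrightarrow> L k \<subseteq> B k"
  shows "\<exists>V. open V \<and> x \<in> V \<and> (\<forall>k\<in>K. \<forall>y\<in>V \<inter> S. y \<in> B k \<longrightarrow> ereal (\<beta> k y) < a)"
proof -
  have "\<exists>V. open V \<and> x \<in> V \<and> (\<forall>y\<in>V \<inter> S. y \<in> B k \<longrightarrow> ereal (\<beta> k y) < a)" if k: "k \<in> K" for k
  proof (cases "x \<in> B k")
    case True
    obtain V where V: "open V" "x \<in> V" "\<forall>y\<in>V \<inter> B k. ereal (\<beta> k y) < a"
      using usc_on_nbhd[OF usc_on_ereal[OF \<beta>[OF k]] True x[OF k True]] by blast
    then show ?thesis by (intro exI[of _ V]) blast
  next
    case False
    then have "x \<notin> L k" using LB[OF k] by blast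
    show ?thesis
    proof (intro exI[of _ "- L k"] conjI ballI impI)
      show "open (- L k)" using L[OF k] by (rule open_Compl)
      show "x \<in> - L k" using \<open>x \<notin> L k\<close> by simp
      fix y assume "y \<in> - L k \<inter> S" "y \<in> B k"
      then show "ereal (\<beta> k y) < a" using small[OF k _ False] by simp
    qed
  qed
  then have "\<forall>k\<in>K. \<exists>V. open V \<and> x \<in> V \<and> (\<forall>y\<in>V \<inter> S. y \<in> B k \<longrightarrow> ereal (\<beta> k y) < a)" by (rule ballI)
  from bchoice[OF this] obtain V where V: "\<forall>k\<in>K. open (V k) \<and> x \<in> V k \<and>
      (\<forall>y\<in>V k \<inter> S. y \<in> B k \<longrightarrow> ereal (\<beta> k y) < a)" ..
  show ?thesis
  proof (intro exI[of _ "\<Inter>k\<in>K. V k"] conjI ballI impI)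
    show "open (\<Inter>k\<in>K. V k)" using assms(1) V by (intro open_INT) auto
    show "x \<in> (\<Inter>k\<in>K. V k)" using V by auto
    fix k y assume k: "k \<in> K" and y: "y \<in> (\<Inter>k\<in>K. V k) \<inter> S" "y \<in> B k"
    have "y \<in> V k \<inter> S" using y k by blast
    then show "ereal (\<beta> k y) < a" using V[THEN bspec, OF k] y(2) by blast
  qed
qed

text \<open>On \<open>B - L\<close> the function \<open>\<beta>\<close> is dominated by
  \<open>u\<close>, so the maximum joins \<open>u\<close> without a jump at the edge of
  \<open>B\<close>.\<close>

lemma max_glue:
  assumes U: "open U" "U \<subseteq> S" and u: "usc_on S u" "subharmonic_on \<A> g G U u"
    and B: "open B" "closed L" "L \<subseteq> B" and \<beta>: "continuous_on B \<beta>" "subharmonic_on \<A> g G (B \<inter> U) (\<lambda>y. ereal (\<beta> y))"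
    and le: "\<And>y. y \<in> (B - L) \<inter> S \<Longrightarrow> ereal (\<beta> y) \<le> u y"
  defines "v \<equiv> \<lambda>y. if y \<in> B then max (u y) (ereal (\<beta> y)) else u y"
  shows "usc_on S v" "subharmonic_on \<A> g G U v"
proof -
  show usc: "usc_on S v" unfolding usc_on_iff
  proof (intro ballI conjI allI impI)
    fix x assume x: "x \<in> S"
    show "v x < \<infinity>" using usc_onD[OF u(1) x] by (auto simp: v_def max_def)
    fix a assume a: "v x < a"
    have "u x < a" using a unfolding v_def by (auto split: if_splits)
    then obtain V where V: "open V" "x \<in> V" "\<forall>y\<in>V \<inter> S. u y < a" using usc_on_nbhd[OF u(1) x] by blast
    show "\<exists>V. open V \<and> x \<in> V \<and> (\<forall>y\<in>V \<inter> S. v y < a)"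
    proof (cases "x \<in> B")
      case True
      then have "ereal (\<beta> x) < a" using a by (simp add: v_def)
      then obtain V' where V': "open V'" "x \<in> V'" "\<forall>y\<in>V' \<inter> B. ereal (\<beta> y) < a"
        using usc_on_nbhd[OF usc_on_ereal[OF \<beta>(1)] True] by blast
      show ?thesis
        by (rule exI[of _ "V \<inter> V'"]) (use V V' in \<open>auto simp: v_def\<close>)
    next
      case False
      then have "x \<in> V - L" using V B(3) by blast
      moreover have "v y < a" if "y \<in> (V - L) \<inter> S" for y
        using that V(3) le[of y] by (auto simp: v_def max_def)
      moreover have "open (V - L)" using V(1) B(2) by (rule open_Diff)
      ultimately show ?thesis by blast
    qed
  qed
  show "subharmonic_on \<A> g G U v"
  proof (rule subharmonic_pieces[OF usc_on_subset[OF usc U(2)]])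
    fix x assume x: "x \<in> U"
    show "\<exists>W f. open W \<and> x \<in> W \<and> W \<subseteq> U \<and> subharmonic_on \<A> g G W f \<and> (\<forall>y\<in>W. f y \<le> v y) \<and> f x = v x"
    proof (cases "x \<in> B \<and> u x \<le> ereal (\<beta> x)")
      case True
      then have "ereal (\<beta> x) = v x" by (simp add: v_def max_def)
      moreover have "\<forall>y\<in>B \<inter> U. ereal (\<beta> y) \<le> v y" by (simp add: v_def)
      ultimately show ?thesis using True x \<beta>(2) B(1) U(1)
        by (intro exI[of _ "B \<inter> U"] exI[of _ "\<lambda>y. ereal (\<beta> y)"]) auto
    next
      case False
      then have "u x = v x" by (auto simp: v_def max_def)
      moreover have "\<forall>y\<in>U. u y \<le> v y" by (simp add: v_def)
      ultimately show ?thesis using x u(2) U(1)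
        by (intro exI[of _ U] exI[of _ u]) auto
    qed
  qed
qed

context riemannian
begin

text \<open>Steepness \<open>t\<close> and height \<open>a\<close> stay free, to be fixed once
  bounds on the function to be glued are known. The rim lies at depth \<open>2 * \<zeta>\<close>, so
  that a smaller neighbourhood cut out at depth \<open>\<zeta>\<close> leaves room for another
  function in between.\<close>

definition local_barrier :: "('m, 'e) jet set \<Rightarrow> 'm set \<Rightarrow> real \<Rightarrow> 'm \<Rightarrow> 'm set \<Rightarrow> 'm set \<Rightarrow> ('m \<Rightarrow> real)
    \<Rightarrow> real \<Rightarrow> real \<Rightarrow> bool" where
  "local_barrier G U lam x B L \<eta> \<zeta> t0 \<longleftrightarrow> open B \<and> x \<in> B \<and> closed L \<and> L \<subseteq> B \<and> continuous_on B \<eta> \<and> \<eta> x = 0 \<and>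
     (\<forall>y\<in>B \<inter> closure U. \<eta> y \<le> 0) \<and> (\<forall>y\<in>(B - L) \<inter> closure U. \<eta> y \<le> - 2 * \<zeta>) \<and> 0 < \<zeta> \<and> 0 < t0 \<and>
     (\<forall>t\<ge>t0. \<forall>a\<le>lam. subharmonic_on \<A> g G (B \<inter> U) (\<lambda>y. ereal (a + t * \<eta> y)))"

lemma local_barrierD:
  assumes "local_barrier G U lam x B L \<eta> \<zeta> t0"
  shows "open B" "x \<in> B" "closed L" "L \<subseteq> B" "continuous_on B \<eta>" "\<eta> x = 0"
    "\<And>y. y \<in> B \<Longrightarrow> y \<in> closure U \<Longrightarrow> \<eta> y \<le> 0" "\<And>y. y \<in> B - L \<Longrightarrow> y \<in> closure U \<Longrightarrow> \<eta> y \<le> - 2 * \<zeta>" "0 < \<zeta>" "0 < t0"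
    "\<And>t a. t0 \<le> t \<Longrightarrow> a \<le> lam \<Longrightarrow> subharmonic_on \<A> g G (B \<inter> U) (\<lambda>y. ereal (a + t * \<eta> y))"
  using assms unfolding local_barrier_def by blast+

text \<open>
  Subtracting a small multiple of the squared chart distance from a defining function makes it
  strictly negative away from \<^term>\<open>x\<close>, and keeps its reduced jets in the open asymptotic cone.
\<close>

lemma local_barrier_exists:
  assumes G: "monotone_jets \<A> G" and U: "open U" and conv: "strictly_convex_component \<A> g G U C"
    and x: "x \<in> fst ` C" "x \<in> closure U" and W0: "open W0" "x \<in> W0"
  shows "\<exists>B L \<eta> \<zeta> t0. local_barrier G U lam x B L \<eta> \<zeta> t0 \<and> B \<subseteq> W0"
proof -
  obtain \<rho> where \<rho>: "local_defining_function \<A> U (fst ` C) x \<rho>"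
    and asy: "red_jet2 \<A> g x \<rho> \<in> asymptotic_interior \<A> (fibre_at_value G lam)"
    using conv x(1) unfolding strictly_convex_component_def by blast
  obtain N t0 where N: "openin (red_jet_topology \<A>) N" "red_jet2 \<A> g x \<rho> \<in> N" "0 < t0"
    and NG: "\<And>t. t \<ge> t0 \<Longrightarrow> scale_red_jet t ` N \<subseteq> fibre_at_value G lam"
    using asy unfolding asymptotic_interior_def by blast
  obtain W where *: "open W \<and> x \<in> W \<and> smooth_fun_on \<A> W \<rho> \<and>
        (\<forall>y \<in> W \<inter> closure U. \<rho> y = 0 \<longleftrightarrow> y \<in> fst ` C) \<and>
        (\<forall>y \<in> W \<inter> fst ` C. differential \<A> y \<rho> \<noteq> (\<lambda>c. 0)) \<and> (\<forall>y \<in> W \<inter> U. \<rho> y < 0)"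
    using \<rho> unfolding local_defining_function_def by (elim exE) (rule that)
  note W = *[THEN conjunct1] *[THEN conjunct2, THEN conjunct1] *[THEN conjunct2, THEN conjunct2, THEN conjunct1]
  have zero: "\<rho> y = 0 \<longleftrightarrow> y \<in> fst ` C" if "y \<in> W \<inter> closure U" for y
    using * that by (elim conjE) (rule bspec)
  have neg: "\<rho> y < 0" if "y \<in> W \<inter> U" for y
    using *[THEN conjunct2, THEN conjunct2, THEN conjunct2, THEN conjunct2, THEN conjunct2] that by (rule bspec)
  obtain c where c: "c \<in> charts_at \<A> x" using charts_at_exists by blast
  have cA: "c \<in> \<A>" "x \<in> fst c" using charts_atD[OF c] by auto
  define q where "q = (\<lambda>y. (dist (snd c y) (snd c x))\<^sup>2)"
  define W1 where "W1 = W \<inter> W0 \<inter> fst c"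
  have W1: "open W1" "x \<in> W1" using W W0 cA by (auto simp: W1_def)
  have \<rho>W: "Ck_fun_on \<A> 2 W \<rho>" using W(3) unfolding smooth_fun_on_def by blast
  have \<rho>2: "Ck_fun_on \<A> 2 W1 \<rho>" by (rule Ck_fun_on_subset[OF \<rho>W]) (auto simp: W1_def)
  have q: "Ck_fun_on \<A> 2 W1 q"
    unfolding q_def by (rule Ck_fun_on_subset[OF Ck_fun_on_sq_dist[OF cA(1)]]) (simp add: W1_def)
  obtain V \<delta> where V: "open V" "x \<in> V" "V \<subseteq> W1" "\<delta> > 0"
    and VJ: "\<And>y e. y \<in> V \<Longrightarrow> \<bar>e\<bar> < \<delta> \<Longrightarrow> red_jet2 \<A> g y (\<lambda>z. \<rho> z + e * q z) \<in> N"
    using red_jet2_perturbed_nbhd[OF W1 \<rho>2 q N(1,2)] by blast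
  obtain r where r: "r > 0" "{y \<in> fst c. dist (snd c y) (snd c x) \<le> r} \<subseteq> V"
    and rc: "\<And>s. s \<le> r \<Longrightarrow> compact {y \<in> fst c. dist (snd c y) (snd c x) \<le> s}"
    using chart_ball[OF c V(1,2)] by blast
  define B where "B = {y \<in> fst c. dist (snd c y) (snd c x) < r}"
  define L where "L = {y \<in> fst c. dist (snd c y) (snd c x) \<le> r / 2}"
  have B: "open B" "x \<in> B" "B \<subseteq> V" unfolding B_def using open_chart_ball[OF cA(1)] cA(2) r by auto
  have L: "closed L" "L \<subseteq> B" using compact_imp_closed[OF rc[of "r/2"]] r(1) by (auto simp: L_def B_def)
  define e where "e = \<delta> / 2"
  have e: "0 < e" "e < \<delta>" using V(4) by (auto simp: e_def)
  define \<eta> where "\<eta> = (\<lambda>y. \<rho> y + (- e) * q y)"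
  \<comment> \<open>Off \<open>L\<close> the squared distance is at least
    \<open>(r / 2)\<^sup>2\<close>, so \<open>\<eta>\<close> is at most \<open>- 2 * \<zeta>\<close>
    there.\<close>
  define \<zeta> where "\<zeta> = e * (r / 2)\<^sup>2 / 2"
  have BW: "B \<subseteq> W1" "B \<subseteq> W" "B \<subseteq> W0" using B V by (auto simp: W1_def)
  \<comment> \<open>The sign of \<open>\<rho>\<close> is given on \<open>U\<close>; continuity
    carries it to the closure.\<close>
  have \<rho>le: "\<rho> y \<le> 0" if y: "y \<in> W" "y \<in> closure U" for y
  proof (rule ccontr)
    assume "\<not> \<rho> y \<le> 0"
    have "open (W \<inter> \<rho> -` {0<..})"
      by (rule continuous_open_preimage[OF C2_continuous[OF W(1) \<rho>W] W(1)]) simp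
    moreover have "y \<in> W \<inter> \<rho> -` {0<..}" using \<open>\<not> \<rho> y \<le> 0\<close> y by simp
    ultimately obtain z where "z \<in> W \<inter> \<rho> -` {0<..}" "z \<in> U"
      using y(2) unfolding closure_iff_nhds_not_empty by blast
    then show False using neg[of z] by simp
  qed
  have q0: "q y \<ge> 0" for y by (simp add: q_def)
  have \<eta>2: "Ck_fun_on \<A> 2 W1 \<eta>"
    using Ck_fun_on_affine[OF W1(1) \<rho>2 q, of 1 "- e" 0] by (simp add: \<eta>_def)
  have \<eta>le: "\<eta> y \<le> 0" if "y \<in> B" "y \<in> closure U" for y
  proof -
    have "0 \<le> e * q y" using e(1) q0[of y] by simp
    moreover have "\<rho> y \<le> 0" using \<rho>le that BW(2) by blast
    ultimately show ?thesis by (simp add: \<eta>_def)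
  qed
  have "local_barrier G U lam x B L \<eta> \<zeta> t0"
    unfolding local_barrier_def
  proof (intro conjI ballI allI impI)
    show "continuous_on B \<eta>" by (rule continuous_on_subset[OF C2_continuous[OF W1(1) \<eta>2] BW(1)])
    have "\<rho> x = 0" using zero[of x] W(2) x by blast
    then show "\<eta> x = 0" by (simp add: \<eta>_def q_def)
    show "\<eta> y \<le> 0" if "y \<in> B \<inter> closure U" for y using \<eta>le that by blast
    show "\<eta> y \<le> - 2 * \<zeta>" if y: "y \<in> (B - L) \<inter> closure U" for y
    proof -
      have "(r/2)\<^sup>2 \<le> q y" using y r(1) unfolding B_def L_def q_def by (intro power_mono) auto
      then have "e * (r/2)\<^sup>2 \<le> e * q y" using e(1) by simp
      moreover have "\<rho> y \<le> 0" using \<rho>le[of y] y BW(2) by blast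
      ultimately show ?thesis by (simp add: \<eta>_def \<zeta>_def)
    qed
    show "0 < \<zeta>" using e(1) r(1) by (simp add: \<zeta>_def)
    fix t a assume t: "t0 \<le> t" and a: "a \<le> lam"
    have BU: "open (B \<inter> U)" using B(1) U by blast
    have "subharmonic_on \<A> g G (B \<inter> U) (\<lambda>y. ereal (t * \<rho> y + (- (t * e)) * q y + a))"
    proof (rule C2_subharmonic[OF BU _ G])
      show "Ck_fun_on \<A> 2 (B \<inter> U) (\<lambda>y. t * \<rho> y + (- (t * e)) * q y + a)"
        by (rule Ck_fun_on_subset[OF Ck_fun_on_affine[OF W1(1) \<rho>2 q]]) (use BW(1) in blast)
      fix y assume y: "y \<in> B \<inter> U"
      then have yW: "y \<in> W1" using BW(1) by blast
      have "red_jet2 \<A> g y (\<lambda>z. \<rho> z + (- e) * q z) \<in> N" by (rule VJ) (use y B(3) e in auto)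
      then have "(y, (\<lambda>c. differential \<A> y \<rho> c + (- e) *\<^sub>R differential \<A> y q c),
          (\<lambda>c. hessian \<A> g y \<rho> c + (- e) *\<^sub>R hessian \<A> g y q c)) \<in> N"
        using jet2_affine[OF W1(1) yW \<rho>2 q, of 1 "- e" 0] by (simp add: red_jet2_def jet2_def)
      from subsetD[OF NG[OF t] imageI[OF this]]
      have "(y, lam, (\<lambda>c. t *\<^sub>R (differential \<A> y \<rho> c + (- e) *\<^sub>R differential \<A> y q c)),
          (\<lambda>c. t *\<^sub>R (hessian \<A> g y \<rho> c + (- e) *\<^sub>R hessian \<A> g y q c))) \<in> G"
        by (simp add: scale_red_jet_def fibre_at_value_def)
      \<comment> \<open>The asymptotic interior yields membership at value \<open>lam\<close>; the
        actual value is not larger, so condition (N) applies.\<close>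
      moreover have "t * \<rho> y + (- (t * e)) * q y + a - lam \<le> 0"
      proof -
        have "t * \<eta> y \<le> 0" using \<eta>le[of y] y closure_subset[of U] t N(3) by (intro mult_nonneg_nonpos) auto
        then show ?thesis using a by (simp add: \<eta>_def algebra_simps)
      qed
      ultimately have "(y, lam + (t * \<rho> y + (- (t * e)) * q y + a - lam),
          (\<lambda>c. t *\<^sub>R (differential \<A> y \<rho> c + (- e) *\<^sub>R differential \<A> y q c)),
          (\<lambda>c. t *\<^sub>R (hessian \<A> g y \<rho> c + (- e) *\<^sub>R hessian \<A> g y q c))) \<in> G"
        using G unfolding monotone_jets_def by blast
      then show "jet2 \<A> g y (\<lambda>y. t * \<rho> y + (- (t * e)) * q y + a) \<in> G"
        unfolding jet2_affine[OF W1(1) yW \<rho>2 q] by (simp add: scaleR_right_distrib scaleR_right_diff_distrib algebra_simps)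
    qed
    then show "subharmonic_on \<A> g G (B \<inter> U) (\<lambda>y. ereal (a + t * \<eta> y))"
      by (simp add: \<eta>_def algebra_simps)
  qed (use B L N in auto)
  then show ?thesis using BW(3) by blast
qed

text \<open>
  The given function \<^term>\<open>w\<close> may blow up at the boundary, so it is used only away from the boundary,
  where it lies between the values of the barriers near the boundary and on the rims of their domains.
\<close>

lemma bounded_subharmonic_exists:
  assumes G: "monotone_jets \<A> G" and U: "open U" "compact (closure U)"
    and w: "subharmonic_on \<A> g G U w" "\<And>x. x \<in> U \<Longrightarrow> ereal a \<le> w x"
    and bar: "\<And>x. x \<in> closure U - U \<Longrightarrow> \<exists>B L \<eta> \<zeta> t0. local_barrier G U lam x B L \<eta> \<zeta> t0"
  shows "\<exists>w0 a'. usc_on (closure U) w0 \<and> subharmonic_on \<A> g G U w0 \<and> (\<forall>x\<in>closure U. ereal a' \<le> w0 x) \<and>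
    (\<forall>x\<in>closure U - U. w0 x \<le> ereal lam)"
proof -
  let ?S = "closure U"
  obtain B L \<eta> \<zeta> t0 where lb: "\<And>x. x \<in> ?S - U \<Longrightarrow> local_barrier G U lam x (B x) (L x) (\<eta> x) (\<zeta> x) (t0 x)"
    using bar by metis
  \<comment> \<open>These sets cover the compact boundary; on them a barrier stays above half of its
    drop to the rim.\<close>
  define O' where "O' k = B k \<inter> \<eta> k -` {- \<zeta> k<..}" for k
  have O': "open (O' k)" "k \<in> O' k" if "k \<in> ?S - U" for k
    using local_barrierD(1,2,5,6,9)[OF lb[OF that]] continuous_open_preimage[OF _ _ open_greaterThan]
    by (auto simp: O'_def)
  have "compact (?S - U)" using U by (intro compact_diff)
  then obtain K where K: "K \<subseteq> ?S - U" "finite K" "?S - U \<subseteq> (\<Union>k\<in>K. O' k)"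
    by (rule compactE_image[of _ "?S - U" O']) (use O' in auto)
  note lbK = lb[OF subsetD[OF K(1)]]
  define N where "N = (\<Union>k\<in>K. O' k)"
  have N: "open N" "?S - U \<subseteq> N" using K O'(1) unfolding N_def by auto
  have QU: "?S - N \<subseteq> U" using N(2) by blast
  have wU: "usc_on U w" by (rule subharmonic_on_usc[OF w(1)])
  obtain M :: real where M: "\<And>y. y \<in> ?S - N \<Longrightarrow> w y \<le> ereal M"
  proof (cases "?S - N = {}")
    case True
    then show ?thesis using that by blast
  next
    case False
    have "compact (?S - N)" using U(2) N(1) by (rule compact_diff)
    then obtain z where z: "z \<in> ?S - N" "\<forall>y\<in>?S - N. w y \<le> w z"
      using usc_attains_max[OF _ False usc_on_subset[OF wU QU]] by blast
    have "w z < \<infinity>" using usc_onD[OF wU] z(1) QU by blast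
    then obtain M where "w z \<le> ereal M" by (cases "w z") auto
    then show ?thesis using that z(2) order_trans by blast
  qed
  \<comment> \<open>With \<open>t k * \<zeta> k = T\<close>, barriers exceed \<open>lam - T\<close>
    on the sets \<open>O' k\<close> and are at most \<open>lam - 2 * T\<close> on their rims. The
    sum gives \<open>t0 k \<le> t k\<close>; the terms in \<open>M\<close> and \<open>a\<close> let
    the shift by \<open>C \<ge> 0\<close> place \<open>w\<close> strictly between these two levels
    off \<open>N\<close>.\<close>
  define T where "T = (\<Sum>k\<in>K. \<zeta> k * t0 k) + \<bar>M - a\<bar> + \<bar>a - lam\<bar> + 1"
  define C where "C = a - lam + 2 * T - 1/2"
  define t where "t k = T / \<zeta> k" for k
  have pos: "0 < \<zeta> k" "0 < t0 k" if "k \<in> K" for k using local_barrierD(9,10)[OF lbK[OF that]] .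
  have sum0: "0 \<le> (\<Sum>k\<in>K. \<zeta> k * t0 k)"
    by (rule sum_nonneg) (use pos in \<open>simp add: less_imp_le\<close>)
  have T: "T > 0" "C \<ge> 0" "M - C < lam - T" "a - C > lam - 2 * T"
    unfolding C_def T_def using sum0 by (auto simp: abs_if)
  have tk: "t0 k \<le> t k" "t k * \<zeta> k = T" "0 < t k" if k: "k \<in> K" for k
  proof -
    have "\<zeta> k * t0 k \<le> (\<Sum>k\<in>K. \<zeta> k * t0 k)"
      by (rule member_le_sum[OF k _ K(2)]) (use pos in \<open>simp add: less_imp_le\<close>)
    then have "\<zeta> k * t0 k \<le> T" unfolding T_def by simp
    then show "t0 k \<le> t k" "t k * \<zeta> k = T" "0 < t k"
      using pos[OF k] T(1) unfolding t_def by (simp_all add: field_simps)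
  qed
  define \<beta> where "\<beta> k y = lam + t k * \<eta> k y" for k y
  \<comment> \<open>The candidates at \<open>y\<close>: each barrier on its own domain, and the
    shifted \<open>w\<close> off \<open>N\<close> only, where it is bounded above. In
    \<open>N\<close> some barrier is present, so the maximum exists.\<close>
  define \<T> where "\<T> y = (\<lambda>k. ereal (\<beta> k y)) ` {k \<in> K. y \<in> B k} \<union> (if y \<in> N then {} else {w y + ereal (- C)})" for y
  define w0 where "w0 y = Max (\<T> y)" for y
  have fin: "finite (\<T> y)" for y using K(2) by (simp add: \<T>_def)
  have ne: "\<T> y \<noteq> {}" for y unfolding \<T>_def N_def O'_def by auto
  have w0_in: "w0 y \<in> \<T> y" for y unfolding w0_def by (rule Max_in[OF fin ne])
  have w0_ge: "z \<le> w0 y" if "z \<in> \<T> y" for y z unfolding w0_def by (rule Max_ge[OF fin that])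
  have \<beta>w0: "ereal (\<beta> k y) \<le> w0 y" if "k \<in> K" "y \<in> B k" for k y
    by (rule w0_ge) (use that in \<open>simp add: \<T>_def\<close>)
  have ww0: "w y + ereal (- C) \<le> w0 y" if "y \<notin> N" for y by (rule w0_ge) (use that in \<open>simp add: \<T>_def\<close>)
  have inN: "ereal (lam - T) < w0 y" if yN: "y \<in> N" for y
  proof -
    obtain k where k: "k \<in> K" "y \<in> B k" "- \<zeta> k < \<eta> k y" using yN unfolding N_def O'_def by auto
    have "t k * (- \<zeta> k) < t k * \<eta> k y" using tk(3)[OF k(1)] k(3) by (rule mult_strict_left_mono[rotated])
    then have "lam - T < \<beta> k y" using tk(2)[OF k(1)] by (simp add: \<beta>_def)
    then show ?thesis using \<beta>w0[OF k(1,2)] by (metis ereal_less(2) less_ereal.simps(1) less_le_trans)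
  qed
  have outN: "w y + ereal (- C) < ereal (lam - T)" if "y \<in> ?S" "y \<notin> N" for y
    using M[of y] that T(3) by (cases "w y") auto
  have low: "ereal (lam - 2 * T) < w0 y" if y: "y \<in> ?S" for y
  proof (cases "y \<in> N")
    case True
    have "ereal (lam - 2 * T) \<le> ereal (lam - T)" using T(1) by simp
    then show ?thesis using inN[OF True] by (rule le_less_trans)
  next
    case False
    have "ereal a \<le> w y" using w(2) QU y False by blast
    then have "ereal (lam - 2 * T) < w y + ereal (- C)" using T(4) by (cases "w y") auto
    then show ?thesis using ww0[OF False] by (rule less_le_trans)
  qed
  have rim: "ereal (\<beta> k y) \<le> ereal (lam - 2 * T)" if k: "k \<in> K" and y: "y \<in> B k - L k" "y \<in> ?S" for k y
  proof -
    have "t k * \<eta> k y \<le> t k * (- 2 * \<zeta> k)"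
      using local_barrierD(8)[OF lbK[OF k] y] tk(3)[OF k] by (intro mult_left_mono) auto
    then show ?thesis using tk(2)[OF k] by (simp add: \<beta>_def algebra_simps)
  qed
  have usc: "usc_on ?S w0" unfolding usc_on_iff
  proof (intro ballI conjI allI impI)
    fix x assume x: "x \<in> ?S"
    have "w x < \<infinity>" if "x \<notin> N" using usc_onD[OF wU] QU x that by blast
    then show "w0 x < \<infinity>" using w0_in[of x] unfolding \<T>_def by (auto split: if_splits)
    fix b assume b: "w0 x < b"
    have "\<exists>V. open V \<and> x \<in> V \<and> (\<forall>k\<in>K. \<forall>y\<in>V \<inter> ?S. y \<in> B k \<longrightarrow> ereal (\<beta> k y) < b)"
    proof (rule usc_on_finite_glue[OF K(2), where L=L])
      fix k assume k: "k \<in> K"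
      note D = local_barrierD[OF lbK[OF k]]
      show "open (B k)" "closed (L k)" "L k \<subseteq> B k" by (fact D)+
      show "continuous_on (B k) (\<beta> k)" unfolding \<beta>_def by (intro continuous_intros D(5))
      show "ereal (\<beta> k x) < b" if "x \<in> B k" using \<beta>w0[OF k that] b by (rule le_less_trans)
      show "ereal (\<beta> k y) < b" if "y \<in> (B k - L k) \<inter> ?S" for y
        using le_less_trans[OF rim[OF k, of y] less_trans[OF low[OF x] b]] that by blast
    qed
    then obtain V where V: "open V" "x \<in> V" "\<forall>k\<in>K. \<forall>y\<in>V \<inter> ?S. y \<in> B k \<longrightarrow> ereal (\<beta> k y) < b" by blast
    have "\<exists>V'. open V' \<and> x \<in> V' \<and> (\<forall>y\<in>V' \<inter> ?S. y \<notin> N \<longrightarrow> w y + ereal (- C) < b)"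
    proof (cases "x \<in> N")
      case True
      then show ?thesis using N(1) by blast
    next
      case False
      then have xU: "x \<in> U" using QU x by blast
      have "usc_on U (\<lambda>y. w y + ereal (- C))" by (rule usc_on_add_continuous[OF wU]) simp
      from usc_on_nbhd[OF this xU le_less_trans[OF ww0[OF False] b]]
      obtain V' where V': "open V'" "x \<in> V'" "\<forall>y\<in>V' \<inter> U. w y + ereal (- C) < b" by blast
      then show ?thesis using xU U(1) by (intro exI[of _ "V' \<inter> U"]) auto
    qed
    then obtain V' where V': "open V'" "x \<in> V'" "\<forall>y\<in>V' \<inter> ?S. y \<notin> N \<longrightarrow> w y + ereal (- C) < b" by blast
    have "w0 y < b" if y: "y \<in> (V \<inter> V') \<inter> ?S" for y
    proof -
      have "z < b" if "z \<in> \<T> y" for z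
        using that V(3) V'(3) y unfolding \<T>_def by (auto split: if_splits)
      then show ?thesis using w0_in by blast
    qed
    then show "\<exists>V. open V \<and> x \<in> V \<and> (\<forall>y\<in>V \<inter> ?S. w0 y < b)"
      using V V' by (intro exI[of _ "V \<inter> V'"]) auto
  qed
  have sub: "subharmonic_on \<A> g G U w0"
  proof (rule subharmonic_pieces[OF usc_on_subset[OF usc closure_subset]])
    fix x assume x: "x \<in> U"
    consider k where "k \<in> K" "x \<in> B k" "w0 x = ereal (\<beta> k x)" | "x \<notin> N" "w0 x = w x + ereal (- C)"
      using w0_in[of x] unfolding \<T>_def by (auto split: if_splits)
    then show "\<exists>W f. open W \<and> x \<in> W \<and> W \<subseteq> U \<and> subharmonic_on \<A> g G W f \<and> (\<forall>y\<in>W. f y \<le> w0 y) \<and> f x = w0 x"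
    proof cases
      case 1
      note D = local_barrierD[OF lbK[OF 1(1)]]
      have "subharmonic_on \<A> g G (B k \<inter> U) (\<lambda>y. ereal (\<beta> k y))"
        unfolding \<beta>_def by (rule D(11)[OF tk(1)[OF 1(1)] order_refl])
      then show ?thesis using 1 x D(1) U(1) \<beta>w0[OF 1(1)]
        by (intro exI[of _ "B k \<inter> U"] exI[of _ "\<lambda>y. ereal (\<beta> k y)"]) auto
    next
      case 2
      have sh: "subharmonic_on \<A> g G U (\<lambda>y. w y + ereal (- C))"
        by (rule subharmonic_shift[OF w(1) G]) (use T(2) in simp)
      have "x \<in> ?S" using x closure_subset by blast
      from usc_on_nbhd[OF subharmonic_on_usc[OF sh] x outN[OF this 2(1)]]
      obtain V where V: "open V" "x \<in> V" "\<forall>y\<in>V \<inter> U. w y + ereal (- C) < ereal (lam - T)" by blast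
      \<comment> \<open>Inside \<open>N\<close> the shifted \<open>w\<close> is not a candidate; but
        near \<open>x\<close> semicontinuity keeps it below \<open>lam - T\<close>, hence below
        \<open>w0\<close> there.\<close>
      have "w y + ereal (- C) \<le> w0 y" if y: "y \<in> V \<inter> U" for y
      proof (cases "y \<in> N")
        case True
        have "w y + ereal (- C) < w0 y" using V(3) y inN[OF True] by (meson less_trans)
        then show ?thesis by (rule less_imp_le)
      next
        case False
        then show ?thesis by (rule ww0)
      qed
      moreover have "subharmonic_on \<A> g G (V \<inter> U) (\<lambda>y. w y + ereal (- C))"
        by (rule subharmonic_on_subset[OF sh]) simp
      ultimately show ?thesis using 2 x V U(1)
        by (intro exI[of _ "V \<inter> U"] exI[of _ "\<lambda>y. w y + ereal (- C)"]) auto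
    qed
  qed
  have bd: "w0 x \<le> ereal lam" if x: "x \<in> ?S - U" for x
  proof -
    have "x \<in> N" using x N(2) by blast
    then obtain k where k: "k \<in> K" "x \<in> B k" "w0 x = ereal (\<beta> k x)"
      using w0_in[of x] unfolding \<T>_def by auto
    have "t k * \<eta> k x \<le> 0"
      using local_barrierD(7)[OF lbK[OF k(1)] k(2)] x tk(3)[OF k(1)] by (intro mult_nonneg_nonpos) auto
    then show ?thesis using k(3) by (simp add: \<beta>_def)
  qed
  show ?thesis
    using usc sub low bd by (intro exI[of _ w0] exI[of _ "lam - 2 * T"]) (auto intro: less_imp_le)
qed

section \<open>Competitors of the Dirichlet problem and boundary barriers\<close>

definition competitor :: "('m, 'e) jet set \<Rightarrow> 'm set \<Rightarrow> ('m \<Rightarrow> real) \<Rightarrow> ('m \<Rightarrow> ereal) \<Rightarrow> bool" where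
  "competitor G U h v \<longleftrightarrow> usc_on (closure U) v \<and> subharmonic_on \<A> g G U v \<and> (\<forall>x\<in>closure U - U. v x \<le> ereal (h x))"

context
  fixes G U \<C> \<phi> h w a
  assumes G: "monotone_jets \<A> G" and U: "open U" "compact (closure U)"
    and part: "partition_on (bdry \<A> (closure U)) \<C>" and surj: "fst ` bdry \<A> (closure U) = closure U - U"
    and conv: "strictly_convex_boundary \<A> g G U \<C> \<phi>"
    and h: "continuous_on (closure U - U) h" "\<And>b. b \<in> bdry \<A> (closure U) \<Longrightarrow> \<phi> b = h (fst b)"
    and w: "subharmonic_on \<A> g G U w" "\<And>x. x \<in> U \<Longrightarrow> ereal a \<le> w x"
begin

lemma subsolution_competitor:
  assumes "subsolution \<A> g G U \<phi> v"
  shows "competitor G U h v"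
proof -
  have "v x \<le> ereal (h x)" if x: "x \<in> closure U - U" for x
  proof -
    obtain b where b: "b \<in> bdry \<A> (closure U)" "fst b = x" using x unfolding surj[symmetric] by blast
    then show ?thesis using assms h(2)[OF b(1)] unfolding subsolution_def by auto
  qed
  then show ?thesis using assms unfolding subsolution_def competitor_def by blast
qed

text \<open>If some component supplies subsolutions, any of them is continuous on a compact set and
  so bounded. Otherwise every boundary point has a barrier of height \<open>- M\<close>, below all
  values of \<open>h\<close>, and the given \<open>w\<close> is modified near the boundary.\<close>

lemma bounded_competitor: "\<exists>w0 a'. competitor G U h w0 \<and> (\<forall>x\<in>closure U. ereal a' \<le> w0 x)"
proof -
  obtain \<C>A \<C>B where *: "\<C>A \<union> \<C>B = \<C> \<and> \<C>A \<inter> \<C>B = {} \<and>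
        (\<forall>b \<in> \<Union>\<C>A. \<forall>\<delta>>0. \<exists>w :: 'm \<Rightarrow> real. continuous_on (closure U) w \<and>
           subsolution \<A> g G U \<phi> (\<lambda>x. ereal (w x)) \<and>
           delta_maximal \<phi> \<delta> b (\<lambda>x. ereal (w x))) \<and>
        (\<forall>C \<in> \<C>B. strictly_convex_component \<A> g G U C)"
    using conv unfolding strictly_convex_boundary_def by (elim exE) (rule that)
  note AB = *[THEN conjunct1] and A = *[THEN conjunct2, THEN conjunct2, THEN conjunct1, rule_format]
    and B = *[THEN conjunct2, THEN conjunct2, THEN conjunct2, THEN bspec]
  show ?thesis
  proof (cases "\<Union>\<C>A = {}")
    case False
    then obtain b where "b \<in> \<Union>\<C>A" by blast
    from A[OF this zero_less_one] obtain w1 :: "'m \<Rightarrow> real" where w1: "continuous_on (closure U) w1"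
      "subsolution \<A> g G U \<phi> (\<lambda>x. ereal (w1 x))" by blast
    have "bounded (w1 ` closure U)" by (rule compact_imp_bounded[OF compact_continuous_image[OF w1(1) U(2)]])
    then obtain M where M: "\<And>x. x \<in> closure U \<Longrightarrow> \<bar>w1 x\<bar> \<le> M" unfolding bounded_real by blast
    have "\<forall>x\<in>closure U. ereal (- M) \<le> ereal (w1 x)" using M by (fastforce simp: abs_le_iff)
    then show ?thesis using subsolution_competitor[OF w1(2)] by blast
  next
    case True
    have "compact (closure U - U)" using U by (intro compact_diff)
    from compact_imp_bounded[OF compact_continuous_image[OF h(1) this]]
    obtain M where M: "\<And>x. x \<in> closure U - U \<Longrightarrow> \<bar>h x\<bar> \<le> M" unfolding bounded_real by blast
    have "\<exists>B L \<eta> \<zeta> t0. local_barrier G U (- M) x B L \<eta> \<zeta> t0" if x: "x \<in> closure U - U" for x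
    proof -
      obtain b where b: "b \<in> bdry \<A> (closure U)" "fst b = x" using x unfolding surj[symmetric] by blast
      obtain C where C: "C \<in> \<C>" "b \<in> C" using b(1) part unfolding partition_on_def by blast
      have "C \<in> \<C>B" using C AB True by blast
      from local_barrier_exists[OF G U(1) B[OF this], of x UNIV "- M"] show ?thesis
        using C(2) b(2) x by blast
    qed
    from bounded_subharmonic_exists[OF G U w this] obtain w0 a' where w0: "usc_on (closure U) w0"
        "subharmonic_on \<A> g G U w0" "\<forall>x\<in>closure U. ereal a' \<le> w0 x"
        "\<forall>x\<in>closure U - U. w0 x \<le> ereal (- M)" by blast
    have "w0 x \<le> ereal (h x)" if "x \<in> closure U - U" for x
    proof -
      have "ereal (- M) \<le> ereal (h x)" using M[OF that] by simp
      then show ?thesis using w0(4) that order_trans by blast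
    qed
    then show ?thesis using w0 unfolding competitor_def by blast
  qed
qed

text \<open>On a component with subsolutions, a \<open>\<delta> / 2\<close>-maximal one works near
  \<open>x\<close> by continuity. On a strictly convex one, a steep local barrier of height
  \<open>h x - \<delta> / 2\<close> is glued to the bounded competitor.\<close>

lemma boundary_barrier:
  assumes x: "x \<in> closure U - U" and \<delta>: "0 < \<delta>"
  shows "\<exists>v V. competitor G U h v \<and> open V \<and> x \<in> V \<and> (\<forall>y\<in>V \<inter> closure U. ereal (h x - \<delta>) \<le> v y)"
proof -
  obtain \<C>A \<C>B where *: "\<C>A \<union> \<C>B = \<C> \<and> \<C>A \<inter> \<C>B = {} \<and>
        (\<forall>b \<in> \<Union>\<C>A. \<forall>\<delta>>0. \<exists>w :: 'm \<Rightarrow> real. continuous_on (closure U) w \<and>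
           subsolution \<A> g G U \<phi> (\<lambda>x. ereal (w x)) \<and>
           delta_maximal \<phi> \<delta> b (\<lambda>x. ereal (w x))) \<and>
        (\<forall>C \<in> \<C>B. strictly_convex_component \<A> g G U C)"
    using conv unfolding strictly_convex_boundary_def by (elim exE) (rule that)
  note AB = *[THEN conjunct1] and A = *[THEN conjunct2, THEN conjunct2, THEN conjunct1, rule_format]
    and B = *[THEN conjunct2, THEN conjunct2, THEN conjunct2, THEN bspec]
  obtain b where b: "b \<in> bdry \<A> (closure U)" "fst b = x" using x unfolding surj[symmetric] by blast
  obtain C where C: "C \<in> \<C>" "b \<in> C" using b(1) part unfolding partition_on_def by blast
  show ?thesis
  proof (cases "C \<in> \<C>A")
    case True
    then have "b \<in> \<Union>\<C>A" using C(2) by blast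
    moreover have "0 < \<delta> / 2" using \<delta> by simp
    ultimately obtain w1 :: "'m \<Rightarrow> real" where w1: "continuous_on (closure U) w1"
      "subsolution \<A> g G U \<phi> (\<lambda>x. ereal (w1 x))" "delta_maximal \<phi> (\<delta> / 2) b (\<lambda>x. ereal (w1 x))"
      using A by blast
    have "h x - \<delta> / 2 \<le> w1 x" using w1(3) b(2) h(2)[OF b(1)] by (simp add: delta_maximal_def)
    then have "w1 x \<in> {h x - \<delta><..}" using \<delta> by simp
    moreover have "x \<in> closure U" using x by blast
    ultimately obtain V where V: "open V" "x \<in> V" "\<forall>y\<in>closure U. y \<in> V \<longrightarrow> w1 y \<in> {h x - \<delta><..}"
      using w1(1) unfolding continuous_on_topological by (meson open_greaterThan)
    have "\<forall>y\<in>V \<inter> closure U. ereal (h x - \<delta>) \<le> ereal (w1 y)" using V(3) by (auto intro: less_imp_le)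
    then show ?thesis using subsolution_competitor[OF w1(2)] V(1,2) by blast
  next
    case False
    then have CB: "C \<in> \<C>B" using C AB by blast
    \<comment> \<open>The barrier is confined to a set where \<open>h\<close> exceeds its height, so
      its boundary values stay below \<open>h\<close>.\<close>
    have "h x \<in> {h x - \<delta> / 2<..}" using \<delta> by simp
    then obtain W0 where W0: "open W0" "x \<in> W0" "\<forall>y\<in>closure U - U. y \<in> W0 \<longrightarrow> h y \<in> {h x - \<delta> / 2<..}"
      using h(1) x unfolding continuous_on_topological by (meson open_greaterThan)
    have xC: "x \<in> fst ` C" using C(2) b(2) by blast
    have xS: "x \<in> closure U" using x by blast
    obtain B1 L \<eta> \<zeta> t0 where lb: "local_barrier G U (h x) x B1 L \<eta> \<zeta> t0" and B1: "B1 \<subseteq> W0"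
      using local_barrier_exists[OF G U(1) B[OF CB] xC xS W0(1,2), of "h x"] by blast
    note D = local_barrierD[OF lb]
    obtain w0 a' where w0: "competitor G U h w0" "\<And>y. y \<in> closure U \<Longrightarrow> ereal a' \<le> w0 y"
      using bounded_competitor by blast
    \<comment> \<open>Steep enough that the barrier drops below the lower bound \<open>a'\<close> of
      \<open>w0\<close> on the rim.\<close>
    define t where "t = max t0 (\<bar>h x - a'\<bar> / (2 * \<zeta>))"
    have "\<bar>h x - a'\<bar> / (2 * \<zeta>) \<le> t" by (simp add: t_def)
    then have "\<bar>h x - a'\<bar> \<le> t * (2 * \<zeta>)" using D(9) by (subst (asm) pos_divide_le_eq) simp
    moreover have "t0 \<le> t" by (simp add: t_def)
    ultimately have t: "t0 \<le> t" "0 < t" "\<bar>h x - a'\<bar> \<le> 2 * \<zeta> * t"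
      using D(10) by (simp_all add: mult.commute)
    define \<beta> where "\<beta> y = (h x - \<delta> / 2) + t * \<eta> y" for y
    have \<beta>sub: "subharmonic_on \<A> g G (B1 \<inter> U) (\<lambda>y. ereal (\<beta> y))"
      unfolding \<beta>_def by (rule D(11)[OF t(1)]) (use \<delta> in simp)
    have \<beta>c: "continuous_on B1 \<beta>" unfolding \<beta>_def by (intro continuous_intros D(5))
    have \<beta>le: "ereal (\<beta> y) \<le> w0 y" if y: "y \<in> (B1 - L) \<inter> closure U" for y
    proof -
      have "t * \<eta> y \<le> t * (- 2 * \<zeta>)" using D(8)[of y] y t(2) by (intro mult_left_mono) auto
      then have "\<beta> y \<le> a'" using t(3) \<delta> by (simp add: \<beta>_def algebra_simps abs_if split: if_splits)
      then show ?thesis using w0(2)[of y] y by (meson IntD2 ereal_less_eq(3) order_trans)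
    qed
    define v where "v = (\<lambda>y. if y \<in> B1 then max (w0 y) (ereal (\<beta> y)) else w0 y)"
    have w0': "usc_on (closure U) w0" "subharmonic_on \<A> g G U w0" "\<And>y. y \<in> closure U - U \<Longrightarrow> w0 y \<le> ereal (h y)"
      using w0(1) unfolding competitor_def by blast+
    have v: "usc_on (closure U) v" "subharmonic_on \<A> g G U v"
      unfolding v_def by (rule max_glue[OF U(1) closure_subset w0'(1,2) D(1,3,4) \<beta>c \<beta>sub \<beta>le]; assumption)+
    have "v y \<le> ereal (h y)" if y: "y \<in> closure U - U" for y
    proof (cases "y \<in> B1")
      case True
      have "h x - \<delta> / 2 < h y" using W0(3) B1 True y by auto
      moreover have "t * \<eta> y \<le> 0" using D(7)[OF True] y t(2) by (intro mult_nonneg_nonpos) auto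
      ultimately have "\<beta> y \<le> h y" by (simp add: \<beta>_def)
      then show ?thesis using w0'(3)[OF y] by (simp add: v_def)
    next
      case False
      then show ?thesis using w0'(3)[OF y] by (simp add: v_def)
    qed
    then have comp: "competitor G U h v" using v unfolding competitor_def by blast
    have "open (B1 \<inter> \<beta> -` {h x - \<delta><..})" by (rule continuous_open_preimage[OF \<beta>c D(1)]) simp
    moreover have "x \<in> B1 \<inter> \<beta> -` {h x - \<delta><..}" using D(2,6) \<delta> by (simp add: \<beta>_def)
    moreover have "ereal (h x - \<delta>) \<le> v y" if "y \<in> B1 \<inter> \<beta> -` {h x - \<delta><..}" for y
      using that by (auto simp: v_def le_max_iff_disj intro: less_imp_le)
    ultimately show ?thesis using comp by blast
  qed
qed

end

end

section \<open>Perron's method\<close>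

lemma subharmonic_on_cong:
  assumes "subharmonic_on \<A> g F V u" "open V" "\<And>x. x \<in> V \<Longrightarrow> u x = v x"
  shows "subharmonic_on \<A> g F V v"
proof (rule subharmonic_pieces)
  have "{x \<in> V. u x < a} = {x \<in> V. v x < a}" for a using assms(3) by auto
  then show "usc_on V v"
    using subharmonic_on_usc[OF assms(1)] assms(3) unfolding usc_on_def by simp
  show "\<exists>W f. open W \<and> x \<in> W \<and> W \<subseteq> V \<and> subharmonic_on \<A> g F W f \<and> (\<forall>y\<in>W. f y \<le> v y) \<and> f x = v x"
    if "x \<in> V" for x
    using assms that by (intro exI[of _ V] exI[of _ u]) auto
qed

lemma continuous_on_if_usc:
  fixes f :: "'m::topological_space \<Rightarrow> real"
  assumes "usc_on S (\<lambda>x. ereal (f x))" "usc_on S (\<lambda>x. ereal (- f x))"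
  shows "continuous_on S f"
proof -
  have "openin (top_of_set S) {x \<in> S. f x < a}" for a
    using assms(1)[unfolded usc_on_def, THEN conjunct2, THEN spec, of "ereal a"] by simp
  moreover have "openin (top_of_set S) {x \<in> S. f x > a}" for a
    using assms(2)[unfolded usc_on_def, THEN conjunct2, THEN spec, of "ereal (- a)"] by simp
  ultimately have "continuous_map (top_of_set S) euclideanreal f"
    unfolding continuous_map_upper_lower_semicontinuous_lt by simp
  then show ?thesis by simp
qed

context riemannian
begin

lemma competitorD:
  assumes "competitor G U h v"
  shows "usc_on (closure U) v" "subharmonic_on \<A> g G U v" "\<And>x. x \<in> closure U - U \<Longrightarrow> v x \<le> ereal (h x)"
  using assms unfolding competitor_def by blast+

text \<open>Comparison refers to the interior and the frontier of a compact set;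
  \<open>interior (closure U) = U\<close> turns these into \<open>U\<close> and
  \<open>closure U - U\<close>.\<close>

lemma compare:
  assumes comp: "comparison_holds \<A> g F" and U: "compact (closure U)" "interior (closure U) = U"
    and u: "usc_on (closure U) u" "subharmonic_on \<A> g F U u"
    and v: "usc_on (closure U) v" "subharmonic_on \<A> g (dual_subequation \<A> F) U v"
    and bd: "\<And>x. x \<in> closure U - U \<Longrightarrow> u x + v x \<le> 0" and x: "x \<in> closure U"
  shows "u x + v x \<le> 0"
proof -
  have "subharmonic_on_compact \<A> g F (closure U) u" "subharmonic_on_compact \<A> g (dual_subequation \<A> F) (closure U) v"
    unfolding subharmonic_on_compact_def U(2) using u v by auto
  moreover have "\<forall>x\<in>frontier (closure U). u x + v x \<le> 0"
    using bd unfolding frontier_def U(2) by simp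
  ultimately show ?thesis using comp U(1) x unfolding comparison_holds_def by blast
qed

lemma perron_solution:
  assumes F: "subequation \<A> F" and comp: "comparison_holds \<A> g F"
    and U: "open U" "compact (closure U)" "interior (closure U) = U"
    and w0: "competitor F U h w0" "\<And>x. x \<in> closure U \<Longrightarrow> ereal a0 \<le> w0 x"
    and v0: "competitor (dual_subequation \<A> F) U (\<lambda>x. - h x) v0" "\<And>x. x \<in> closure U \<Longrightarrow> ereal b0 \<le> v0 x"
    and lower: "\<And>x \<delta>. x \<in> closure U - U \<Longrightarrow> 0 < \<delta> \<Longrightarrow> \<exists>v V. competitor F U h v \<and> open V \<and> x \<in> V \<and>
      (\<forall>y\<in>V \<inter> closure U. ereal (h x - \<delta>) \<le> v y)"
    and upper: "\<And>x \<delta>. x \<in> closure U - U \<Longrightarrow> 0 < \<delta> \<Longrightarrow> \<exists>v V. competitor (dual_subequation \<A> F) U (\<lambda>x. - h x) v \<and>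
      open V \<and> x \<in> V \<and> (\<forall>y\<in>V \<inter> closure U. ereal (- h x - \<delta>) \<le> v y)"
  shows "\<exists>f. continuous_on (closure U) f \<and> harmonic_on \<A> g F U (\<lambda>x. ereal (f x)) \<and> (\<forall>x\<in>closure U - U. f x = h x)"
proof -
  let ?S = "closure U" and ?D = "dual_subequation \<A> F"
  have US: "U \<subseteq> ?S" by (rule closure_subset)
  have pair: "w x + v x \<le> 0" if w: "competitor F U h w" and v: "competitor ?D U (\<lambda>x. - h x) v" and x: "x \<in> ?S" for w v x
  proof (rule compare[OF comp U(2,3) competitorD(1,2)[OF w] competitorD(1,2)[OF v] _ x])
    fix y assume y: "y \<in> ?S - U"
    have "w y + v y \<le> ereal (h y) + ereal (- h y)"
      by (rule add_mono[OF competitorD(3)[OF w y] competitorD(3)[OF v y]])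
    then show "w y + v y \<le> 0" by (simp add: zero_ereal_def)
  qed
  have above: "w x \<le> ereal (- b)"
    if w: "competitor F U h w" and v: "competitor ?D U (\<lambda>x. - h x) v" "ereal b \<le> v x" and x: "x \<in> ?S" for w v x b
  proof -
    have "w x + v x \<le> 0" by (rule pair[OF w v(1) x])
    then show ?thesis using v(2) by (cases "w x"; cases "v x") auto
  qed
  define \<F> where "\<F> = {w. competitor F U h w}"
  define P where "P = (\<lambda>y. SUP w\<in>\<F>. w y)"
  define u where "u = usc_reg ?S P"
  have P_ge: "w y \<le> P y" if "competitor F U h w" for w y
    unfolding P_def by (rule SUP_upper) (use that in \<open>simp add: \<F>_def\<close>)
  have P_le: "P y \<le> b" if "\<And>w. competitor F U h w \<Longrightarrow> w y \<le> b" for y b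
    unfolding P_def by (rule SUP_least) (use that in \<open>simp add: \<F>_def\<close>)
  have Pu: "P y \<le> u y" if "y \<in> ?S" for y unfolding u_def by (rule usc_reg_ge[OF that])
  \<comment> \<open>A bounded-below competitor of the dual problem caps all members of the Perron
    family uniformly, so the regularization is finite.\<close>
  have u_le: "u x \<le> ereal (- b0)" for x unfolding u_def
  proof (rule usc_reg_le_nbhd[of UNIV])
    show "P y \<le> ereal (- b0)" if "y \<in> UNIV \<inter> ?S" for y
      by (rule P_le, rule above[OF _ v0(1) v0(2)]) (use that in auto)
  qed auto
  have u_ge: "ereal a0 \<le> u x" if "x \<in> ?S" for x
    using w0(2)[OF that] P_ge[OF w0(1), of x] Pu[OF that] by (meson order_trans)
  have u_fin: "u x < \<infinity>" for x using u_le[of x] by (auto simp: less_top[symmetric] top_ereal_def)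
  have u_usc: "usc_on ?S u" unfolding u_def by (rule usc_reg_usc) (use u_fin in \<open>simp add: u_def\<close>)
  have u_sub: "subharmonic_on \<A> g F U u"
    unfolding u_def P_def
    by (rule usc_reg_Sup_subharmonic[OF subequation_closed[OF F] U(1) US])
       (use competitorD(2) u_fin in \<open>auto simp: \<F>_def u_def P_def\<close>)
  \<comment> \<open>A dual competitor close to \<open>- h x\<close> on a whole neighbourhood of
    \<open>x\<close> bounds all members there at once; such a bound passes to the
    regularization.\<close>
  have u_bd: "u x \<le> ereal (h x)" if x: "x \<in> ?S - U" for x
  proof (rule ereal_le_epsilon2)
    fix \<delta> :: real assume \<delta>: "0 < \<delta>"
    obtain v V where v: "competitor ?D U (\<lambda>x. - h x) v" "open V" "x \<in> V"
      "\<forall>y\<in>V \<inter> ?S. ereal (- h x - \<delta>) \<le> v y" using upper[OF x \<delta>] by blast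
    have "u x \<le> ereal (- (- h x - \<delta>))" unfolding u_def
    proof (rule usc_reg_le_nbhd[OF v(2,3)])
      show "P y \<le> ereal (- (- h x - \<delta>))" if "y \<in> V \<inter> ?S" for y
        by (rule P_le, rule above[OF _ v(1)]) (use that v(4) in auto)
    qed
    then show "u x \<le> ereal (h x) + ereal \<delta>" by (simp add: add.commute)
  qed
  \<comment> \<open>The regularized supremum belongs to the family itself, so it is the largest
    competitor.\<close>
  have u_comp: "competitor F U h u" unfolding competitor_def using u_usc u_sub u_bd by blast
  define v where "v = usc_reg ?S (\<lambda>y. - u y)"
  have v_ge: "- u x \<le> v x" if "x \<in> ?S" for x unfolding v_def by (rule usc_reg_ge[OF that])
  have v_fin: "v x < \<infinity>" for x
  proof -
    have "v x \<le> ereal (- a0)" unfolding v_def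
    proof (rule usc_reg_le_nbhd[of UNIV])
      show "- u y \<le> ereal (- a0)" if "y \<in> UNIV \<inter> ?S" for y
        using u_ge[of y] that by (cases "u y") auto
    qed auto
    then show ?thesis by (auto simp: less_top[symmetric] top_ereal_def)
  qed
  have v_usc: "usc_on ?S v" unfolding v_def by (rule usc_reg_usc) (use v_fin in \<open>simp add: v_def\<close>)
  have v_sub: "subharmonic_on \<A> g ?D U v" unfolding v_def
  proof (rule maximal_dual_subharmonic[OF U(1) US])
    show "usc_reg ?S (\<lambda>y. - u y) x < \<infinity>" for x using v_fin by (simp add: v_def)
    fix f B L y
    assume B: "open B" "B \<subseteq> U" "closed L" "L \<subseteq> B" and f: "Ck_fun_on \<A> 2 B f" "\<And>y. y \<in> B \<Longrightarrow> jet2 \<A> g y f \<in> F"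
      and le: "\<And>y. y \<in> B - L \<Longrightarrow> ereal (f y) \<le> u y" and y: "y \<in> B"
    \<comment> \<open>Inserting the bump changes \<open>u\<close> inside \<open>U\<close> only, so
      the result is a competitor, and \<open>u\<close> dominates it.\<close>
    define u' where "u' = (\<lambda>y. if y \<in> B then max (u y) (ereal (f y)) else u y)"
    have BU: "B \<inter> U = B" using B(2) by blast
    have f': "subharmonic_on \<A> g F (B \<inter> U) (\<lambda>y. ereal (f y))"
      unfolding BU by (rule C2_subharmonic[OF B(1) f(1) subequation_monotone[OF F] f(2)])
    have le': "ereal (f y) \<le> u y" if "y \<in> (B - L) \<inter> ?S" for y using le that by blast
    have "usc_on ?S u'" "subharmonic_on \<A> g F U u'"
      unfolding u'_def
      by (rule max_glue[OF U(1) US u_usc u_sub B(1,3,4) C2_continuous[OF B(1) f(1)] f' le']; assumption)+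
    moreover have "u' x \<le> ereal (h x)" if "x \<in> ?S - U" for x
      using u_bd[OF that] that B(2) by (auto simp: u'_def)
    ultimately have "competitor F U h u'" unfolding competitor_def by blast
    then have "u' y \<le> u y" using P_ge[of u' y] Pu[of y] y B(2) US by (meson order_trans subsetD)
    then show "ereal (f y) \<le> u y" using y by (simp add: u'_def)
  qed
  have v_bd: "v x \<le> ereal (- h x)" if x: "x \<in> ?S - U" for x
  proof (rule ereal_le_epsilon2)
    fix \<delta> :: real assume \<delta>: "0 < \<delta>"
    obtain w V where w: "competitor F U h w" "open V" "x \<in> V"
      "\<forall>y\<in>V \<inter> ?S. ereal (h x - \<delta>) \<le> w y" using lower[OF x \<delta>] by blast
    have "v x \<le> ereal (- h x + \<delta>)" unfolding v_def
    proof (rule usc_reg_le_nbhd[OF w(2,3)])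
      show "- u y \<le> ereal (- h x + \<delta>)" if y: "y \<in> V \<inter> ?S" for y
      proof -
        have "ereal (h x - \<delta>) \<le> w y" using w(4) y by blast
        also have "w y \<le> P y" by (rule P_ge[OF w(1)])
        also have "P y \<le> u y" by (rule Pu) (use y in blast)
        finally show ?thesis by (cases "u y") auto
      qed
    qed
    then show "v x \<le> ereal (- h x) + ereal \<delta>" by simp
  qed
  have v_comp: "competitor ?D U (\<lambda>x. - h x) v" unfolding competitor_def using v_usc v_sub v_bd by blast
  define f where "f x = real_of_ereal (u x)" for x
  have uf: "u x = ereal (f x)" if "x \<in> ?S" for x
    using u_ge[OF that] u_fin[of x] unfolding f_def by (cases "u x") auto
  \<comment> \<open>Comparison gives \<open>u + v \<le> 0\<close>, regularization gives
    \<open>- u \<le> v\<close>, and \<open>u\<close> is finite. Thus \<open>- u\<close> is upper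
    semicontinuous as well.\<close>
  have vf: "v x = ereal (- f x)" if x: "x \<in> ?S" for x
    using pair[OF u_comp v_comp x] v_ge[OF x] uf[OF x] by (cases "v x") auto
  have usc_f: "usc_on ?S (\<lambda>x. ereal (f x))"
    unfolding usc_on_iff using u_usc[unfolded usc_on_iff] uf by simp
  have usc_nf: "usc_on ?S (\<lambda>x. ereal (- f x))"
    unfolding usc_on_iff using v_usc[unfolded usc_on_iff] vf by simp
  have "continuous_on ?S f" by (rule continuous_on_if_usc[OF usc_f usc_nf])
  moreover have "subharmonic_on \<A> g F U (\<lambda>x. ereal (f x))"
    by (rule subharmonic_on_cong[OF u_sub U(1)]) (use uf US in blast)
  moreover have "subharmonic_on \<A> g ?D U (\<lambda>x. - ereal (f x))"
    by (rule subharmonic_on_cong[OF v_sub U(1)]) (use vf US in auto)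
  moreover have "f x = h x" if x: "x \<in> ?S - U" for x
    using u_bd[OF x] v_bd[OF x] uf[of x] vf[of x] x by auto
  ultimately show ?thesis unfolding harmonic_on_def by blast
qed

end

text \<open>Values off \<open>closure U\<close> are normalized by \<open>extensional\<close>, so
  that unique existence of a total function expresses uniqueness on the closure.\<close>

theorem theorem4p2p1:
  fixes \<A> :: "('m::{t2_space,second_countable_topology}, 'e::euclidean_space) chart set"
    and g :: "'m \<Rightarrow> ('m, 'e) tensor2"
    and F :: "('m, 'e) jet set"
    and U :: "'m set"
    and \<C> :: "'m bdry_point set set"
    and \<phi> :: "'m bdry_point \<Rightarrow> real"
  assumes "smooth_structure \<A>"
    and "riemannian_metric \<A> g"
    and "subequation \<A> F"
    and "comparison_holds \<A> g F"
    and "open U" and "connected U" and "U \<noteq> {}"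
    and "compact (closure U)"
    and "interior (closure U) = U"
    and "embedded_corners \<A> (closure U) \<C>"
    and "\<exists>w a. subharmonic_on \<A> g F U w \<and> (\<forall>x\<in>U. ereal a \<le> w x)"
    and "\<exists>w a. subharmonic_on \<A> g (dual_subequation \<A> F) U w \<and> (\<forall>x\<in>U. ereal a \<le> w x)"
    and "continuous_map (bdry_topology \<A> (closure U)) euclideanreal \<phi>"
    and "consistent \<A> (closure U) \<phi>"
    and "strictly_convex_boundary \<A> g F U \<C> \<phi>"
    and "strictly_convex_boundary \<A> g (dual_subequation \<A> F) U \<C> (\<lambda>b. - \<phi> b)"
  shows "\<exists>!u. u \<in> extensional (closure U) \<and> dirichlet_solution \<A> g F U \<phi> u"
proof -
  interpret riemannian \<A> g by unfold_locales (fact assms)+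
  let ?S = "closure U" and ?D = "dual_subequation \<A> F"
  have mwc: "manifold_with_corners \<A> ?S" and part: "partition_on (bdry \<A> ?S) \<C>"
    using assms(10) unfolding embedded_corners_def by blast+
  have surj: "fst ` bdry \<A> ?S = ?S - U" using fst_bdry[OF mwc] assms(9) by simp
  obtain h where "continuous_on (?S - interior ?S) h" and h: "\<And>b. b \<in> bdry \<A> ?S \<Longrightarrow> \<phi> b = h (fst b)"
    by (rule consistent_descends[OF mwc assms(13,14)]) blast
  then have hc: "continuous_on (?S - U) h" using assms(9) by simp
  have nhc: "continuous_on (?S - U) (\<lambda>x. - h x)" using hc by (intro continuous_intros)
  have nh: "- \<phi> b = - h (fst b)" if "b \<in> bdry \<A> ?S" for b using h[OF that] by simp
  obtain w a where w: "subharmonic_on \<A> g F U w" "\<And>x. x \<in> U \<Longrightarrow> ereal a \<le> w x" using assms(11) by blast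
  obtain w' a' where w': "subharmonic_on \<A> g ?D U w'" "\<And>x. x \<in> U \<Longrightarrow> ereal a' \<le> w' x" using assms(12) by blast
  note G = subequation_monotone[OF assms(3)] and G' = dual_monotone[OF assms(3)]
  obtain w0 a0 where w0: "competitor F U h w0" "\<And>x. x \<in> ?S \<Longrightarrow> ereal a0 \<le> w0 x"
    using bounded_competitor[OF G assms(5,8) part surj assms(15) hc h w] by blast
  obtain v0 b0 where v0: "competitor ?D U (\<lambda>x. - h x) v0" "\<And>x. x \<in> ?S \<Longrightarrow> ereal b0 \<le> v0 x"
    using bounded_competitor[OF G' assms(5,8) part surj assms(16) nhc nh w'] by blast
  obtain f where f: "continuous_on ?S f" "harmonic_on \<A> g F U (\<lambda>x. ereal (f x))" "\<And>x. x \<in> ?S - U \<Longrightarrow> f x = h x"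
    using perron_solution[OF assms(3,4,5,8,9) w0 v0 boundary_barrier[OF G assms(5,8) part surj assms(15) hc h w]
        boundary_barrier[OF G' assms(5,8) part surj assms(16) nhc nh w']] by blast
  have cong: "dirichlet_solution \<A> g F U \<phi> (restrict f ?S)"
    unfolding dirichlet_solution_def harmonic_on_def
  proof (intro conjI ballI)
    show "continuous_on ?S (restrict f ?S)" by (rule continuous_on_eq[OF f(1)]) simp
    show "subharmonic_on \<A> g F U (\<lambda>x. ereal (restrict f ?S x))"
      by (rule subharmonic_on_cong[OF f(2)[unfolded harmonic_on_def, THEN conjunct1] assms(5)])
         (use closure_subset in auto)
    show "subharmonic_on \<A> g ?D U (\<lambda>x. - ereal (restrict f ?S x))"
      by (rule subharmonic_on_cong[OF f(2)[unfolded harmonic_on_def, THEN conjunct2] assms(5)])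
         (use closure_subset in auto)
    fix b assume b: "b \<in> bdry \<A> ?S"
    then have "fst b \<in> ?S - U" unfolding surj[symmetric] by (rule imageI)
    then show "restrict f ?S (fst b) = \<phi> b" using f(3) h[OF b] by simp
  qed
  \<comment> \<open>One solution is compared, as a subharmonic function, with the negative of the
    other, which is subharmonic for the dual; exchanging them gives equality.\<close>
  have le: "u1 x \<le> u2 x" if u1: "dirichlet_solution \<A> g F U \<phi> u1" and u2: "dirichlet_solution \<A> g F U \<phi> u2" and x: "x \<in> ?S" for u1 u2 x
  proof -
    have D: "continuous_on ?S u1" "continuous_on ?S u2" "subharmonic_on \<A> g F U (\<lambda>x. ereal (u1 x))"
      "subharmonic_on \<A> g ?D U (\<lambda>x. - ereal (u2 x))"
      using u1 u2 unfolding dirichlet_solution_def harmonic_on_def by blast+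
    have n: "continuous_on ?S (\<lambda>x. - u2 x)" using D(2) by (intro continuous_intros)
    have "ereal (u1 x) + ereal (- u2 x) \<le> 0"
    proof (rule compare[OF assms(4,8,9) usc_on_ereal[OF D(1)] D(3) usc_on_ereal[OF n] _ _ x])
      show "subharmonic_on \<A> g ?D U (\<lambda>x. ereal (- u2 x))" using D(4) by simp
      fix y assume "y \<in> ?S - U"
      then obtain b where b: "b \<in> bdry \<A> ?S" "y = fst b" unfolding surj[symmetric] by blast
      have "u1 y = \<phi> b" "u2 y = \<phi> b" using u1 u2 b unfolding dirichlet_solution_def by blast+
      then show "ereal (u1 y) + ereal (- u2 y) \<le> 0" by simp
    qed
    then show ?thesis by simp
  qed
  show ?thesis
  proof (rule ex1I[of _ "restrict f ?S"])
    show "restrict f ?S \<in> extensional ?S \<and> dirichlet_solution \<A> g F U \<phi> (restrict f ?S)" using cong by simp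
    fix u assume u: "u \<in> extensional ?S \<and> dirichlet_solution \<A> g F U \<phi> u"
    show "u = restrict f ?S"
    proof (rule extensionalityI[of _ ?S])
      show "u x = restrict f ?S x" if "x \<in> ?S" for x
        using le[OF conjunct2[OF u] cong that] le[OF cong conjunct2[OF u] that] by simp
    qed (use u in auto)
  qed
qed

end
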